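(* Suppose that the distribution of $Z$ is circularly symmetric, i.e., that $Z$ and $\mathrm{e}^{\mathrm{i}\vartheta}Z$ have the same distribution for each $\vartheta\in\Theta$ (hypothesis $H_0$). Then, as $n\to\infty$, $T_n$ converges in distribution to \[ T_\infty:=\|V\|_{\mathbb{H}}^2=\int_\Theta\int_{\mathbb{R}^{2d}}V^2(s,\vartheta)\,w(\|s\|)\,\mathrm{d}s\,\mathrm{d}\vartheta, \] where $V$ is a centred Gaussian random element of $\mathbb{H}$ with covariance kernel \[ K(s,\vartheta;t,\eta)=\mathbb{E}[V(s,\vartheta)V(t,\eta)]=\mathbb{E}\big[\ell(W,s,\vartheta)\,\ell(W,t,\eta)\big],\qquad s,t\in\mathbb{R}^{2d},\ \vartheta,\eta\in\Theta . \]
   Context: Let $d\ge 1$ be a fixed integer, $\Theta:=[-\pi,\pi)$, and let $Z,Z_1,Z_2,\ldots$ be independent and identically distributed $\mathbb{C}^d$-valued random vectors defined on a common probability space $(\Omega,\mathcal{A},\mathbb{P})$. For $z=(z_1,\ldots,z_d)^\top\in\mathbb{C}^d$ put $\mathrm{RI}(z):=(\mathrm{Re}\,z_1,\ldots,\mathrm{Re}\,z_d,\mathrm{Im}\,z_1,\ldots,\mathrm{Im}\,z_d)^\top\in\mathbb{R}^{2d}$. Set $W:=\mathrm{RI}(Z)$, $W_j:=\mathrm{RI}(Z_j)$ and $W_{\vartheta,j}:=\mathrm{RI}(\mathrm{e}^{\mathrm{i}\vartheta}Z_j)=M_\vartheta W_j$ for $\vartheta\in\Theta$, where \[ M_\vartheta=\begin{pmatrix}\cos\vartheta\,\mathrm{I}_d&-\sin\vartheta\,\mathrm{I}_d\\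 \sin\vartheta\,\mathrm{I}_d&\cos\vartheta\,\mathrm{I}_d\end{pmatrix} \] and $\mathrm{I}_d$ is the unit matrix of order $d$. The empirical characteristic functions are $\varphi_n^\ast(s):=\frac1n\sum_{j=1}^n\exp(\mathrm{i}s^\top W_j)$ and $\varphi_{n,\vartheta}^\ast(s):=\frac1n\sum_{j=1}^n\exp(\mathrm{i}s^\top W_{\vartheta,j})$, $s\in\mathbb{R}^{2d}$. Let $\|\cdot\|$ be the Euclidean norm on $\mathbb{R}^{2d}$, and let $w:[0,\infty)\to(0,\infty)$ be a measurable function (the weight function) such that $s\mapsto w(\|s\|)$ is (Lebesgue) integrable on $\mathbb{R}^{2d}$. The test statistic is \[ T_n=n\int_\Theta\int_{\mathbb{R}^{2d}}\big|\varphi_n^\ast(s)-\varphi_{n,\vartheta}^\ast(s)\big|^2\,w(\|s\|)\,\mathrm{d}s\,\mathrm{d}\vartheta . \] Let $\mathrm{CS}^+(\xi):=\cos\xi+\sin\xi$, $\xi\in\mathbb{R}$, and $\ell(w,s,\vartheta):=\mathrm{CS}^+(s^\top w)-\mathrm{CS}^+(s^\top M_\vartheta w)$ for $w,s\in\mathbb{R}^{2d}$, $\vartheta\in\Theta$. $\mathbb{H}=L^2(\mathbb{R}^{2d}\times\Theta,\mathcal{B}(\mathbb{R}^{2d}\times\Theta),w(\|s\|)\,\mathrm{d}s\,\mathrm{d}\vartheta)$ is the separable Hilbert space of (equivalence classes of) real-valued measurable functions on $\mathbb{R}^{2d}\times\Theta$ that are square integrable with respect to $w(\|s\|)\,\mathrm{d}s\,\mathrm{d}\vartheta$,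 with norm $\|f\|_{\mathbb{H}}=\big(\int_\Theta\int_{\mathbb{R}^{2d}}f^2(s,\vartheta)w(\|s\|)\,\mathrm{d}s\,\mathrm{d}\vartheta\big)^{1/2}$. *)

theory Defs
  imports "HOL-Probability.Probability"
begin

section \<open>Complex vectors as real vectors\<close>

text \<open>The space \<open>\<real>\<^sup>2\<^sup>d\<close> is \<^typ>\<open>real ^ ('d + 'd)\<close>: the summand \<^const>\<open>Inl\<close> indexes
  the first \<open>d\<close> coordinates (real parts), \<^const>\<open>Inr\<close> the last \<open>d\<close> (imaginary parts).\<close>

definition RI :: "complex ^ 'd \<Rightarrow> real ^ ('d + 'd)" where
  "RI z = (\<chi> i. case i of Inl k \<Rightarrow> Re (z $ k) | Inr k \<Rightarrow> Im (z $ k))"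

definition rot :: "real \<Rightarrow> real ^ ('d :: finite + 'd) ^ ('d + 'd)" where
  "rot \<theta> = (\<chi> i j. case (i, j) of
       (Inl k, Inl l) \<Rightarrow> if k = l then cos \<theta> else 0
     | (Inl k, Inr l) \<Rightarrow> if k = l then - sin \<theta> else 0
     | (Inr k, Inl l) \<Rightarrow> if k = l then sin \<theta> else 0
     | (Inr k, Inr l) \<Rightarrow> if k = l then cos \<theta> else 0)"

lemma RI_rotate: "RI (exp (\<i> * of_real \<theta>) *s z) = rot \<theta> *v RI z"
proof -
  have sum_split: "(\<Sum>j\<in>UNIV. f j) = (\<Sum>k\<in>UNIV. f (Inl k)) + (\<Sum>k\<in>UNIV. f (Inr k))"
    for f :: "'a::finite + 'a \<Rightarrow> real"
    using sum.Plus [of "UNIV :: 'a set" "UNIV :: 'a set" f] by (simp add: comp_def)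
  show ?thesis
    by (simp add: vec_eq_iff RI_def rot_def matrix_vector_mult_def vector_scalar_mult_def
        sum_split if_distrib [of "\<lambda>x. x * _"] sum.delta' exp_Euler cos_of_real sin_of_real
        split: sum.split cong: if_cong)
qed

section \<open>The test statistic\<close>

definition Theta :: "real set" where
  "Theta = {-pi..<pi}"

definition ecf :: "(nat \<Rightarrow> real ^ 'm) \<Rightarrow> nat \<Rightarrow> real ^ 'm \<Rightarrow> complex" where
  "ecf x n s = (1 / of_nat n) * (\<Sum>j = 1..n. exp (\<i> * of_real (s \<bullet> x j)))"

text \<open>The statistic of the sample \<open>z\<^sub>1, \<dots>, z\<^sub>n\<close>; the value \<open>z 0\<close> is not used.\<close>

definition test_stat :: "(real \<Rightarrow> real) \<Rightarrow> nat \<Rightarrow> (nat \<Rightarrow> complex ^ 'd) \<Rightarrow> real" where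
  "test_stat w n z = real n *
     (LINT \<theta>:Theta|lborel. LINT s|lborel.
        (cmod (ecf (\<lambda>j. RI (z j)) n s
             - ecf (\<lambda>j. RI (exp (\<i> * of_real \<theta>) *s z j)) n s))\<^sup>2 * w (norm s))"

definition CS_plus :: "real \<Rightarrow> real" where
  "CS_plus \<xi> = cos \<xi> + sin \<xi>"

definition ell :: "real ^ ('d :: finite + 'd) \<Rightarrow> real ^ ('d + 'd) \<Rightarrow> real \<Rightarrow> real" where
  "ell x s \<theta> = CS_plus (s \<bullet> x) - CS_plus (s \<bullet> (rot \<theta> *v x))"

section \<open>Random elements of an \<open>L\<^sup>2\<close> space\<close>

text \<open>Elements of \<open>L\<^sup>2(\<mu>)\<close> are represented by square integrable functions, without passing to
  classes modulo equality almost everywhere. An open set of the seminorm contains with a function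
  all functions equal to it almost everywhere, so \<open>L2_borel \<mu>\<close> is the Borel
  \<open>\<sigma>\<close>-algebra of the quotient space, pulled back to representatives.\<close>

definition L2_fun :: "'x measure \<Rightarrow> ('x \<Rightarrow> real) set" where
  "L2_fun \<mu> = {f \<in> borel_measurable \<mu>. integrable \<mu> (\<lambda>x. (f x)\<^sup>2)}"

definition L2_inner :: "'x measure \<Rightarrow> ('x \<Rightarrow> real) \<Rightarrow> ('x \<Rightarrow> real) \<Rightarrow> real" where
  "L2_inner \<mu> f g = (LINT x|\<mu>. f x * g x)"

definition L2_norm :: "'x measure \<Rightarrow> ('x \<Rightarrow> real) \<Rightarrow> real" where
  "L2_norm \<mu> f = sqrt (LINT x|\<mu>. (f x)\<^sup>2)"

definition L2_open :: "'x measure \<Rightarrow> ('x \<Rightarrow> real) set \<Rightarrow> bool" where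
  "L2_open \<mu> U \<longleftrightarrow> U \<subseteq> L2_fun \<mu> \<and>
     (\<forall>f\<in>U. \<exists>e>0. \<forall>g\<in>L2_fun \<mu>. L2_norm \<mu> (\<lambda>x. g x - f x) < e \<longrightarrow> g \<in> U)"

definition L2_borel :: "'x measure \<Rightarrow> ('x \<Rightarrow> real) measure" where
  "L2_borel \<mu> = sigma (L2_fun \<mu>) {U. L2_open \<mu> U}"

text \<open>Normal laws on the line include the point masses (variance \<open>0\<close>).\<close>

definition normal_law :: "real measure \<Rightarrow> bool" where
  "normal_law \<nu> \<longleftrightarrow> (\<exists>m \<sigma>. \<nu> = return borel m \<or>
     \<sigma> > 0 \<and> \<nu> = density lborel (\<lambda>x. ennreal (normal_density m \<sigma> x)))"

definition gaussian_element ::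
    "'b measure \<Rightarrow> 'x measure \<Rightarrow> ('b \<Rightarrow> 'x \<Rightarrow> real) \<Rightarrow> bool" where
  "gaussian_element N \<mu> V \<longleftrightarrow> prob_space N \<and> V \<in> N \<rightarrow>\<^sub>M L2_borel \<mu> \<and>
     (\<forall>h\<in>L2_fun \<mu>. normal_law (distr N borel (\<lambda>\<omega>. L2_inner \<mu> (V \<omega>) h)))"

definition centred_element ::
    "'b measure \<Rightarrow> 'x measure \<Rightarrow> ('b \<Rightarrow> 'x \<Rightarrow> real) \<Rightarrow> bool" where
  "centred_element N \<mu> V \<longleftrightarrow> (\<forall>h\<in>L2_fun \<mu>. (LINT \<omega>|N. L2_inner \<mu> (V \<omega>) h) = 0)"

text \<open>Since the values of \<open>V\<close> are classes of functions, the identity \<open>E[V(x) V(y)] = K(x,y)\<close> is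
  read as an identity of bilinear forms on \<open>L\<^sup>2(\<mu>)\<close>. The predicate \<open>pointwise_covariance\<close> is the
  literal identity; it makes sense for a jointly measurable version of \<open>V\<close>.\<close>

definition covariance_kernel ::
    "'b measure \<Rightarrow> 'x measure \<Rightarrow> ('b \<Rightarrow> 'x \<Rightarrow> real) \<Rightarrow> ('x \<Rightarrow> 'x \<Rightarrow> real) \<Rightarrow> bool" where
  "covariance_kernel N \<mu> V K \<longleftrightarrow> (\<forall>g\<in>L2_fun \<mu>. \<forall>h\<in>L2_fun \<mu>.
     (LINT \<omega>|N. L2_inner \<mu> (V \<omega>) g * L2_inner \<mu> (V \<omega>) h)
       = (LINT x|\<mu>. LINT y|\<mu>. K x y * g x * h y))"

definition pointwise_covariance ::
    "'b measure \<Rightarrow> 'x measure \<Rightarrow> ('b \<Rightarrow> 'x \<Rightarrow> real) \<Rightarrow> ('x \<Rightarrow> 'x \<Rightarrow> real) \<Rightarrow> bool" where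
  "pointwise_covariance N \<mu> V K \<longleftrightarrow>
     (\<lambda>(\<omega>, x). V \<omega> x) \<in> borel_measurable (N \<Otimes>\<^sub>M \<mu>) \<and>
     (\<forall>x\<in>space \<mu>. \<forall>y\<in>space \<mu>.
        integrable N (\<lambda>\<omega>. V \<omega> x * V \<omega> y) \<and> (LINT \<omega>|N. V \<omega> x * V \<omega> y) = K x y)"

section \<open>The limit\<close>

definition H_measure :: "(real \<Rightarrow> real) \<Rightarrow> ((real ^ 'm) \<times> real) measure" where
  "H_measure w = density (lborel \<Otimes>\<^sub>M restrict_space lborel Theta)
     (\<lambda>(s, \<theta>). ennreal (w (norm s)))"

definition limit_kernel ::
    "'a measure \<Rightarrow> ('a \<Rightarrow> complex ^ 'd) \<Rightarrow>
     (real ^ ('d + 'd)) \<times> real \<Rightarrow> (real ^ ('d + 'd)) \<times> real \<Rightarrow> real" where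
  "limit_kernel P Z = (\<lambda>(s, \<theta>) (t, \<eta>).
     (LINT \<omega>|P. ell (RI (Z \<omega>)) s \<theta> * ell (RI (Z \<omega>)) t \<eta>))"

lemma space_H_measure: "space (H_measure w) = UNIV \<times> Theta"
  by (simp add: H_measure_def space_pair_measure space_restrict_space)

lemma H_norm_iterated:
  fixes f :: "(real ^ 'm) \<times> real \<Rightarrow> real"
  assumes w: "\<And>r. r \<ge> 0 \<Longrightarrow> w r > 0" "w \<in> borel_measurable (restrict_space borel {0..})"
    and f: "f \<in> L2_fun (H_measure w)"
  shows "(L2_norm (H_measure w) f)\<^sup>2
     = (LINT \<theta>:Theta|lborel. LINT s|lborel. (f (s, \<theta>))\<^sup>2 * w (norm s))"
proof -
  let ?L = "lborel :: (real ^ 'm) measure" and ?R = "restrict_space lborel Theta"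
  have Th: "Theta \<in> sets lborel" by (simp add: Theta_def)
  interpret L: sigma_finite_measure ?L by (rule sigma_finite_lborel)
  interpret R: sigma_finite_measure ?R
    using Th by (intro sigma_finite_measure_restrict_space sigma_finite_lborel) auto
  interpret LR: pair_sigma_finite ?L ?R ..
  have wn: "(\<lambda>s :: real ^ 'm. w (norm s)) \<in> borel_measurable borel"
    by (rule measurable_compose [OF measurable_restrict_space2 w(2)]) auto
  have wm: "(\<lambda>x. w (norm (fst x))) \<in> borel_measurable (?L \<Otimes>\<^sub>M ?R)"
    by (rule measurable_compose [OF measurable_fst]) (simp add: wn)
  have fm: "f \<in> borel_measurable (?L \<Otimes>\<^sub>M ?R)"
    and fi: "integrable (H_measure w) (\<lambda>x. (f x)\<^sup>2)"
    using f by (auto simp: L2_fun_def H_measure_def)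
  have d: "H_measure w = density (?L \<Otimes>\<^sub>M ?R) (\<lambda>x. ennreal (w (norm (fst x))))"
    by (simp add: H_measure_def case_prod_unfold)
  have pos: "w (norm (fst x)) \<ge> 0" for x :: "(real ^ 'm) \<times> real"
    using w(1) [of "norm (fst x)"] by simp
  have int: "integrable (?L \<Otimes>\<^sub>M ?R) (\<lambda>x. w (norm (fst x)) * (f x)\<^sup>2)"
    using fi fm wm pos unfolding d by (subst (asm) integrable_real_density) auto
  have "(L2_norm (H_measure w) f)\<^sup>2 = (LINT x|H_measure w. (f x)\<^sup>2)"
    by (simp add: L2_norm_def)
  also have "\<dots> = (LINT x|(?L \<Otimes>\<^sub>M ?R). w (norm (fst x)) * (f x)\<^sup>2)"
    using fm wm pos unfolding d by (subst integral_real_density) auto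
  also have "\<dots> = (LINT \<theta>|?R. LINT s|?L. w (norm s) * (f (s, \<theta>))\<^sup>2)"
    using LR.integral_snd [of "\<lambda>s \<theta>. w (norm s) * (f (s, \<theta>))\<^sup>2"] int
    by (simp add: case_prod_unfold)
  also have "\<dots> = (LINT \<theta>:Theta|lborel. LINT s|lborel. (f (s, \<theta>))\<^sup>2 * w (norm s))"
    using Th by (subst integral_restrict_space) (auto simp: set_lebesgue_integral_def mult.commute)
  finally show ?thesis .
qed

end

theory Submission
  imports Defs
begin

text \<open>
  By oddness of the mixed term in \<open>s\<close>, the statistic is \<open>\<parallel>S\<^sub>n\<parallel>\<^sup>2\<close> for the normalised sum \<open>S\<^sub>n\<close> of the
  bounded, centred, independent random functions \<open>ell W\<^sub>j\<close> of \<open>L\<^sup>2\<close>. It suffices that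
  \<open>E exp (-k \<parallel>S\<^sub>n\<parallel>\<^sup>2)\<close> converges for all natural numbers \<open>k\<close>, by the Weierstrass theorem in the
  variable \<open>exp (-x)\<close>. For step functions on finite partitions the squared norm is a finite sum of squares
  of inner products, and \<open>exp (-a\<^sup>2/2)\<close> is a Gaussian mixture of the \<open>exp (i t a)\<close>, so only
  characteristic functions of single inner products occur, to which the one-dimensional
  central limit theorem applies. The error of the partition is uniform in \<open>n\<close>
  because the covariance of \<open>S\<^sub>n\<close> does not depend on \<open>n\<close>.

  For the existence of \<open>V\<close>, a Cholesky factorisation of the kernel, pivoted along a dense sequence of points,
  gives functions \<open>\<phi>\<^sub>k\<close> with \<open>\<Sum>\<^sub>k \<phi>\<^sub>k x * \<phi>\<^sub>k y = K x y\<close> everywhere, and \<open>V\<close> is a version of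
  \<open>\<Sum>\<^sub>k \<xi>\<^sub>k \<phi>\<^sub>k\<close> with independent standard normal \<open>\<xi>\<^sub>k\<close>.
\<close>

section \<open>The space of square integrable functions\<close>

text \<open>No tightness argument in L^2 is made: the limit concerns one nonnegative number.
  Tightness is replaced by a trace identity: the expected part of the squared norm that a partition
  misses is the same number for all n \<ge> 1, so the case n = 1, where dominated convergence
  applies, controls every n. Circular symmetry enters through E ell W s theta = 0, which removes the
  mixed terms of that covariance and centres the scalar summands.

  For V the characteristic function of an inner product follows from normality, centring and the
  kernel alone, so the convergence holds for every such V and not just for the one constructed.

  The existence part asks for E V(x) V(y) = K(x,y) at every pair of points and for joint
  measurability. Eigenfunctions of a covariance operator are determined only up to null sets;
  Cholesky factors are functions with a definite value at each point. Integrability of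
  \<open>w\<close> makes the underlying measure finite, so bounded functions such as
  \<open>ell\<close> lie in L^2.\<close>

lemma L2_funD:
  assumes "f \<in> L2_fun M"
  shows "f \<in> borel_measurable M" "integrable M (\<lambda>x. (f x)\<^sup>2)"
  using assms by (auto simp: L2_fun_def)

lemma L2_funI:
  assumes "f \<in> borel_measurable M" "integrable M (\<lambda>x. (f x)\<^sup>2)"
  shows "f \<in> L2_fun M"
  using assms by (auto simp: L2_fun_def)

lemma L2_fun_integrable_mult:
  assumes f: "f \<in> L2_fun M" and g: "g \<in> L2_fun M"
  shows "integrable M (\<lambda>x. f x * g x)"
proof (rule Bochner_Integration.integrable_bound)
  note [measurable] = L2_funD(1)[OF f] L2_funD(1)[OF g]
  show "integrable M (\<lambda>x. (f x)\<^sup>2 + (g x)\<^sup>2)"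
    using L2_funD(2)[OF f] L2_funD(2)[OF g] by simp
  show "(\<lambda>x. f x * g x) \<in> borel_measurable M" by measurable
  have "\<bar>a * b\<bar> \<le> a\<^sup>2 + b\<^sup>2" for a b :: real
    using sum_squares_bound[of "\<bar>a\<bar>" "\<bar>b\<bar>"] mult_nonneg_nonneg[of "\<bar>a\<bar>" "\<bar>b\<bar>"]
    unfolding abs_mult power2_abs by linarith
  then show "AE x in M. norm (f x * g x) \<le> norm ((f x)\<^sup>2 + (g x)\<^sup>2)" by simp
qed

lemma L2_fun_cmult:
  assumes "f \<in> L2_fun M"
  shows "(\<lambda>x. c * f x) \<in> L2_fun M"
  using assms by (auto simp: L2_fun_def power_mult_distrib)

lemma L2_fun_add:
  assumes f: "f \<in> L2_fun M" and g: "g \<in> L2_fun M"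
  shows "(\<lambda>x. f x + g x) \<in> L2_fun M"
  using L2_funD[OF f] L2_funD[OF g] L2_fun_integrable_mult[OF f g]
  by (auto simp: L2_fun_def power2_sum mult.assoc)

lemma L2_fun_diff:
  assumes f: "f \<in> L2_fun M" and g: "g \<in> L2_fun M"
  shows "(\<lambda>x. f x - g x) \<in> L2_fun M"
  using L2_fun_add[OF f L2_fun_cmult[OF g, of "-1"]] by simp

lemma L2_fun_sum:
  assumes "\<And>i. i \<in> I \<Longrightarrow> f i \<in> L2_fun M"
  shows "(\<lambda>x. \<Sum>i\<in>I. f i x) \<in> L2_fun M"
  using assms
proof (induction I rule: infinite_finite_induct)
  case (insert i I)
  then show ?case by (simp add: L2_fun_add)
qed (simp_all add: L2_fun_def)

lemma (in finite_measure) L2_fun_bounded: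
  assumes f: "f \<in> borel_measurable M" and B: "\<And>x. x \<in> space M \<Longrightarrow> \<bar>f x\<bar> \<le> B"
  shows "f \<in> L2_fun M"
proof (rule L2_funI[OF f])
  have "AE x in M. norm ((f x)\<^sup>2) \<le> B\<^sup>2"
    using B by (intro AE_I2) (simp add: abs_le_square_iff[symmetric] order_trans[OF _ abs_ge_self])
  then show "integrable M (\<lambda>x. (f x)\<^sup>2)"
    using f by (intro integrable_const_bound) auto
qed

lemma (in finite_measure) L2_fun_integrable:
  assumes "f \<in> L2_fun M"
  shows "integrable M f"
  using square_integrable_imp_integrable[OF L2_funD[OF assms]] .

lemma L2_norm_power2: "(L2_norm M f)\<^sup>2 = (LINT x|M. (f x)\<^sup>2)"
  by (simp add: L2_norm_def)

lemma L2_norm_nonneg: "0 \<le> L2_norm M f"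
  by (simp add: L2_norm_def)

lemma L2_norm_cmult: "L2_norm M (\<lambda>x. c * f x) = \<bar>c\<bar> * L2_norm M f"
  by (simp add: L2_norm_def power_mult_distrib real_sqrt_mult)

lemma L2_inner_add_left:
  assumes "f \<in> L2_fun M" "g \<in> L2_fun M" "h \<in> L2_fun M"
  shows "L2_inner M (\<lambda>x. f x + g x) h = L2_inner M f h + L2_inner M g h"
  using assms by (simp add: L2_inner_def distrib_right L2_fun_integrable_mult)

lemma L2_inner_diff_left:
  assumes "f \<in> L2_fun M" "g \<in> L2_fun M" "h \<in> L2_fun M"
  shows "L2_inner M (\<lambda>x. f x - g x) h = L2_inner M f h - L2_inner M g h"
  using assms by (simp add: L2_inner_def left_diff_distrib L2_fun_integrable_mult)

lemma L2_inner_commute: "L2_inner M f g = L2_inner M g f"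
  by (simp add: L2_inner_def mult.commute)

lemma L2_inner_cmult_left: "L2_inner M (\<lambda>x. c * f x) g = c * L2_inner M f g"
  by (simp add: L2_inner_def mult.assoc)

lemma L2_inner_sum_left:
  assumes "\<And>i. i \<in> I \<Longrightarrow> f i \<in> L2_fun M" "h \<in> L2_fun M"
  shows "L2_inner M (\<lambda>x. \<Sum>i\<in>I. f i x) h = (\<Sum>i\<in>I. L2_inner M (f i) h)"
  using assms by (simp add: L2_inner_def sum_distrib_right L2_fun_integrable_mult)

lemma L2_norm_diff_power2:
  assumes f: "f \<in> L2_fun M" and g: "g \<in> L2_fun M"
  shows "(L2_norm M (\<lambda>x. f x - g x))\<^sup>2
    = (L2_norm M f)\<^sup>2 - 2 * L2_inner M f g + (L2_norm M g)\<^sup>2"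
  using L2_funD[OF f] L2_funD[OF g] L2_fun_integrable_mult[OF f g]
  by (simp add: L2_norm_power2 L2_inner_def power2_diff mult.assoc)

text \<open>The quadratic t -> |f - t g|^2 is nonnegative, and its minimum gives the bound.
  \<open>L2_norm\<close> is only a seminorm, so |g| = 0 does not make g the zero function; that case
  needs its own argument: an affine function of t that is bounded below is constant.\<close>

lemma L2_Cauchy_Schwarz:
  assumes f: "f \<in> L2_fun M" and g: "g \<in> L2_fun M"
  shows "\<bar>L2_inner M f g\<bar> \<le> L2_norm M f * L2_norm M g"
proof -
  let ?a = "L2_norm M f" and ?b = "L2_norm M g" and ?p = "L2_inner M f g"
  have *: "0 \<le> ?a\<^sup>2 - 2 * t * ?p + t\<^sup>2 * ?b\<^sup>2" for t
    using L2_norm_diff_power2[OF f L2_fun_cmult[OF g, of t]]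
      zero_le_power2[of "L2_norm M (\<lambda>x. f x - t * g x)"]
    by (simp add: L2_norm_cmult power_mult_distrib L2_inner_commute[of M f] L2_inner_cmult_left)
  have "?p\<^sup>2 \<le> ?a\<^sup>2 * ?b\<^sup>2"
  proof (cases "?b = 0")
    case True
    have "?p = 0"
    proof (rule ccontr)
      assume "?p \<noteq> 0"
      \<comment> \<open>This value of t makes the affine function equal to -1.\<close>
      then show False
        using *[of "(?a\<^sup>2 + 1) / (2 * ?p)"] True by simp
    qed
    then show ?thesis by simp
  next
    case False
    then have b: "?b\<^sup>2 > 0" by simp
    have "?p\<^sup>2 / ?b\<^sup>2 \<le> ?a\<^sup>2"
      using *[of "?p / ?b\<^sup>2"] False by (simp add: power2_eq_square)
    then show ?thesis
      using b by (simp add: pos_divide_le_eq)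
  qed
  then have "?p\<^sup>2 \<le> (?a * ?b)\<^sup>2" by (simp add: power_mult_distrib)
  then have "\<bar>?p\<bar> \<le> \<bar>?a * ?b\<bar>" by (simp add: abs_le_square_iff)
  then show ?thesis by (simp add: abs_mult L2_norm_nonneg)
qed

lemma L2_norm_triangle:
  assumes f: "f \<in> L2_fun M" and g: "g \<in> L2_fun M"
  shows "L2_norm M (\<lambda>x. f x + g x) \<le> L2_norm M f + L2_norm M g"
proof (rule power2_le_imp_le)
  show "(L2_norm M (\<lambda>x. f x + g x))\<^sup>2 \<le> (L2_norm M f + L2_norm M g)\<^sup>2"
    using L2_norm_diff_power2[OF f L2_fun_cmult[OF g, of "-1"]] L2_Cauchy_Schwarz[OF f g]
    by (simp add: L2_norm_cmult L2_inner_commute[of M f] L2_inner_cmult_left[of M "-1", simplified]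
        power2_sum) (simp add: L2_norm_def)
qed (simp add: L2_norm_nonneg)

lemma L2_norm_triangle_diff:
  assumes "f \<in> L2_fun M" "g \<in> L2_fun M" "h \<in> L2_fun M"
  shows "L2_norm M (\<lambda>x. f x - h x) \<le> L2_norm M (\<lambda>x. f x - g x) + L2_norm M (\<lambda>x. g x - h x)"
  using L2_norm_triangle[OF L2_fun_diff[OF assms(1,2)] L2_fun_diff[OF assms(2,3)]] by simp

lemma L2_norm_minus_commute: "L2_norm M (\<lambda>x. f x - g x) = L2_norm M (\<lambda>x. g x - f x)"
  by (simp add: L2_norm_def power2_commute)

section \<open>Measurability with respect to \<open>L2_borel\<close>\<close>

lemma space_L2_borel [simp]: "space (L2_borel M) = L2_fun M"
  unfolding L2_borel_def by (rule space_measure_of) (auto simp: L2_open_def)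

lemma sets_L2_borel: "sets (L2_borel M) = sigma_sets (L2_fun M) {U. L2_open M U}"
  unfolding L2_borel_def by (rule sets_measure_of) (auto simp: L2_open_def)

text \<open>A Lipschitz function pulls open sets back to sets open for the seminorm, and these are
  the generators of \<open>L2_borel\<close>.\<close>

lemma measurable_L2_borel_Lipschitz:
  fixes F :: "('x \<Rightarrow> real) \<Rightarrow> real"
  assumes F: "\<And>f g. f \<in> L2_fun M \<Longrightarrow> g \<in> L2_fun M \<Longrightarrow>
    \<bar>F g - F f\<bar> \<le> C * L2_norm M (\<lambda>x. g x - f x)"
  shows "F \<in> borel_measurable (L2_borel M)"
proof (rule borel_measurableI)
  fix S :: "real set" assume S: "open S"
  have "L2_open M (F -` S \<inter> L2_fun M)"
    unfolding L2_open_def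
  proof safe
    fix f assume f: "f \<in> L2_fun M" "F f \<in> S"
    with S obtain e where e: "e > 0" "\<And>y. \<bar>y - F f\<bar> < e \<Longrightarrow> y \<in> S"
      by (metis dist_real_def open_dist)
    show "\<exists>d>0. \<forall>g\<in>L2_fun M. L2_norm M (\<lambda>x. g x - f x) < d \<longrightarrow> g \<in> F -` S \<inter> L2_fun M"
    \<comment> \<open>The constant is enlarged to \<open>\<bar>C\<bar> + 1\<close> because the
      radius must be positive also when C \<le> 0.\<close>
    proof (intro exI[of _ "e / (\<bar>C\<bar> + 1)"] conjI ballI impI)
      show "0 < e / (\<bar>C\<bar> + 1)" using e(1) by simp
      fix g assume g: "g \<in> L2_fun M" "L2_norm M (\<lambda>x. g x - f x) < e / (\<bar>C\<bar> + 1)"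
      have "\<bar>F g - F f\<bar> \<le> (\<bar>C\<bar> + 1) * L2_norm M (\<lambda>x. g x - f x)"
        by (rule order_trans[OF F[OF f(1) g(1)]]) (intro mult_right_mono L2_norm_nonneg, simp)
      also have "\<dots> < e" using g(2) by (simp add: field_simps)
      finally show "g \<in> F -` S \<inter> L2_fun M" using e(2) g(1) by simp
    qed
  qed
  then show "F -` S \<inter> space (L2_borel M) \<in> sets (L2_borel M)"
    by (simp add: sets_L2_borel sigma_sets.Basic)
qed

lemma measurable_L2_inner:
  assumes h: "h \<in> L2_fun M"
  shows "(\<lambda>f. L2_inner M f h) \<in> borel_measurable (L2_borel M)"
proof (rule measurable_L2_borel_Lipschitz[where C="L2_norm M h"])
  fix f g assume fg: "f \<in> L2_fun M" "g \<in> L2_fun M"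
  show "\<bar>L2_inner M g h - L2_inner M f h\<bar> \<le> L2_norm M h * L2_norm M (\<lambda>x. g x - f x)"
    using L2_Cauchy_Schwarz[OF L2_fun_diff[OF fg(2,1)] h] fg h
    by (simp add: L2_inner_diff_left mult.commute)
qed

lemma measurable_L2_norm: "L2_norm M \<in> borel_measurable (L2_borel M)"
proof (rule measurable_L2_borel_Lipschitz[where C=1])
  fix f g assume fg: "f \<in> L2_fun M" "g \<in> L2_fun M"
  show "\<bar>L2_norm M g - L2_norm M f\<bar> \<le> 1 * L2_norm M (\<lambda>x. g x - f x)"
    using L2_norm_triangle[OF L2_fun_diff[OF fg(2,1)] fg(1)]
      L2_norm_triangle[OF L2_fun_diff[OF fg] fg(2)] L2_norm_minus_commute[of M g f] by simp
qed

section \<open>Approximation by step functions\<close>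

text \<open>The level sets of \<open>p m\<close> are the finite partitions of the overview. They are
  not assumed to refine each other, and \<open>p m x\<close> may leave \<open>space M\<close>; the
  partitions become fine only through the pointwise convergence of \<open>p m\<close> to the
  identity.\<close>

locale discretised_measure = finite_measure M
  for M :: "'x :: {metric_space, second_countable_topology} measure" +
  fixes p :: "nat \<Rightarrow> 'x \<Rightarrow> 'x"
  assumes sets_eq: "sets M = sets (restrict_space borel (space M))"
    and simple_p: "\<And>m. simple_function M (p m)"
    and p_tendsto: "\<And>x. x \<in> space M \<Longrightarrow> (\<lambda>m. p m x) \<longlonglongrightarrow> x"
begin

lemma sets_borelE:
  assumes "A \<in> sets M"
  obtains B where "B \<in> sets borel" "A = B \<inter> space M"
proof -
  have "A \<in> sets (restrict_space borel (space M))" using assms by (subst sets_eq[symmetric])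
  then show ?thesis using that by (auto simp: sets_restrict_space)
qed

lemma borel_measurable_M:
  assumes "f \<in> borel_measurable borel"
  shows "f \<in> borel_measurable M"
  using measurable_restrict_space1[OF assms] measurable_cong_sets[OF sets_eq refl] by blast

lemma finite_range_p: "finite (p m ` space M)"
  using simple_p by (rule simple_functionD)

lemma step_L2_fun: "(\<lambda>x. c (p m x)) \<in> L2_fun M"
proof -
  have "simple_function M (\<lambda>x. c (p m x))"
    using simple_function_compose[OF simple_p, of c m] by (simp add: comp_def)
  moreover obtain B where "\<forall>y\<in>p m ` space M. \<bar>c y\<bar> \<le> B"
    using finite_imp_bounded[of "c ` p m ` space M"] finite_range_p
    by (auto simp: bounded_iff)
  ultimately show ?thesis
    by (intro L2_fun_bounded[of _ B] borel_measurable_simple_function) auto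
qed

text \<open>Approximation is demanded for all large m, not for some m, because
  \<open>energy_tendsto\<close> runs along the given sequence of partitions. The values c are
  unrestricted since \<open>p m\<close> has finite range on \<open>space M\<close>.\<close>

definition approximable :: "('x \<Rightarrow> real) \<Rightarrow> bool" where
  "approximable f \<longleftrightarrow> f \<in> L2_fun M \<and>
     (\<forall>e>0. \<forall>\<^sub>F m in sequentially. \<exists>c. (LINT x|M. (f x - c (p m x))\<^sup>2) < e)"

text \<open>From (a + b)^2 \<le> 2 a^2 + 2 b^2. Two errors below e / 4 thus combine to less than e,
  which explains the e / 4 in the closure properties.\<close>

lemma square_integral_add_le:
  assumes f: "f \<in> L2_fun M" and g: "g \<in> L2_fun M"
  shows "(LINT x|M. (f x + g x)\<^sup>2) \<le> 2 * (LINT x|M. (f x)\<^sup>2) + 2 * (LINT x|M. (g x)\<^sup>2)"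
proof -
  have "(LINT x|M. (f x + g x)\<^sup>2) \<le> (LINT x|M. 2 * (f x)\<^sup>2 + 2 * (g x)\<^sup>2)"
    using L2_funD(2)[OF L2_fun_add[OF f g]] L2_funD(2)[OF f] L2_funD(2)[OF g]
  proof (intro integral_mono)
    fix x
    have "0 \<le> (f x - g x)\<^sup>2" by simp
    then show "(f x + g x)\<^sup>2 \<le> 2 * (f x)\<^sup>2 + 2 * (g x)\<^sup>2"
      by (simp add: power2_sum power2_diff)
  qed simp_all
  then show ?thesis
    using L2_funD(2)[OF f] L2_funD(2)[OF g] by simp
qed

lemma approximable_cong:
  assumes "approximable f" "\<And>x. x \<in> space M \<Longrightarrow> f x = g x"
  shows "approximable g"
proof -
  have "g \<in> L2_fun M \<longleftrightarrow> f \<in> L2_fun M"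
    using assms(2) unfolding L2_fun_def mem_Collect_eq
    by (intro arg_cong2[where f="(\<and>)"] measurable_cong Bochner_Integration.integrable_cong) auto
  moreover have "(LINT x|M. (g x - c (p m x))\<^sup>2) = (LINT x|M. (f x - c (p m x))\<^sup>2)" for c m
    using assms(2) by (intro Bochner_Integration.integral_cong) auto
  ultimately show ?thesis using assms(1) by (simp add: approximable_def)
qed

lemma approximable_add:
  assumes f: "approximable f" and g: "approximable g"
  shows "approximable (\<lambda>x. f x + g x)"
  unfolding approximable_def
proof (intro conjI allI impI)
  have L: "f \<in> L2_fun M" "g \<in> L2_fun M" using f g by (auto simp: approximable_def)
  then show "(\<lambda>x. f x + g x) \<in> L2_fun M" by (rule L2_fun_add)
  fix e :: real assume e: "e > 0"
  then have "\<forall>\<^sub>F m in sequentially. \<exists>c. (LINT x|M. (f x - c (p m x))\<^sup>2) < e / 4"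
    and "\<forall>\<^sub>F m in sequentially. \<exists>c. (LINT x|M. (g x - c (p m x))\<^sup>2) < e / 4"
    using f g unfolding approximable_def by (meson divide_pos_pos zero_less_numeral)+
  then show "\<forall>\<^sub>F m in sequentially. \<exists>c. (LINT x|M. (f x + g x - c (p m x))\<^sup>2) < e"
  proof eventually_elim
    case (elim m)
    then obtain c d where c: "(LINT x|M. (f x - c (p m x))\<^sup>2) < e / 4"
      and d: "(LINT x|M. (g x - d (p m x))\<^sup>2) < e / 4" by blast
    have "(LINT x|M. ((f x - c (p m x)) + (g x - d (p m x)))\<^sup>2) < e"
      using c d square_integral_add_le[OF L2_fun_diff[OF L(1) step_L2_fun[of c m]]
          L2_fun_diff[OF L(2) step_L2_fun[of d m]]] by linarith
    then show ?case
      by (intro exI[of _ "\<lambda>y. c y + d y"]) (simp add: algebra_simps)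
  qed
qed

lemma approximable_cmult:
  assumes f: "approximable f"
  shows "approximable (\<lambda>x. a * f x)"
  unfolding approximable_def
proof (intro conjI allI impI)
  show "(\<lambda>x. a * f x) \<in> L2_fun M" using f by (auto simp: approximable_def L2_fun_cmult)
  fix e :: real assume e: "e > 0"
  \<comment> \<open>Adding 1 keeps the denominator positive when a = 0.\<close>
  then have "\<forall>\<^sub>F m in sequentially. \<exists>c. (LINT x|M. (f x - c (p m x))\<^sup>2) < e / (a\<^sup>2 + 1)"
    using f unfolding approximable_def by (meson add_nonneg_pos divide_pos_pos zero_le_power2 zero_less_one)
  then show "\<forall>\<^sub>F m in sequentially. \<exists>c. (LINT x|M. (a * f x - c (p m x))\<^sup>2) < e"
  proof eventually_elim
    case (elim m)
    then obtain c where c: "(LINT x|M. (f x - c (p m x))\<^sup>2) < e / (a\<^sup>2 + 1)" by blast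
    have "(LINT x|M. (a * f x - a * c (p m x))\<^sup>2) = a\<^sup>2 * (LINT x|M. (f x - c (p m x))\<^sup>2)"
      by (simp flip: right_diff_distrib add: power_mult_distrib)
    also have "\<dots> \<le> (a\<^sup>2 + 1) * (LINT x|M. (f x - c (p m x))\<^sup>2)"
      by (intro mult_right_mono) auto
    also have "\<dots> < e" using c by (simp add: pos_less_divide_eq add_nonneg_pos mult.commute)
    finally show ?case by (intro exI[of _ "\<lambda>y. a * c y"])
  qed
qed

lemma approximable_limit:
  assumes f: "f \<in> L2_fun M" and g: "\<And>n. approximable (g n)"
    and lim: "(\<lambda>n. LINT x|M. (f x - g n x)\<^sup>2) \<longlonglongrightarrow> 0"
  shows "approximable f"
  unfolding approximable_def
proof (intro conjI allI impI f)
  fix e :: real assume e: "e > 0"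
  then have "\<forall>\<^sub>F n in sequentially. (LINT x|M. (f x - g n x)\<^sup>2) < e / 4"
    by (intro order_tendstoD(2)[OF lim]) simp
  then obtain n where n: "(LINT x|M. (f x - g n x)\<^sup>2) < e / 4"
    using eventually_sequentially by force
  have L: "g n \<in> L2_fun M" using g by (auto simp: approximable_def)
  have "\<forall>\<^sub>F m in sequentially. \<exists>c. (LINT x|M. (g n x - c (p m x))\<^sup>2) < e / 4"
    using g e unfolding approximable_def by (meson divide_pos_pos zero_less_numeral)
  then show "\<forall>\<^sub>F m in sequentially. \<exists>c. (LINT x|M. (f x - c (p m x))\<^sup>2) < e"
  proof eventually_elim
    case (elim m)
    then obtain c where c: "(LINT x|M. (g n x - c (p m x))\<^sup>2) < e / 4" by blast
    have "(LINT x|M. ((f x - g n x) + (g n x - c (p m x)))\<^sup>2) < e"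
      using c n square_integral_add_le[OF L2_fun_diff[OF f L] L2_fun_diff[OF L step_L2_fun[of c m]]]
      by linarith
    then show ?case by (intro exI[of _ c]) simp
  qed
qed

lemma square_integral_tendsto_0:
  assumes f: "f \<in> borel_measurable M" and g: "\<And>n. g n \<in> borel_measurable M"
    and lim: "\<And>x. x \<in> space M \<Longrightarrow> (\<lambda>n. g n x) \<longlonglongrightarrow> f x"
    and B: "\<And>n x. x \<in> space M \<Longrightarrow> \<bar>f x - g n x\<bar> \<le> \<bar>b x\<bar>" and b: "b \<in> L2_fun M"
  shows "(\<lambda>n. LINT x|M. (f x - g n x)\<^sup>2) \<longlonglongrightarrow> 0"
proof -
  note [measurable] = f g
  have "(\<lambda>n. LINT x|M. (f x - g n x)\<^sup>2) \<longlonglongrightarrow> (LINT x|M. 0)"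
  proof (rule integral_dominated_convergence[where w="\<lambda>x. (b x)\<^sup>2"])
    show "integrable M (\<lambda>x. (b x)\<^sup>2)" using b by (rule L2_funD)
    show "AE x in M. (\<lambda>n. (f x - g n x)\<^sup>2) \<longlonglongrightarrow> 0"
      using lim by (intro AE_I2 tendsto_eq_intros | assumption)+ auto
    show "AE x in M. norm ((f x - g n x)\<^sup>2) \<le> (b x)\<^sup>2" for n
      using B by (intro AE_I2) (simp add: abs_le_square_iff)
  qed simp_all
  then show ?thesis by simp
qed

lemma approximable_bounded_limit:
  assumes f: "f \<in> borel_measurable M" and g: "\<And>n. approximable (g n)"
    and lim: "\<And>x. x \<in> space M \<Longrightarrow> (\<lambda>n. g n x) \<longlonglongrightarrow> f x"
    and B: "\<And>x. x \<in> space M \<Longrightarrow> \<bar>f x\<bar> \<le> B" "\<And>n x. x \<in> space M \<Longrightarrow> \<bar>g n x\<bar> \<le> B"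
  shows "approximable f"
proof (rule approximable_limit[OF L2_fun_bounded[OF f B(1)] g])
  show "(\<lambda>n. LINT x|M. (f x - g n x)\<^sup>2) \<longlonglongrightarrow> 0"
  proof (rule square_integral_tendsto_0[OF f _ lim])
    show "g n \<in> borel_measurable M" for n
      using g by (auto simp: approximable_def L2_fun_def)
    show "\<bar>f x - g n x\<bar> \<le> \<bar>2 * B\<bar>" if "x \<in> space M" for n x
      using B(1)[OF that] B(2)[OF that, of n] by simp
    show "(\<lambda>x. 2 * B) \<in> L2_fun M" by (rule L2_fun_bounded) auto
  qed
qed

text \<open>The step function is f composed with \<open>p m\<close>: it converges pointwise by
  continuity, and boundedly. Since \<open>p m x\<close> may leave \<open>space M\<close>, f has to
  be continuous and bounded on the whole type.\<close>

lemma approximable_continuous: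
  assumes f: "continuous_on UNIV f" and B: "\<And>x. \<bar>f x\<bar> \<le> B"
  shows "approximable f"
proof -
  have fm: "f \<in> borel_measurable M"
    by (intro borel_measurable_M borel_measurable_continuous_onI f)
  have lim: "(\<lambda>m. LINT x|M. (f x - f (p m x))\<^sup>2) \<longlonglongrightarrow> 0"
  proof (rule square_integral_tendsto_0[OF fm])
    show "(\<lambda>x. f (p m x)) \<in> borel_measurable M" for m
      using step_L2_fun by (rule L2_funD)
    show "(\<lambda>m. f (p m x)) \<longlonglongrightarrow> f x" if "x \<in> space M" for x
      using f p_tendsto[OF that] by (auto simp: continuous_on_eq_continuous_at intro: isCont_tendsto_compose)
    show "\<bar>f x - f (p m x)\<bar> \<le> \<bar>2 * B\<bar>" for m x
      using B[of x] B[of "p m x"] by simp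
    show "(\<lambda>x. 2 * B) \<in> L2_fun M" by (rule L2_fun_bounded) auto
  qed
  show ?thesis
    unfolding approximable_def
  proof (intro conjI allI impI)
    show "f \<in> L2_fun M" using fm B by (rule L2_fun_bounded)
    fix e :: real assume "e > 0"
    then show "\<forall>\<^sub>F m in sequentially. \<exists>c. (LINT x|M. (f x - c (p m x))\<^sup>2) < e"
      using order_tendstoD(2)[OF lim, of e] by (auto elim: eventually_mono)
  qed
qed

text \<open>The tents max 0 (1 - n d(x,F)) decrease to the indicator, because the distance to a
  closed set is positive outside it.\<close>

lemma approximable_indicator_closed:
  assumes F: "closed F"
  shows "approximable (indicator F)"
\<comment> \<open>\<open>infdist\<close> to the empty set is 0 by convention, so there the tents
  would converge to 1.\<close>
proof (cases "F = {}")
  case True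
  then show ?thesis
    by (intro approximable_cong[OF approximable_continuous[of "\<lambda>_. 0" 0]]) simp_all
next
  case False
  show ?thesis
  proof (rule approximable_bounded_limit)
    show "indicator F \<in> borel_measurable M"
      using F by (intro borel_measurable_M) auto
    show "approximable (\<lambda>x. max 0 (1 - real n * infdist x F))" for n
      by (rule approximable_continuous[where B=1])
        (auto intro!: continuous_intros simp: infdist_nonneg)
    show "(\<lambda>n. max 0 (1 - real n * infdist x F)) \<longlonglongrightarrow> indicator F x" for x
    proof (cases "x \<in> F")
      case True
      then show ?thesis by simp
    next
      case False
      then have d: "infdist x F > 0"
        using F \<open>F \<noteq> {}\<close> by (simp add: infdist_pos_not_in_closed)
      have "\<forall>\<^sub>F n in sequentially. real n > 1 / infdist x F"
        by (rule filterlim_at_top_dense[THEN iffD1, rule_format, OF filterlim_real_sequentially])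
      then have "\<forall>\<^sub>F n in sequentially. max 0 (1 - real n * infdist x F) = 0"
        by eventually_elim (use d in \<open>simp add: field_simps\<close>)
      then show ?thesis using False by (simp add: tendsto_eventually)
    qed
  qed (auto simp: infdist_nonneg indicator_def)
qed

text \<open>Dynkin argument: the closed sets are an intersection-stable generator, and
  approximability passes to complements and to countable disjoint unions.\<close>

lemma approximable_indicator_borel:
  assumes "A \<in> sets borel"
  shows "approximable (indicator A)"
proof -
  have "Int_stable (Collect closed :: 'x set set)" by (auto simp: Int_stable_def)
  moreover have "(Collect closed :: 'x set set) \<subseteq> Pow UNIV" by simp
  moreover have "A \<in> sigma_sets UNIV (Collect closed)"
    using assms by (simp add: borel_eq_closed)
  ultimately show ?thesis
  proof (induct rule: sigma_sets_induct_disjoint)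
    case (basic A)
    then show ?case by (simp add: approximable_indicator_closed)
  next
    case empty
    show ?case by (rule approximable_indicator_closed) simp
  next
    case (compl A)
    have "approximable (\<lambda>x. 1 + (-1) * indicator A x)"
      using compl approximable_continuous[of "\<lambda>_. 1" 1]
      by (intro approximable_add approximable_cmult) auto
    then show ?case by (rule approximable_cong) (auto simp: indicator_def)
  next
    case (union A)
    have fin: "approximable (indicator (\<Union>i<n. A i))" for n
    proof (induction n)
      case 0
      show ?case by (rule approximable_indicator_closed) simp
    next
      case (Suc n)
      have "A n \<inter> (\<Union>i<n. A i) = {}"
      proof -
        have "A n \<inter> A i = {}" if "i < n" for i
          using disjoint_family_onD[OF union(1), of n i] that by simp
        then show ?thesis by blast
      qed
      then have eq: "indicator (\<Union>i<Suc n. A i) x = indicator (A n) x + (indicator (\<Union>i<n. A i) x :: real)" for x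
        by (auto simp: lessThan_Suc indicator_def)
      show ?case
        using approximable_add[OF union(3)[of n] Suc] by (rule approximable_cong) (simp add: eq)
    qed
    have "range A \<subseteq> sets borel" using union(2) by (simp add: borel_eq_closed)
    then have "indicator (\<Union>i. A i) \<in> borel_measurable M"
      by (intro borel_measurable_M borel_measurable_indicator) auto
    then show ?case
    proof (rule approximable_bounded_limit[where B=1, OF _ fin])
      show "(\<lambda>n. indicator (\<Union>i<n. A i) x) \<longlonglongrightarrow> (indicator (\<Union>i. A i) x :: real)" for x
        by (rule LIMSEQ_indicator_UN)
    qed (auto simp: indicator_def)
  qed
qed

lemma approximable_sum:
  assumes "\<And>i. i \<in> I \<Longrightarrow> approximable (f i)"
  shows "approximable (\<lambda>x. \<Sum>i\<in>I. f i x)"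
  using assms
proof (induction I rule: infinite_finite_induct)
  case (insert i I)
  then show ?case by (simp add: approximable_add)
qed (use approximable_continuous[of "\<lambda>_. 0" 0] in simp_all)

lemma approximable_L2_fun:
  assumes f: "f \<in> L2_fun M"
  shows "approximable f"
proof -
  note [measurable] = L2_funD(1)[OF f]
  obtain F where F: "\<And>i. simple_function M (F i)" "\<And>x. x \<in> space M \<Longrightarrow> (\<lambda>i. F i x) \<longlonglongrightarrow> f x"
    "\<And>i x. x \<in> space M \<Longrightarrow> dist (F i x) 0 \<le> 2 * dist (f x) 0"
    using borel_measurable_implies_sequence_metric[OF L2_funD(1)[OF f], of 0] by blast
  have FM: "F i \<in> borel_measurable M" for i by (intro borel_measurable_simple_function F)
  have *: "approximable (F i)" for i
  proof (rule approximable_cong)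
    show "approximable (\<lambda>x. \<Sum>y\<in>F i ` space M. y * indicator (F i -` {y} \<inter> space M) x)"
    proof (intro approximable_sum approximable_cmult)
      fix y
      have "F i -` {y} \<inter> space M \<in> sets M"
        using F(1) by (rule simple_functionD)
      then obtain B where B: "B \<in> sets borel" "F i -` {y} \<inter> space M = B \<inter> space M"
        by (rule sets_borelE)
      show "approximable (indicator (F i -` {y} \<inter> space M))"
        by (rule approximable_cong[OF approximable_indicator_borel[OF B(1)]])
          (metis B(2) IntI Int_iff indicator_simps)
    qed
    show "(\<Sum>y\<in>F i ` space M. y * indicator (F i -` {y} \<inter> space M) x) = F i x"
      if "x \<in> space M" for x
    proof -
      have "F i x = (\<Sum>y\<in>F i ` space M. indicator (F i -` {y} \<inter> space M) x *\<^sub>R y)"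
        by (rule simple_function_indicator_representation_banach[OF F(1) that])
      also have "\<dots> = (\<Sum>y\<in>F i ` space M. y * indicator (F i -` {y} \<inter> space M) x)"
        by (intro sum.cong refl) simp
      finally show ?thesis by (rule sym)
    qed
  qed
  show ?thesis
  proof (rule approximable_limit[OF f *])
    show "(\<lambda>n. LINT x|M. (f x - F n x)\<^sup>2) \<longlonglongrightarrow> 0"
    \<comment> \<open>The simple functions satisfy |F n| \<le> 2 |f|, so the difference is at most
      |f| + 2 |f| = 3 |f|.\<close>
    proof (rule square_integral_tendsto_0[OF L2_funD(1)[OF f] FM F(2) _ L2_fun_cmult[OF f, of 3]])
      show "\<bar>f x - F n x\<bar> \<le> \<bar>3 * f x\<bar>" if "x \<in> space M" for n x
        using F(3)[OF that, of n] by (simp add: abs_mult)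
    qed
  qed
qed

section \<open>Energy of a function on a finite partition\<close>

definition cell :: "nat \<Rightarrow> 'x \<Rightarrow> 'x set" where
  "cell m y = p m -` {y} \<inter> space M"

text \<open>This is the squared norm of the orthogonal projection of f onto the step functions of
  partition m. Cells of measure 0 contribute 0, since x / 0 = 0.\<close>

definition energy :: "nat \<Rightarrow> ('x \<Rightarrow> real) \<Rightarrow> real" where
  "energy m f = (\<Sum>y\<in>p m ` space M. (L2_inner M f (indicator (cell m y)))\<^sup>2 / measure M (cell m y))"

lemma cell_sets [measurable]: "cell m y \<in> sets M"
  unfolding cell_def using simple_p by (rule simple_functionD)

lemma indicator_L2_fun: "A \<in> sets M \<Longrightarrow> indicator A \<in> L2_fun M"
  by (intro L2_fun_bounded[of _ 1]) (auto simp: indicator_def)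

lemma step_eq_sum:
  fixes c :: "'x \<Rightarrow> real"
  assumes "x \<in> space M"
  shows "c (p m x) = (\<Sum>y\<in>p m ` space M. c y * indicator (cell m y) x)"
  using assms finite_range_p[of m]
  by (subst sum.mono_neutral_right[of _ "{p m x}"]) (auto simp: cell_def indicator_def)

text \<open>The cells are disjoint, so the squared distance splits into one quadratic polynomial in
  \<open>c y\<close> per cell. The two lemmas that follow compare these polynomials with their
  extreme values.\<close>

lemma square_dist_step:
  assumes f: "f \<in> L2_fun M"
  shows "(LINT x|M. (f x - c (p m x))\<^sup>2) = (LINT x|M. (f x)\<^sup>2)
    - (\<Sum>y\<in>p m ` space M. 2 * c y * L2_inner M f (indicator (cell m y))
         - (c y)\<^sup>2 * measure M (cell m y))"
proof -
  have int: "integrable M (\<lambda>x. f x * indicator (cell m y) x)" for y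
    using f by (intro L2_fun_integrable_mult indicator_L2_fun) auto
  have int': "integrable M (indicator (cell m y) :: 'x \<Rightarrow> real)" for y
    by (intro L2_fun_integrable indicator_L2_fun cell_sets)
  have "(f x - c (p m x))\<^sup>2 = (f x)\<^sup>2 - (\<Sum>y\<in>p m ` space M.
      2 * c y * (f x * indicator (cell m y) x) - (c y)\<^sup>2 * indicator (cell m y) x)"
    if "x \<in> space M" for x
  proof -
    have "2 * c (p m x) * f x - (c (p m x))\<^sup>2
        = (\<Sum>y\<in>p m ` space M. (2 * c y * f x - (c y)\<^sup>2) * indicator (cell m y) x)"
      by (rule step_eq_sum[OF that])
    also have "\<dots> = (\<Sum>y\<in>p m ` space M.
        2 * c y * (f x * indicator (cell m y) x) - (c y)\<^sup>2 * indicator (cell m y) x)"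
      by (intro sum.cong refl) (simp add: left_diff_distrib)
    finally have "(\<Sum>y\<in>p m ` space M. 2 * c y * (f x * indicator (cell m y) x)
        - (c y)\<^sup>2 * indicator (cell m y) x) = 2 * c (p m x) * f x - (c (p m x))\<^sup>2" ..
    then show ?thesis by (simp add: power2_diff)
  qed
  then have "(LINT x|M. (f x - c (p m x))\<^sup>2) = (LINT x|M. (f x)\<^sup>2 - (\<Sum>y\<in>p m ` space M.
      2 * c y * (f x * indicator (cell m y) x) - (c y)\<^sup>2 * indicator (cell m y) x))"
    by (intro Bochner_Integration.integral_cong) auto
  also have "\<dots> = (LINT x|M. (f x)\<^sup>2)
    - (\<Sum>y\<in>p m ` space M. 2 * c y * L2_inner M f (indicator (cell m y))
         - (c y)\<^sup>2 * measure M (cell m y))"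
    using L2_funD(2)[OF f] int int'
    by (subst Bochner_Integration.integral_diff)
      (auto simp: L2_inner_def Bochner_Integration.integral_sum Int_absorb2 sets.sets_into_space
        intro!: Bochner_Integration.integrable_sum)
  finally show ?thesis .
qed

lemma energy_le:
  assumes f: "f \<in> L2_fun M"
  shows "energy m f \<le> (LINT x|M. (f x)\<^sup>2)"
proof -
  \<comment> \<open>The mean over the cell is the best constant. On a null cell it is 0 and both
    sides of the next equation vanish.\<close>
  define c where "c y = L2_inner M f (indicator (cell m y)) / measure M (cell m y)" for y
  have "2 * c y * L2_inner M f (indicator (cell m y)) - (c y)\<^sup>2 * measure M (cell m y)
      = (L2_inner M f (indicator (cell m y)))\<^sup>2 / measure M (cell m y)" for y
    by (cases "measure M (cell m y) = 0") (auto simp: c_def power2_eq_square)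
  then have "(LINT x|M. (f x - c (p m x))\<^sup>2) = (LINT x|M. (f x)\<^sup>2) - energy m f"
    using square_dist_step[OF f, of c m] by (simp add: energy_def)
  moreover have "0 \<le> (LINT x|M. (f x - c (p m x))\<^sup>2)" by simp
  ultimately show ?thesis by linarith
qed

text \<open>Converse of \<open>energy_le\<close>: whatever step function is at hand, its distance to
  f bounds what the projection misses. An approximation of any origin therefore forces the energy up
  to the squared norm.\<close>

lemma energy_ge:
  assumes f: "f \<in> L2_fun M"
  shows "(LINT x|M. (f x)\<^sup>2) - (LINT x|M. (f x - c (p m x))\<^sup>2) \<le> energy m f"
proof -
  have "2 * a * L2_inner M f (indicator (cell m y)) - a\<^sup>2 * measure M (cell m y)
      \<le> (L2_inner M f (indicator (cell m y)))\<^sup>2 / measure M (cell m y)" for a y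
  proof (cases "measure M (cell m y) = 0")
    \<comment> \<open>On a null cell the quadratic term is absent, so the linear term has to vanish
      by itself; Cauchy-Schwarz against the null indicator shows it.\<close>
    case True
    have sq: "(indicator A x :: real)\<^sup>2 = indicator A x" for A and x :: 'x
      by (simp add: indicator_def)
    have "(L2_norm M (indicator (cell m y)))\<^sup>2 = measure M (cell m y)"
      by (simp add: L2_norm_power2 sq)
    then have "L2_inner M f (indicator (cell m y)) = 0"
      using L2_Cauchy_Schwarz[OF f indicator_L2_fun[OF cell_sets], of m y] True by simp
    then show ?thesis using True by simp
  next
    case False
    let ?i = "L2_inner M f (indicator (cell m y))" and ?\<mu> = "measure M (cell m y)"
    have pos: "?\<mu> > 0" using False by (simp add: zero_less_measure_iff)
    have "0 \<le> (?i - a * ?\<mu>)\<^sup>2" by simp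
    then have "(2 * a * ?i - a\<^sup>2 * ?\<mu>) * ?\<mu> \<le> ?i\<^sup>2"
      by (simp add: power2_eq_square algebra_simps)
    then show ?thesis using pos by (simp add: pos_le_divide_eq)
  qed
  then show ?thesis
    unfolding square_dist_step[OF f] energy_def by (simp add: sum_mono)
qed

lemma energy_tendsto:
  assumes f: "f \<in> L2_fun M"
  shows "(\<lambda>m. energy m f) \<longlonglongrightarrow> (LINT x|M. (f x)\<^sup>2)"
proof (rule tendstoI)
  fix e :: real assume "e > 0"
  then have "\<forall>\<^sub>F m in sequentially. \<exists>c. (LINT x|M. (f x - c (p m x))\<^sup>2) < e"
    using approximable_L2_fun[OF f] by (simp add: approximable_def)
  then show "\<forall>\<^sub>F m in sequentially. dist (energy m f) (LINT x|M. (f x)\<^sup>2) < e"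
  proof eventually_elim
    case (elim m)
    then obtain c where "(LINT x|M. (f x - c (p m x))\<^sup>2) < e" by blast
    then show ?case
      using energy_le[OF f, of m] energy_ge[OF f, of c m] by (simp add: dist_real_def)
  qed
qed

lemma L2_separable:
  obtains D where "countable D" "D \<subseteq> L2_fun M"
    "\<And>f e. f \<in> L2_fun M \<Longrightarrow> e > 0 \<Longrightarrow> \<exists>g\<in>D. L2_norm M (\<lambda>x. f x - g x) < e"
proof
  let ?D = "\<Union>m. (\<lambda>q x. q (p m x)) ` (p m ` space M \<rightarrow>\<^sub>E \<rat>)"
  show "countable ?D"
    by (intro countable_UN countable_image countable_PiE finite_range_p countable_rat) auto
  show "?D \<subseteq> L2_fun M" using step_L2_fun by auto
  fix f and e :: real assume f: "f \<in> L2_fun M" and e: "e > 0"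
  then have "\<forall>\<^sub>F m in sequentially. \<exists>c. (LINT x|M. (f x - c (p m x))\<^sup>2) < (e / 2)\<^sup>2"
    using approximable_L2_fun[OF f] by (simp add: approximable_def)
  then obtain m c where c: "(LINT x|M. (f x - c (p m x))\<^sup>2) < (e / 2)\<^sup>2"
    unfolding eventually_sequentially by blast
  have c': "L2_norm M (\<lambda>x. f x - c (p m x)) < e / 2"
  proof (rule power2_less_imp_less)
    show "(L2_norm M (\<lambda>x. f x - c (p m x)))\<^sup>2 < (e / 2)\<^sup>2"
      using c by (simp only: L2_norm_power2)
  qed (use e in simp)
  \<comment> \<open>Moving each value by less than d costs at most d times the square root of the
    total mass, which is below e / 2. The summand 1 keeps the denominator nonzero for the zero
    measure.\<close>
  define d where "d = e / (2 * (sqrt (measure M (space M)) + 1))"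
  have d: "d > 0" using e by (auto simp: d_def intro!: divide_pos_pos add_nonneg_pos)
  have "\<exists>q\<in>\<rat>. \<bar>c y - q\<bar> < d" for y
  proof -
    obtain q where "q \<in> \<rat>" "c y - d < q" "q < c y + d"
      using Rats_dense_in_real[of "c y - d" "c y + d"] d by auto
    then show ?thesis by (intro bexI[of _ q]) (auto simp: abs_less_iff)
  qed
  then obtain q where q: "\<And>y. q y \<in> \<rat>" "\<And>y. \<bar>c y - q y\<bar> < d" by metis
  \<comment> \<open>The restriction makes the function extensional, as the index set of the dense
    family requires, and does not change its composite with \<open>p m\<close> on
    \<open>space M\<close>.\<close>
  define r where "r = restrict q (p m ` space M)"
  have "L2_norm M (\<lambda>x. c (p m x) - r (p m x)) \<le> d * sqrt (measure M (space M))"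
  proof -
    have "(LINT x|M. (c (p m x) - r (p m x))\<^sup>2) \<le> (LINT x|M. d\<^sup>2)"
    proof (rule integral_mono)
      show "integrable M (\<lambda>x. (c (p m x) - r (p m x))\<^sup>2)"
        by (intro L2_funD L2_fun_diff step_L2_fun)
      show "(c (p m x) - r (p m x))\<^sup>2 \<le> d\<^sup>2" if "x \<in> space M" for x
        using q(2)[of "p m x"] d that by (auto simp: r_def abs_le_square_iff[symmetric])
    qed simp
    then have "L2_norm M (\<lambda>x. c (p m x) - r (p m x)) \<le> sqrt (measure M (space M) * d\<^sup>2)"
      unfolding L2_norm_def by (simp add: mult.commute)
    then show ?thesis using d by (simp add: real_sqrt_mult mult.commute)
  qed
  also have "\<dots> < e / 2"
  proof -
    have "d * (sqrt (measure M (space M)) + 1) = e / 2"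
    proof -
      have "sqrt (measure M (space M)) + 1 \<noteq> 0" by (smt (verit) measure_nonneg real_sqrt_ge_zero)
      then show ?thesis by (simp add: d_def field_simps)
    qed
    then show ?thesis using d by (simp add: distrib_left)
  qed
  finally have "L2_norm M (\<lambda>x. f x - r (p m x)) < e"
    using c' L2_norm_triangle_diff[OF f step_L2_fun[of c m] step_L2_fun[of r m]] by linarith
  moreover have "(\<lambda>x. r (p m x)) \<in> ?D"
    using q(1) by (intro UN_I[of m] image_eqI[of _ _ r]) (auto simp: r_def)
  ultimately show "\<exists>g\<in>?D. L2_norm M (\<lambda>x. f x - g x) < e" by (rule bexI)
qed

text \<open>By separability every open set is a countable union of balls around points of a
  countable dense set. Hence it is enough that the distances to fixed functions are random
  variables.\<close>

lemma measurable_into_L2_borel: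
  assumes V: "\<And>\<omega>. \<omega> \<in> space N \<Longrightarrow> V \<omega> \<in> L2_fun M"
    and dist: "\<And>g. g \<in> L2_fun M \<Longrightarrow> (\<lambda>\<omega>. L2_norm M (\<lambda>x. V \<omega> x - g x)) \<in> borel_measurable N"
  shows "V \<in> N \<rightarrow>\<^sub>M L2_borel M"
  unfolding L2_borel_def
proof (rule measurable_measure_of)
  show "{U. L2_open M U} \<subseteq> Pow (L2_fun M)" by (auto simp: L2_open_def)
  show "V \<in> space N \<rightarrow> L2_fun M" using V by auto
  fix U assume "U \<in> {U. L2_open M U}"
  then have U: "L2_open M U" by simp
  obtain D where D: "countable D" "D \<subseteq> L2_fun M"
    "\<And>f e. f \<in> L2_fun M \<Longrightarrow> e > 0 \<Longrightarrow> \<exists>g\<in>D. L2_norm M (\<lambda>x. f x - g x) < e"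
    using L2_separable by blast
  define ball where "ball g k = {f \<in> L2_fun M. L2_norm M (\<lambda>x. f x - g x) < 1 / real (Suc k)}" for g k
  have eq: "U = (\<Union>(g, k)\<in>{(g, k). g \<in> D \<and> ball g k \<subseteq> U}. ball g k)" (is "_ = ?R")
  proof
    show "U \<subseteq> ?R"
    proof
      fix f assume fU: "f \<in> U"
      then have f: "f \<in> L2_fun M" using U by (auto simp: L2_open_def)
      obtain e where e: "e > 0" "\<And>g. g \<in> L2_fun M \<Longrightarrow> L2_norm M (\<lambda>x. g x - f x) < e \<Longrightarrow> g \<in> U"
        using U fU by (auto simp: L2_open_def)
      obtain k where k: "1 / real (Suc k) < e / 2"
        using e(1) nat_approx_posE[of "e / 2"] by auto
      obtain g where g: "g \<in> D" "L2_norm M (\<lambda>x. f x - g x) < 1 / real (Suc k)"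
        using D(3)[OF f, of "1 / real (Suc k)"] by auto
      have "ball g k \<subseteq> U"
      proof
        fix h assume "h \<in> ball g k"
        then have h: "h \<in> L2_fun M" "L2_norm M (\<lambda>x. h x - g x) < 1 / real (Suc k)"
          by (auto simp: ball_def)
        have "g \<in> L2_fun M" using g(1) D(2) by blast
        from L2_norm_triangle_diff[OF h(1) this f] h(2) g(2) k
        show "h \<in> U" using e(2)[OF h(1)] L2_norm_minus_commute[of M f g] by linarith
      qed
      then show "f \<in> ?R" using g f by (auto simp: ball_def)
    qed
  qed auto
  have cnt: "countable {(g, k). g \<in> D \<and> ball g k \<subseteq> U}"
    by (rule countable_subset[of _ "D \<times> UNIV"]) (auto intro: D(1))
  have "V -` U \<inter> space N = (\<Union>(g, k)\<in>{(g, k). g \<in> D \<and> ball g k \<subseteq> U}. V -` ball g k \<inter> space N)"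
    by (subst eq) auto
  also have "\<dots> \<in> sets N"
  proof (rule sets.countable_UN'[OF cnt], safe)
    fix g k assume "g \<in> D"
    then have [measurable]: "(\<lambda>\<omega>. L2_norm M (\<lambda>x. V \<omega> x - g x)) \<in> borel_measurable N"
      using dist D(2) by blast
    have "V -` ball g k \<inter> space N = {\<omega>\<in>space N. L2_norm M (\<lambda>x. V \<omega> x - g x) < 1 / real (Suc k)}"
      using V by (auto simp: ball_def)
    also have "\<dots> \<in> sets N" by measurable
    finally show "V -` ball g k \<inter> space N \<in> sets N" .
  qed
  finally show "V -` U \<inter> space N \<in> sets N" .
qed

end

section \<open>Laplace transforms and Gaussian linearisation\<close>

text \<open>In the variable y = exp (- x) the half line becomes (0, 1], and a polynomial in y
  becomes a combination of the functions exp (- i x) with natural i; so integer Laplace arguments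
  suffice. The test functions \<open>cts_step a b\<close> vanish for large x and hence extend
  continuously to y = 0.\<close>

lemma weak_conv_if_Laplace_conv:
  fixes M :: "nat \<Rightarrow> real measure" and L :: "real measure"
  assumes M: "\<And>n. real_distribution (M n)" and L: "real_distribution L"
    and M0: "\<And>n. AE x in M n. 0 \<le> x" and L0: "AE x in L. 0 \<le> x"
    and conv: "\<And>k::nat. (\<lambda>n. LINT x|M n. exp (- (real k * x))) \<longlonglongrightarrow> (LINT x|L. exp (- (real k * x)))"
  shows "weak_conv_m M L"
proof (rule integral_cts_step_conv_imp_weak_conv[OF M L])
  fix a b :: real assume ab: "a < b"
  \<comment> \<open>The maximum stops the logarithm at x = b, beyond which
    \<open>cts_step a b\<close> is 0 anyway; this makes g continuous at y = 0.\<close>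
  define g where "g y = cts_step a b (- ln (max y (exp (- b))))" for y
  have g: "g (exp (- x)) = cts_step a b x" for x
  proof (cases "x \<le> b")
    case True
    then show ?thesis by (simp add: g_def max_def)
  next
    case False
    then show ?thesis using ab by (simp add: g_def max_def cts_step_def)
  qed
  have cts: "continuous_on UNIV (cts_step a b)"
    using cts_step_uniformly_continuous[OF ab] by (rule uniformly_continuous_imp_continuous)
  have "continuous_on {0..1} g"
    unfolding g_def
    by (rule continuous_on_compose2[OF cts])
      (auto intro!: continuous_intros simp: less_max_iff_disj less_imp_neq[symmetric])
  have approx: "\<exists>f. (\<exists>n c. f = (\<lambda>x. \<Sum>i\<le>n. c i * exp (- (real i * x)))) \<and>
      (\<forall>x\<ge>0. \<bar>cts_step a b x - f x\<bar> \<le> e)" if e: "e > 0" for e :: real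
  proof -
    obtain q where q: "real_polynomial_function q" "\<And>y. y \<in> {0..1} \<Longrightarrow> \<bar>g y - q y\<bar> < e"
      using Stone_Weierstrass_real_polynomial_function[OF compact_Icc \<open>continuous_on {0..1} g\<close> e]
      by blast
    then obtain c n where c: "q = (\<lambda>x. \<Sum>i\<le>n. c i * x ^ i)"
      unfolding real_polynomial_function_iff_sum by blast
    show ?thesis
    proof (intro exI conjI allI impI)
      fix x :: real assume "0 \<le> x"
      then have "\<bar>g (exp (- x)) - q (exp (- x))\<bar> < e" by (intro q) auto
      also have "q (exp (- x)) = (\<Sum>i\<le>n. c i * exp (- (real i * x)))"
        unfolding c by (simp flip: exp_of_nat_mult)
      finally show "\<bar>cts_step a b x - (\<Sum>i\<le>n. c i * exp (- (real i * x)))\<bar> \<le> e"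
        unfolding g by simp
    qed (rule refl)
  qed
  have int_exp: "integrable K (\<lambda>x. exp (- (real i * x)))"
    if "real_distribution K" "AE x in K. 0 \<le> x" for K :: "real measure" and i :: nat
  proof -
    interpret real_distribution K by fact
    show ?thesis
      by (rule integrable_const_bound[where B=1]) (use that(2) in auto)
  qed
  have close: "\<bar>(LINT x|K. cts_step a b x) - (\<Sum>i\<le>n. c i * (LINT x|K. exp (- (real i * x))))\<bar> \<le> e"
    if K: "real_distribution K" "AE x in K. 0 \<le> x"
      and f: "\<forall>x\<ge>0. \<bar>cts_step a b x - (\<Sum>i\<le>n. c i * exp (- (real i * x)))\<bar> \<le> e" and e: "e > 0"
    for K :: "real measure" and e c and n :: nat
  proof -
    interpret real_distribution K by fact
    note int = int_exp[OF K] integrable_cts_step[OF ab]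
    have "(LINT x|K. cts_step a b x) - (\<Sum>i\<le>n. c i * (LINT x|K. exp (- (real i * x))))
        = (LINT x|K. cts_step a b x - (\<Sum>i\<le>n. c i * exp (- (real i * x))))"
      using int by simp
    also have "\<bar>\<dots>\<bar> \<le> (LINT x|K. e)"
    proof (rule order_trans[OF integral_abs_bound integral_mono_AE])
      show "AE x in K. \<bar>cts_step a b x - (\<Sum>i\<le>n. c i * exp (- (real i * x)))\<bar> \<le> e"
        using K(2) by eventually_elim (use f in blast)
    qed (use int in auto)
    finally show ?thesis by (simp add: prob_space[simplified])
  qed
  show "(\<lambda>n. LINT x|M n. cts_step a b x) \<longlonglongrightarrow> (LINT x|L. cts_step a b x)"
  proof (rule LIMSEQ_I)
    fix r :: real assume r: "0 < r"
    obtain n c where nc: "\<forall>x\<ge>0. \<bar>cts_step a b x - (\<Sum>i\<le>n. c i * exp (- (real i * x)))\<bar> \<le> r / 4"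
      using approx[of "r / 4"] r by auto
    let ?I = "\<lambda>K. \<Sum>i\<le>n. c i * (LINT x|K. exp (- (real i * x)))"
    have "(\<lambda>m. ?I (M m)) \<longlonglongrightarrow> ?I L" by (intro tendsto_intros conv)
    then obtain m0 where m0: "\<And>m. m \<ge> m0 \<Longrightarrow> \<bar>?I (M m) - ?I L\<bar> < r / 4"
      using LIMSEQ_D[of "\<lambda>m. ?I (M m)" "?I L" "r / 4"] r by auto
    show "\<exists>m0. \<forall>m\<ge>m0. norm ((LINT x|M m. cts_step a b x) - (LINT x|L. cts_step a b x)) < r"
    proof (intro exI allI impI)
      fix m assume m: "m \<ge> m0"
      show "norm ((LINT x|M m. cts_step a b x) - (LINT x|L. cts_step a b x)) < r"
        using close[OF M M0 nc, of m] close[OF L L0 nc] m0[OF m] r unfolding real_norm_def by linarith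
    qed
  qed
qed

text \<open>exp (- b^2 / 2) is the characteristic function of the standard normal law at b, so a
  square in the exponent becomes an average over t of the linear term t b. The factor r stands for
  the weights still to be linearised, and its bound keeps the integrand bounded for Fubini.\<close>

lemma (in prob_space) Gaussian_linearisation:
  fixes a b r :: "'a \<Rightarrow> real"
  assumes [measurable]: "a \<in> borel_measurable M" "b \<in> borel_measurable M" "r \<in> borel_measurable M"
    and r: "\<And>u. \<bar>r u\<bar> \<le> 1"
  shows "(CLINT u|M. iexp (a u) * of_real (exp (- (b u)\<^sup>2 / 2) * r u))
    = (CLINT t|std_normal_distribution. CLINT u|M. iexp (a u + t * b u) * of_real (r u))"
proof -
  let ?G = std_normal_distribution
  interpret G: prob_space ?G by (rule prob_space_normal_density) simp
  interpret GM: pair_prob_space ?G M ..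
  have "integrable (?G \<Otimes>\<^sub>M M) (\<lambda>(t, u). iexp (a u + t * b u) * of_real (r u))"
    by (rule GM.P.integrable_const_bound[where B=1]) (auto simp: norm_mult r)
  then have "(CLINT t|?G. CLINT u|M. iexp (a u + t * b u) * of_real (r u))
      = (CLINT u|M. CLINT t|?G. iexp (a u + t * b u) * of_real (r u))"
    by (rule GM.Fubini_integral[symmetric])
  also have "\<dots> = (CLINT u|M. iexp (a u) * of_real (exp (- (b u)\<^sup>2 / 2) * r u))"
  proof (intro Bochner_Integration.integral_cong refl)
    fix u
    have "(CLINT t|?G. iexp (a u + t * b u) * of_real (r u))
        = (CLINT t|?G. (iexp (a u) * of_real (r u)) * iexp (b u * t))"
      by (intro Bochner_Integration.integral_cong refl)
        (simp add: distrib_left exp_add ac_simps)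
    also have "\<dots> = (iexp (a u) * of_real (r u)) * char ?G (b u)"
      by (simp add: char_def)
    also have "\<dots> = iexp (a u) * of_real (exp (- (b u)\<^sup>2 / 2) * r u)"
      by (simp add: char_std_normal_distribution)
    finally show "(CLINT t|?G. iexp (a u + t * b u) * of_real (r u))
      = iexp (a u) * of_real (exp (- (b u)\<^sup>2 / 2) * r u)" .
  qed
  finally show ?thesis by simp
qed

context
  fixes P :: "'a measure" and N :: "'b measure" and H :: "('x \<Rightarrow> real) set"
    and A :: "nat \<Rightarrow> 'a \<Rightarrow> ('x \<Rightarrow> real) \<Rightarrow> real" and B :: "'b \<Rightarrow> ('x \<Rightarrow> real) \<Rightarrow> real"
  assumes P: "prob_space P" and N: "prob_space N"
    and A [measurable]: "\<And>n h. h \<in> H \<Longrightarrow> (\<lambda>u. A n u h) \<in> borel_measurable P"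
    and B [measurable]: "\<And>h. h \<in> H \<Longrightarrow> (\<lambda>u. B u h) \<in> borel_measurable N"
    and H: "\<And>h h' t. h \<in> H \<Longrightarrow> h' \<in> H \<Longrightarrow> (\<lambda>x. h x + t * h' x) \<in> H"
    and A_lin: "\<And>n h h' t u. h \<in> H \<Longrightarrow> h' \<in> H \<Longrightarrow> u \<in> space P \<Longrightarrow>
      A n u (\<lambda>x. h x + t * h' x) = A n u h + t * A n u h'"
    and B_lin: "\<And>h h' t u. h \<in> H \<Longrightarrow> h' \<in> H \<Longrightarrow> u \<in> space N \<Longrightarrow>
      B u (\<lambda>x. h x + t * h' x) = B u h + t * B u h'"
    and conv: "\<And>h. h \<in> H \<Longrightarrow> (\<lambda>n. CLINT u|P. iexp (A n u h)) \<longlonglongrightarrow> (CLINT u|N. iexp (B u h))"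
begin

text \<open>Each linearisation trades one square for a shift of h by a multiple t of
  \<open>k i\<close>, hence the induction for all h at once and the closure of H under such shifts.
  Dominated convergence with bound 1 takes the limit inside the average over t. In the application A
  and B are the inner products with the normalised sum and with V.\<close>

lemma conv_Gaussian_weights:
  fixes k :: "'i \<Rightarrow> 'x \<Rightarrow> real"
  assumes "finite I" "\<And>i. i \<in> I \<Longrightarrow> k i \<in> H" "h \<in> H"
  shows "(\<lambda>n. CLINT u|P. iexp (A n u h) * of_real (\<Prod>i\<in>I. exp (- (A n u (k i))\<^sup>2 / 2)))
    \<longlonglongrightarrow> (CLINT u|N. iexp (B u h) * of_real (\<Prod>i\<in>I. exp (- (B u (k i))\<^sup>2 / 2)))"
  using assms
proof (induction I arbitrary: h rule: finite_induct)
  case empty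
  then show ?case using conv by simp
next
  case (insert i I)
  let ?G = std_normal_distribution and ?w = "\<lambda>f. \<Prod>j\<in>I. exp (- (f (k j))\<^sup>2 / 2) :: real"
  interpret P: prob_space P by fact
  interpret N: prob_space N by fact
  interpret G: prob_space ?G by (rule prob_space_normal_density) simp
  have k: "k j \<in> H" if "j \<in> insert i I" for j using insert.prems(1) that .
  note h = insert.prems(2)
  have prod1: "\<bar>\<Prod>j\<in>I. exp (- (f j)\<^sup>2 / 2)\<bar> \<le> (1::real)" for f
    by (simp add: abs_prod prod_le_1)
  have mA [measurable]: "(\<lambda>u. A n u h) \<in> borel_measurable P"
    "(\<lambda>u. \<Prod>j\<in>I. exp (- (A n u (k j))\<^sup>2 / 2)) \<in> borel_measurable P"
    "(\<lambda>u. A n u (k i)) \<in> borel_measurable P" for n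
    by (auto intro!: borel_measurable_prod measurable_compose[OF A[OF k]] A k h)
  have mB [measurable]: "(\<lambda>u. B u h) \<in> borel_measurable N"
    "(\<lambda>u. \<Prod>j\<in>I. exp (- (B u (k j))\<^sup>2 / 2)) \<in> borel_measurable N"
    "(\<lambda>u. B u (k i)) \<in> borel_measurable N"
    by (auto intro!: borel_measurable_prod measurable_compose[OF B[OF k]] B k h)
  have eqA: "(CLINT u|P. iexp (A n u h) * of_real (\<Prod>j\<in>insert i I. exp (- (A n u (k j))\<^sup>2 / 2)))
    = (CLINT t|?G. CLINT u|P. iexp (A n u h + t * A n u (k i)) *
        of_real (?w (A n u)))" for n
    using insert.hyps
    by (subst P.Gaussian_linearisation[symmetric, OF mA(1,3,2) prod1]) simp
  have eqB: "(CLINT u|N. iexp (B u h) * of_real (\<Prod>j\<in>insert i I. exp (- (B u (k j))\<^sup>2 / 2)))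
    = (CLINT t|?G. CLINT u|N. iexp (B u h + t * B u (k i)) *
        of_real (?w (B u)))"
    using insert.hyps
    by (subst N.Gaussian_linearisation[symmetric, OF mB(1,3,2) prod1]) simp
  show ?case
    unfolding eqA eqB
  proof (rule integral_dominated_convergence[where w="\<lambda>_. 1"])
    show "AE t in ?G. (\<lambda>n. CLINT u|P. iexp (A n u h + t * A n u (k i)) *
          of_real (?w (A n u)))
      \<longlonglongrightarrow> (CLINT u|N. iexp (B u h + t * B u (k i)) *
          of_real (?w (B u)))"
    proof (rule AE_I2)
      fix t
      let ?h = "\<lambda>x. h x + t * k i x"
      have "(\<lambda>n. CLINT u|P. iexp (A n u ?h) * of_real (?w (A n u)))
        \<longlonglongrightarrow> (CLINT u|N. iexp (B u ?h) * of_real (?w (B u)))"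
        by (intro insert.IH k H h) auto
      moreover have "(CLINT u|P. iexp (A n u ?h) * of_real (?w (A n u)))
        = (CLINT u|P. iexp (A n u h + t * A n u (k i)) * of_real (?w (A n u)))" for n
        using h k by (intro Bochner_Integration.integral_cong refl) (simp add: A_lin)
      moreover have "(CLINT u|N. iexp (B u ?h) * of_real (?w (B u)))
        = (CLINT u|N. iexp (B u h + t * B u (k i)) * of_real (?w (B u)))"
        using h k by (intro Bochner_Integration.integral_cong refl) (simp add: B_lin)
      ultimately show "(\<lambda>n. CLINT u|P. iexp (A n u h + t * A n u (k i)) *
          of_real (?w (A n u)))
        \<longlonglongrightarrow> (CLINT u|N. iexp (B u h + t * B u (k i)) *
          of_real (?w (B u)))"
        by simp
    qed
    show "AE t in ?G. norm (CLINT u|P. iexp (A n u h + t * A n u (k i)) *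
        of_real (?w (A n u))) \<le> 1" for n
    proof (rule AE_I2)
      fix t
      have "norm (CLINT u|P. iexp (A n u h + t * A n u (k i)) *
          of_real (?w (A n u)))
        \<le> (LINT u|P. norm (iexp (A n u h + t * A n u (k i)) *
          complex_of_real (?w (A n u))))"
        by (rule integral_norm_bound)
      also have "\<dots> \<le> (LINT u|P. 1)"
        using prod1 by (intro integral_mono' ) (auto simp: norm_mult simp del: of_real_prod)
      finally show "norm (CLINT u|P. iexp (A n u h + t * A n u (k i)) *
          of_real (?w (A n u))) \<le> 1"
        by (simp add: P.prob_space)
    qed
    show "integrable ?G (\<lambda>_. 1 :: real)" by simp
  qed measurable
qed

text \<open>This is the case h = 0, where linearity turns the oscillating factor into 1.\<close>

lemma conv_Laplace_sum_squares:
  fixes k :: "'i \<Rightarrow> 'x \<Rightarrow> real"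
  assumes I: "finite I" "\<And>i. i \<in> I \<Longrightarrow> k i \<in> H" and H0: "(\<lambda>_. 0) \<in> H"
  shows "(\<lambda>n. LINT u|P. exp (- (\<Sum>i\<in>I. (A n u (k i))\<^sup>2) / 2))
    \<longlonglongrightarrow> (LINT u|N. exp (- (\<Sum>i\<in>I. (B u (k i))\<^sup>2) / 2))"
proof -
  have A0: "A n u (\<lambda>_. 0) = 0" if "u \<in> space P" for n u
    using A_lin[OF H0 H0 that, of n 1] by simp
  have B0: "B u (\<lambda>_. 0) = 0" if "u \<in> space N" for u
    using B_lin[OF H0 H0 that, of 1] by simp
  have e: "(\<Prod>i\<in>I. exp (- (f i)\<^sup>2 / 2)) = exp (- (\<Sum>i\<in>I. (f i)\<^sup>2) / 2)" for f :: "'i \<Rightarrow> real"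
    using I(1) by (simp add: exp_sum[symmetric] sum_negf sum_divide_distrib)
  have "(\<lambda>n. CLINT u|P. iexp (A n u (\<lambda>_. 0)) * of_real (exp (- (\<Sum>i\<in>I. (A n u (k i))\<^sup>2) / 2)))
    \<longlonglongrightarrow> (CLINT u|N. iexp (B u (\<lambda>_. 0)) * of_real (exp (- (\<Sum>i\<in>I. (B u (k i))\<^sup>2) / 2)))"
    using conv_Gaussian_weights[OF I H0] unfolding e .
  also have "(\<lambda>n. CLINT u|P. iexp (A n u (\<lambda>_. 0)) * of_real (exp (- (\<Sum>i\<in>I. (A n u (k i))\<^sup>2) / 2)))
    = (\<lambda>n. CLINT u|P. of_real (exp (- (\<Sum>i\<in>I. (A n u (k i))\<^sup>2) / 2)))"
    by (intro ext Bochner_Integration.integral_cong refl) (simp add: A0)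
  also have "(CLINT u|N. iexp (B u (\<lambda>_. 0)) * of_real (exp (- (\<Sum>i\<in>I. (B u (k i))\<^sup>2) / 2)))
    = (CLINT u|N. of_real (exp (- (\<Sum>i\<in>I. (B u (k i))\<^sup>2) / 2)))"
    by (intro Bochner_Integration.integral_cong refl) (simp add: B0)
  finally show ?thesis
    unfolding integral_complex_of_real by (simp only: tendsto_of_real_iff)
qed

end

section \<open>Normal laws and second moments of random functions\<close>

lemma affine_std_normal_density:
  assumes s: "s > 0"
  shows "distr std_normal_distribution borel (\<lambda>x. m + s * x)
    = density lborel (\<lambda>x. ennreal (normal_density m s x))"
proof -
  interpret G: prob_space std_normal_distribution by (rule prob_space_normal_density) simp
  have "distributed std_normal_distribution lborel (\<lambda>x. x) std_normal_density"
    by (auto simp: distributed_def intro!: distr_id2)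
  then have "distributed std_normal_distribution lborel (\<lambda>x. m + s * x)
      (normal_density (m + s * 0) (\<bar>s\<bar> * 1))"
    using s by (intro G.normal_density_affine) auto
  then have "distr std_normal_distribution lborel (\<lambda>x. m + s * x)
      = density lborel (\<lambda>x. ennreal (normal_density m s x))"
    using s by (simp add: distributed_def)
  moreover have "distr std_normal_distribution lborel (\<lambda>x. m + s * x)
      = distr std_normal_distribution borel (\<lambda>x. m + s * x)"
    by (rule distr_cong) simp_all
  ultimately show ?thesis by simp
qed

text \<open>Affine images of one law treat point masses (s = 0) and densities alike, which avoids
  the case distinction in the computations with normal laws.\<close>

lemma normal_law_iff:
  "normal_law \<nu> \<longleftrightarrow> (\<exists>m s. s \<ge> 0 \<and> \<nu> = distr std_normal_distribution borel (\<lambda>x. m + s * x))"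
proof -
  interpret G: prob_space std_normal_distribution by (rule prob_space_normal_density) simp
  have 0: "distr std_normal_distribution borel (\<lambda>x. m + 0 * x) = return borel m" for m :: real
    by simp
  show ?thesis
  proof
    assume "normal_law \<nu>"
    then obtain m s where "\<nu> = return borel m
        \<or> s > 0 \<and> \<nu> = density lborel (\<lambda>x. ennreal (normal_density m s x))"
      unfolding normal_law_def by blast
    then show "\<exists>m s. s \<ge> 0 \<and> \<nu> = distr std_normal_distribution borel (\<lambda>x. m + s * x)"
    proof
      assume "\<nu> = return borel m"
      then show ?thesis using 0[of m] by (intro exI[of _ m] exI[of _ 0]) simp
    next
      assume "s > 0 \<and> \<nu> = density lborel (\<lambda>x. ennreal (normal_density m s x))"
      then show ?thesis
        using affine_std_normal_density[of s m] by (intro exI[of _ m] exI[of _ s]) simp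
    qed
  next
    assume "\<exists>m s. s \<ge> 0 \<and> \<nu> = distr std_normal_distribution borel (\<lambda>x. m + s * x)"
    then obtain m s where ms: "s \<ge> 0" "\<nu> = distr std_normal_distribution borel (\<lambda>x. m + s * x)"
      by blast
    show "normal_law \<nu>"
    proof (cases "s = 0")
      case True
      then show ?thesis using ms 0[of m] unfolding normal_law_def by auto
    next
      case False
      then show ?thesis
        using ms affine_std_normal_density[of s m]
        unfolding normal_law_def by (intro exI[of _ m] exI[of _ s] disjI2) simp
    qed
  qed
qed

lemma char_affine_std_normal:
  "char (distr std_normal_distribution borel (\<lambda>x. m + s * x)) t
    = iexp (t * m) * of_real (exp (- (s * t)\<^sup>2 / 2))"
proof -
  have "char (distr std_normal_distribution borel (\<lambda>x. m + s * x)) t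
      = (CLINT x|std_normal_distribution. iexp (t * m) * iexp ((s * t) * x))"
    unfolding char_def
    by (subst integral_distr) (auto intro!: Bochner_Integration.integral_cong simp: algebra_simps simp flip: exp_add)
  also have "\<dots> = iexp (t * m) * char std_normal_distribution (s * t)"
    unfolding char_def by simp
  finally show ?thesis by (simp add: char_std_normal_distribution)
qed

text \<open>The two moments force m = 0 and s^2 = q, point masses included.\<close>

lemma normal_law_char:
  assumes \<nu>: "normal_law \<nu>" and mean: "(LINT x|\<nu>. x) = 0" and var: "(LINT x|\<nu>. x * x) = q"
  shows "char \<nu> t = of_real (exp (- q * t\<^sup>2 / 2))"
proof -
  let ?G = std_normal_distribution
  obtain m s where s: "s \<ge> 0" and eq: "\<nu> = distr ?G borel (\<lambda>x. m + s * x)"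
    using \<nu> unfolding normal_law_iff by blast
  interpret G: prob_space ?G by (rule prob_space_normal_density) simp
  have i1: "integrable ?G (\<lambda>x. x)" and i2: "integrable ?G (\<lambda>x. x\<^sup>2)"
    using integrable_std_normal_distribution_moment[of 1] integrable_std_normal_distribution_moment[of 2]
    by simp_all
  have m1: "(LINT x|?G. x) = 0"
    using integral_std_normal_distribution_moment_odd[of 1] by simp
  have m2: "(LINT x|?G. x\<^sup>2) = 1"
    using std_normal_distribution_even_moments(1)[of 1] by (simp add: fact_numeral)
  have "(LINT x|\<nu>. x) = (LINT x|?G. m + s * x)"
    unfolding eq by (subst integral_distr) auto
  also have "\<dots> = m" using i1 m1 by (simp add: G.prob_space[simplified])
  finally have m: "m = 0" using mean by simp
  have "(LINT x|\<nu>. x * x) = (LINT x|?G. s\<^sup>2 * x\<^sup>2)"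
    unfolding eq m by (subst integral_distr) (auto simp: power2_eq_square ac_simps)
  also have "\<dots> = s\<^sup>2" using m2 by simp
  finally have "q = s\<^sup>2" using var by simp
  then show ?thesis
    unfolding eq char_affine_std_normal m by (simp add: power_mult_distrib)
qed

section \<open>Second moments of jointly measurable processes\<close>

context
  fixes N :: "'b measure" and M :: "'x measure" and V :: "'b \<Rightarrow> 'x \<Rightarrow> real" and C :: real
  assumes N: "prob_space N" and M: "finite_measure M"
    and V: "(\<lambda>(u, x). V u x) \<in> borel_measurable (N \<Otimes>\<^sub>M M)"
    and sq: "\<And>x. x \<in> space M \<Longrightarrow> integrable N (\<lambda>u. (V u x)\<^sup>2)"
    and C: "\<And>x. x \<in> space M \<Longrightarrow> (LINT u|N. (V u x)\<^sup>2) \<le> C"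
begin

interpretation N: prob_space N by (rule N)
interpretation M: finite_measure M by (rule M)
interpretation NM: pair_sigma_finite N M ..
interpretation MN: pair_sigma_finite M N ..
interpretation MM: pair_sigma_finite M M ..

lemma measurable_swapped: "(\<lambda>z. V (snd z) (fst z)) \<in> borel_measurable (M \<Otimes>\<^sub>M N)"
  using measurable_compose[OF measurable_pair_swap' V] by (simp add: case_prod_unfold comp_def)

lemma measurable_slice:
  "x \<in> space M \<Longrightarrow> (\<lambda>u. V u x) \<in> borel_measurable N"
  using measurable_compose[OF measurable_Pair2' V, of x]
  by (simp add: case_prod_unfold)

lemma measurable_L2_inner_process:
  assumes "h \<in> borel_measurable M"
  shows "(\<lambda>u. L2_inner M (V u) h) \<in> borel_measurable N"
proof -
  note [measurable] = V assms
  show ?thesis unfolding L2_inner_def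
    by (rule M.borel_measurable_lebesgue_integral) (use V in measurable)
qed

text \<open>The uniform moment bound C and the finiteness of M give joint integrability by Tonelli.
  The context serves the normalised sums, the limit process and the truncation error of the limit
  process alike.\<close>

lemma integrable_square_process: "integrable (N \<Otimes>\<^sub>M M) (\<lambda>(u, x). (V u x)\<^sup>2)"
proof -
  note [measurable] = measurable_swapped V
  have "integrable (M \<Otimes>\<^sub>M N) (\<lambda>(x, u). (V u x)\<^sup>2)"
  proof (rule MN.Fubini_integrable)
    show "integrable M (\<lambda>x. LINT u|N. norm ((\<lambda>(x, u). (V u x)\<^sup>2) (x, u)))"
    proof (rule M.integrable_const_bound[where B=C])
      show "(\<lambda>x. LINT u|N. norm ((\<lambda>(x, u). (V u x)\<^sup>2) (x, u))) \<in> borel_measurable M"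
        by (rule N.borel_measurable_lebesgue_integral) (use measurable_swapped in \<open>simp add: case_prod_unfold\<close>)
    qed (use C in \<open>auto intro!: AE_I2\<close>)
    show "AE x in M. integrable N (\<lambda>u. (\<lambda>(x, u). (V u x)\<^sup>2) (x, u))"
      using sq by (auto intro!: AE_I2)
  qed (use measurable_swapped in \<open>simp add: case_prod_unfold\<close>)
  from MN.integrable_product_swap[OF this] show ?thesis by (simp add: case_prod_unfold)
qed

lemma integrable_norm_process: "integrable N (\<lambda>u. LINT x|M. (V u x)\<^sup>2)"
  using NM.integrable_fst[of "\<lambda>u x. (V u x)\<^sup>2"] integrable_square_process by simp

lemma integral_norm_process: "(LINT u|N. LINT x|M. (V u x)\<^sup>2) = (LINT x|M. LINT u|N. (V u x)\<^sup>2)"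
  using NM.Fubini_integral[of "\<lambda>u x. (V u x)\<^sup>2"] integrable_square_process by simp

lemma AE_L2_fun_process: "AE u in N. V u \<in> L2_fun M"
proof -
  have "AE u in N. integrable M (\<lambda>x. (V u x)\<^sup>2)"
    using NM.AE_integrable_fst[of "\<lambda>u x. (V u x)\<^sup>2"] integrable_square_process by simp
  moreover have "AE u in N. V u \<in> borel_measurable M"
  proof (rule AE_I2)
    fix u assume "u \<in> space N"
    then show "V u \<in> borel_measurable M"
      using measurable_compose[OF measurable_Pair1' V] by simp
  qed
  ultimately show ?thesis by eventually_elim (simp add: L2_fun_def)
qed

text \<open>Fubini on M x M x N. By the arithmetic-geometric mean inequality E |V x V y| \<le> C, so
  after integrating over N the integrand is dominated by |C| |g x| |h y|, and this is integrable
  over M x M.\<close>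

lemma
  assumes g: "integrable M g" and h: "integrable M h"
  shows integrable_inner_mult_process: "integrable N (\<lambda>u. L2_inner M (V u) g * L2_inner M (V u) h)" (is ?int)
    and integral_inner_mult_process: "(LINT u|N. L2_inner M (V u) g * L2_inner M (V u) h)
      = (LINT x|M. LINT y|M. (LINT u|N. V u x * V u y) * g x * h y)" (is ?eq)
proof -
  note [measurable] = measurable_swapped V borel_measurable_integrable[OF g] borel_measurable_integrable[OF h]
  interpret MM: finite_measure "M \<Otimes>\<^sub>M M" by (rule finite_measure_pair_measure) unfold_locales
  interpret Q: pair_sigma_finite "M \<Otimes>\<^sub>M M" N ..
  let ?F = "\<lambda>z u. (V u (fst z) * g (fst z)) * (V u (snd z) * h (snd z))"
  have Vm: "(\<lambda>z. V (snd z) (fst (fst z))) \<in> borel_measurable ((M \<Otimes>\<^sub>M M) \<Otimes>\<^sub>M N)"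
    "(\<lambda>z. V (snd z) (snd (fst z))) \<in> borel_measurable ((M \<Otimes>\<^sub>M M) \<Otimes>\<^sub>M N)"
    using measurable_compose[OF _ measurable_swapped, of "\<lambda>z. (fst (fst z), snd z)" "(M \<Otimes>\<^sub>M M) \<Otimes>\<^sub>M N"]
      measurable_compose[OF _ measurable_swapped, of "\<lambda>z. (snd (fst z), snd z)" "(M \<Otimes>\<^sub>M M) \<Otimes>\<^sub>M N"]
    by simp_all
  have Fm [measurable]: "(\<lambda>(z, u). ?F z u) \<in> borel_measurable ((M \<Otimes>\<^sub>M M) \<Otimes>\<^sub>M N)"
    unfolding case_prod_unfold using Vm by measurable
  have prod: "integrable N (\<lambda>u. V u x * V u y)" "(LINT u|N. \<bar>V u x * V u y\<bar>) \<le> C"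
    if "x \<in> space M" "y \<in> space M" for x y
  proof -
    have b: "\<bar>a * b\<bar> \<le> (a\<^sup>2 + b\<^sup>2) / 2" for a b :: real
      using sum_squares_bound[of "\<bar>a\<bar>" "\<bar>b\<bar>"] by (simp add: abs_mult)
    have i: "integrable N (\<lambda>u. ((V u x)\<^sup>2 + (V u y)\<^sup>2) / 2)"
      using sq that by simp
    show *: "integrable N (\<lambda>u. V u x * V u y)"
    proof (rule Bochner_Integration.integrable_bound[OF i])
      show "(\<lambda>u. V u x * V u y) \<in> borel_measurable N"
        using measurable_slice that by simp
    qed (use b in \<open>auto intro!: AE_I2\<close>)
    have "(LINT u|N. \<bar>V u x * V u y\<bar>) \<le> (LINT u|N. ((V u x)\<^sup>2 + (V u y)\<^sup>2) / 2)"
      using * i b by (intro integral_mono) auto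
    also have "\<dots> \<le> C" using sq C[OF that(1)] C[OF that(2)] that by simp
    finally show "(LINT u|N. \<bar>V u x * V u y\<bar>) \<le> C" .
  qed
  have gh: "integrable (M \<Otimes>\<^sub>M M) (\<lambda>z. \<bar>C\<bar> * (\<bar>g (fst z)\<bar> * \<bar>h (snd z)\<bar>))"
  proof (intro integrable_mult_right MM.Fubini_integrable)
    show "integrable M (\<lambda>x. LINT y|M. norm (\<bar>g (fst (x, y))\<bar> * \<bar>h (snd (x, y))\<bar>))"
      using g by (simp add: abs_mult)
    show "AE x in M. integrable M (\<lambda>y. \<bar>g (fst (x, y))\<bar> * \<bar>h (snd (x, y))\<bar>)"
      using h by simp
  qed measurable
  have F: "integrable ((M \<Otimes>\<^sub>M M) \<Otimes>\<^sub>M N) (\<lambda>(z, u). ?F z u)"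
  proof (rule Q.Fubini_integrable[OF Fm])
    have eqF: "?F z u = (g (fst z) * h (snd z)) * (V u (fst z) * V u (snd z))" for z u
      by (simp add: ac_simps)
    show "integrable (M \<Otimes>\<^sub>M M) (\<lambda>z. LINT u|N. norm ((\<lambda>(z, u). ?F z u) (z, u)))"
    proof (rule Bochner_Integration.integrable_bound[OF gh])
      show "(\<lambda>z. LINT u|N. norm ((\<lambda>(z, u). ?F z u) (z, u))) \<in> borel_measurable (M \<Otimes>\<^sub>M M)"
        by (rule N.borel_measurable_lebesgue_integral) (use Fm in \<open>simp add: case_prod_unfold\<close>)
      show "AE z in M \<Otimes>\<^sub>M M. norm (LINT u|N. norm ((\<lambda>(z, u). ?F z u) (z, u)))
          \<le> norm (\<bar>C\<bar> * (\<bar>g (fst z)\<bar> * \<bar>h (snd z)\<bar>))"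
      proof (rule AE_I2)
        fix z assume "z \<in> space (M \<Otimes>\<^sub>M M)"
        then have z: "fst z \<in> space M" "snd z \<in> space M" by (auto simp: space_pair_measure)
        have "norm (LINT u|N. norm ((\<lambda>(z, u). ?F z u) (z, u)))
            = \<bar>g (fst z) * h (snd z)\<bar> * (LINT u|N. \<bar>V u (fst z) * V u (snd z)\<bar>)"
          unfolding split_conv eqF real_norm_def abs_mult[of "g (fst z) * h (snd z)"] by simp
        also have "\<dots> \<le> \<bar>g (fst z) * h (snd z)\<bar> * \<bar>C\<bar>"
          using prod(2)[OF z] by (intro mult_left_mono) auto
        finally show "norm (LINT u|N. norm ((\<lambda>(z, u). ?F z u) (z, u)))
          \<le> norm (\<bar>C\<bar> * (\<bar>g (fst z)\<bar> * \<bar>h (snd z)\<bar>))" by (simp add: abs_mult ac_simps)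
      qed
    qed
    show "AE z in M \<Otimes>\<^sub>M M. integrable N (\<lambda>u. (\<lambda>(z, u). ?F z u) (z, u))"
      unfolding split_conv eqF using prod(1) by (intro AE_I2 integrable_mult_right) (auto simp: space_pair_measure)
  qed
  have inner: "L2_inner M (V u) g * L2_inner M (V u) h
      = (LINT x|M. LINT y|M. ?F (x, y) u)" for u
    by (simp add: L2_inner_def)
  have "AE u in N. integrable (M \<Otimes>\<^sub>M M) (\<lambda>z. ?F z u)"
    using Q.AE_integrable_snd[of ?F] F by simp
  then have ae: "AE u in N. L2_inner M (V u) g * L2_inner M (V u) h = (LINT z|(M \<Otimes>\<^sub>M M). ?F z u)"
    by eventually_elim (simp add: inner MM.integral_fst'[symmetric])
  have meas: "(\<lambda>u. L2_inner M (V u) g * L2_inner M (V u) h) \<in> borel_measurable N"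
    by (intro borel_measurable_times measurable_L2_inner_process) auto
  have int: "integrable N (\<lambda>u. LINT z|(M \<Otimes>\<^sub>M M). ?F z u)"
    using Q.integrable_snd[of ?F] F by simp
  show ?int
    using int by (subst integrable_cong_AE[OF meas borel_measurable_integrable[OF int] ae])
  have "(LINT u|N. L2_inner M (V u) g * L2_inner M (V u) h) = (LINT u|N. LINT z|(M \<Otimes>\<^sub>M M). ?F z u)"
    by (rule integral_cong_AE[OF meas borel_measurable_integrable[OF int] ae])
  also have "\<dots> = (LINT z|(M \<Otimes>\<^sub>M M). LINT u|N. ?F z u)"
    using Q.Fubini_integral[of ?F] F by simp
  also have "\<dots> = (LINT x|M. LINT y|M. LINT u|N. ?F (x, y) u)"
    using Q.integrable_fst[of ?F] F by (subst MM.integral_fst') simp_all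
  also have "\<dots> = (LINT x|M. LINT y|M. (LINT u|N. V u x * V u y) * g x * h y)"
  proof -
    have "(LINT u|N. ?F (x, y) u) = (LINT u|N. (V u x * V u y) * (g x * h y))" for x y
      by (intro Bochner_Integration.integral_cong refl) (simp add: ac_simps)
    then have "(LINT u|N. ?F (x, y) u) = (LINT u|N. V u x * V u y) * (g x * h y)" for x y
      by (simp only: integral_mult_left_zero)
    then show ?thesis by (simp only: mult.assoc)
  qed
  finally show ?eq .
qed

end

section \<open>The central limit theorem for the squared norm\<close>

definition normalised_sum :: "(nat \<Rightarrow> 'x \<Rightarrow> real) \<Rightarrow> nat \<Rightarrow> 'x \<Rightarrow> real" where
  "normalised_sum f n x = (\<Sum>i<n. f i x) / sqrt n"

text \<open>Interchange of the limits in m and n, licensed by an error \<open>\<delta> m\<close>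
  that is uniform in n. The restriction n \<ge> 1 matches the covariance identity of the normalised
  sums, which excludes the empty sum.\<close>

lemma tendsto_uniform_approx:
  fixes a :: "nat \<Rightarrow> real"
  assumes close: "\<And>m n. n \<ge> 1 \<Longrightarrow> \<bar>a n - a' m n\<bar> \<le> \<delta> m" and \<delta>: "\<delta> \<longlonglongrightarrow> 0"
    and a': "\<And>m. a' m \<longlonglongrightarrow> b' m" and b': "b' \<longlonglongrightarrow> b"
  shows "a \<longlonglongrightarrow> b"
proof (rule LIMSEQ_I)
  fix r :: real assume r: "0 < r"
  have "\<forall>\<^sub>F m in sequentially. \<delta> m < r / 3" "\<forall>\<^sub>F m in sequentially. dist (b' m) b < r / 3"
    using r by (intro order_tendstoD(2)[OF \<delta>] tendstoD[OF b'], simp)+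
  then have "\<forall>\<^sub>F m in sequentially. \<delta> m < r / 3 \<and> dist (b' m) b < r / 3"
    by eventually_elim simp
  then obtain m where m: "\<delta> m < r / 3" "dist (b' m) b < r / 3"
    unfolding eventually_sequentially by blast
  have "\<forall>\<^sub>F n in sequentially. dist (a' m n) (b' m) < r / 3"
    using r by (intro tendstoD[OF a']) simp
  then have "\<forall>\<^sub>F n in sequentially. norm (a n - b) < r"
    using eventually_ge_at_top[of "1::nat"]
  proof eventually_elim
    case (elim n)
    then show ?case using close[of n m] m unfolding real_norm_def dist_real_def by linarith
  qed
  then show "\<exists>n0. \<forall>n\<ge>n0. norm (a n - b) < r" by (simp add: eventually_sequentially)
qed

context discretised_measure
begin

context
  fixes P :: "'a measure" and K :: "'w measure" and W :: "nat \<Rightarrow> 'a \<Rightarrow> 'w"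
    and Y :: "'w \<Rightarrow> 'x \<Rightarrow> real" and B :: real
  assumes P: "prob_space P" and indep: "prob_space.indep_vars P (\<lambda>_. K) W UNIV"
    and ident: "\<And>i. distr P K (W i) = distr P K (W 0)"
    and Y: "(\<lambda>(v, x). Y v x) \<in> borel_measurable (K \<Otimes>\<^sub>M M)"
    and B: "\<And>v x. \<bar>Y v x\<bar> \<le> B"
    and centred: "\<And>x. x \<in> space M \<Longrightarrow> (LINT u|P. Y (W 0 u) x) = 0"
begin

interpretation P: prob_space P by (rule P)

abbreviation (input) "S n u \<equiv> normalised_sum (\<lambda>i. Y (W i u)) n"

lemma measurable_sample [measurable]: "W i \<in> P \<rightarrow>\<^sub>M K"
  using indep unfolding P.indep_vars_def2 by simp

lemma measurable_summand_at:
  "x \<in> space M \<Longrightarrow> (\<lambda>v. Y v x) \<in> borel_measurable K"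
  using measurable_compose[OF measurable_Pair2' Y, of x] by simp

lemma integral_summand_eq:
  assumes "f \<in> borel_measurable K"
  shows "(LINT u|P. f (W i u) :: real) = (LINT u|P. f (W 0 u))"
proof -
  have "(LINT u|P. f (W i u)) = (LINT v|distr P K (W i). f v)"
    using assms by (subst integral_distr) auto
  also have "\<dots> = (LINT v|distr P K (W 0). f v)" by (simp only: ident[of i])
  also have "\<dots> = (LINT u|P. f (W 0 u))"
    using assms by (subst integral_distr) auto
  finally show ?thesis .
qed

lemma measurable_summand:
  "(\<lambda>(u, x). Y (W i u) x) \<in> borel_measurable (P \<Otimes>\<^sub>M M)"
proof -
  have "(\<lambda>z. (W i (fst z), snd z)) \<in> P \<Otimes>\<^sub>M M \<rightarrow>\<^sub>M K \<Otimes>\<^sub>M M" by measurable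
  from measurable_compose[OF this Y] show ?thesis by (simp add: case_prod_unfold)
qed

lemma measurable_normalised_sum:
  "(\<lambda>(u, x). S n u x) \<in> borel_measurable (P \<Otimes>\<^sub>M M)"
  using measurable_summand unfolding normalised_sum_def case_prod_unfold by measurable

lemma B_nonneg: "0 \<le> B"
  using B[of undefined undefined] by linarith

lemma normalised_sum_bound: "\<bar>S n u x\<bar> \<le> sqrt n * B"
proof -
  have "\<bar>\<Sum>i<n. Y (W i u) x\<bar> \<le> (\<Sum>i<n. B)"
    by (rule order_trans[OF sum_abs sum_mono[OF B]])
  then have "\<bar>S n u x\<bar> \<le> (real n * B) / sqrt n"
    by (simp add: normalised_sum_def divide_right_mono)
  also have "\<dots> = sqrt n * B"
    by (cases "n = 0") (simp_all add: field_simps)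
  finally show ?thesis .
qed

lemma summand_L2_fun: "u \<in> space P \<Longrightarrow> Y (W i u) \<in> L2_fun M"
  using measurable_compose[OF measurable_Pair1' measurable_summand, of u i] B
  by (intro L2_fun_bounded[where B=B]) auto

lemma normalised_sum_L2_fun: "u \<in> space P \<Longrightarrow> S n u \<in> L2_fun M"
  using measurable_compose[OF measurable_Pair1' measurable_normalised_sum, of u n]
    normalised_sum_bound
  by (intro L2_fun_bounded[where B="sqrt n * B"]) auto

lemma integrable_summands:
  assumes "x \<in> space M" "y \<in> space M"
  shows "integrable P (\<lambda>u. Y (W i u) x * Y (W j u) y)"
proof (rule P.integrable_const_bound[where B="B * B"])
  show "(\<lambda>u. Y (W i u) x * Y (W j u) y) \<in> borel_measurable P"
    using measurable_compose[OF measurable_sample measurable_summand_at] assms by simp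
  show "AE u in P. norm (Y (W i u) x * Y (W j u) y) \<le> B * B"
    using B B_nonneg by (intro AE_I2) (simp add: abs_mult mult_mono)
qed

lemma covariance_summands:
  assumes x: "x \<in> space M" and y: "y \<in> space M"
  shows "(LINT u|P. Y (W i u) x * Y (W j u) y)
    = (if i = j then LINT u|P. Y (W 0 u) x * Y (W 0 u) y else 0)"
proof (cases "i = j")
  case True
  have "(\<lambda>v. Y v x * Y v y) \<in> borel_measurable K"
    using measurable_summand_at x y by simp
  from integral_summand_eq[OF this, of i] show ?thesis using True by simp
next
  case False
  \<comment> \<open>Using a different function at each of the two indices makes the product a
    product over {i, j} of functions of independent variables.\<close>
  define Z where "Z k v = (if k = i then Y v x else Y v y)" for k v
  have Z: "Z k \<in> borel_measurable K" for k
    using measurable_summand_at x y by (simp add: Z_def[abs_def])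
  have "P.indep_vars (\<lambda>_. borel) (\<lambda>k u. Z k (W k u)) UNIV"
    using indep Z by (rule P.indep_vars_compose2)
  then have ind: "P.indep_vars (\<lambda>_. borel) (\<lambda>k u. Z k (W k u)) {i, j}"
    by (rule P.indep_vars_subset) simp
  have int: "integrable P (\<lambda>u. Z k (W k u))" for k
    using measurable_compose[OF measurable_sample Z] B
    by (intro P.integrable_const_bound[where B=B]) (auto simp: Z_def)
  have "(LINT u|P. Y (W i u) x * Y (W j u) y) = (LINT u|P. (\<Prod>k\<in>{i, j}. Z k (W k u)))"
    using False by (simp add: Z_def)
  also have "\<dots> = (\<Prod>k\<in>{i, j}. LINT u|P. Z k (W k u))"
    using ind int by (intro P.indep_vars_lebesgue_integral) auto
  also have "\<dots> = 0"
    using integral_summand_eq[OF measurable_summand_at[OF x], of i] centred[OF x]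
    by (simp add: Z_def)
  finally show ?thesis using False by simp
qed

text \<open>Off-diagonal terms vanish by independence and centring, and the n equal diagonal terms
  cancel the factor 1 / n. That n drops out is the source of the uniformity in n.\<close>

lemma covariance_normalised_sum:
  assumes x: "x \<in> space M" and y: "y \<in> space M" and n: "n \<ge> 1"
  shows "(LINT u|P. S n u x * S n u y) = (LINT u|P. Y (W 0 u) x * Y (W 0 u) y)"
proof -
  let ?k = "LINT u|P. Y (W 0 u) x * Y (W 0 u) y"
  have "S n u x * S n u y = (\<Sum>i<n. \<Sum>j<n. Y (W i u) x * Y (W j u) y) / n" for u
    by (simp add: normalised_sum_def sum_product)
  then have "(LINT u|P. S n u x * S n u y)
      = (\<Sum>i<n. \<Sum>j<n. LINT u|P. Y (W i u) x * Y (W j u) y) / n"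
    using integrable_summands[OF x y] by simp
  also have "\<dots> = (\<Sum>i<n. \<Sum>j<n. if i = j then ?k else 0) / n"
    by (intro arg_cong2[where f="(/)"] sum.cong refl covariance_summands x y)
  also have "\<dots> = ?k"
    using n by simp
  finally show ?thesis .
qed

text \<open>The bound grows with n; it only licenses Fubini for each fixed n. Uniform control comes
  from the covariance identity instead.\<close>

lemma
  shows integrable_square_normalised_sum:
    "x \<in> space M \<Longrightarrow> integrable P (\<lambda>u. (S n u x)\<^sup>2)" (is "_ \<Longrightarrow> ?int x")
    and square_normalised_sum_le:
    "x \<in> space M \<Longrightarrow> (LINT u|P. (S n u x)\<^sup>2) \<le> (sqrt n * B)\<^sup>2" (is "_ \<Longrightarrow> ?le x")
proof -
  assume x: "x \<in> space M"
  have le: "(S n u x)\<^sup>2 \<le> (sqrt n * B)\<^sup>2" for u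
    using normalised_sum_bound[of u n x] by (simp add: abs_le_square_iff[symmetric])
  have meas: "(\<lambda>u. S n u x) \<in> borel_measurable P"
    using measurable_compose[OF measurable_Pair2'[OF x] measurable_normalised_sum[where n=n]] by simp
  show int: "?int x"
  proof (rule P.integrable_const_bound[OF AE_I2])
    show "norm ((S n u x)\<^sup>2) \<le> (sqrt n * B)\<^sup>2" for u
      using le[of u] by (simp only: real_norm_def abs_power2)
    show "(\<lambda>u. (S n u x)\<^sup>2) \<in> borel_measurable P"
      using meas by (rule borel_measurable_power)
  qed
  have "(LINT u|P. (S n u x)\<^sup>2) \<le> (LINT u|P. (sqrt n * B)\<^sup>2)"
    using int le by (intro integral_mono) auto
  also have "\<dots> = (sqrt n * B)\<^sup>2" by (simp add: P.prob_space)
  finally show "?le x" .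
qed

lemma normalised_sum_process:
  shows "prob_space P" "finite_measure M" "(\<lambda>(u, x). S n u x) \<in> borel_measurable (P \<Otimes>\<^sub>M M)"
    and "x \<in> space M \<Longrightarrow> integrable P (\<lambda>u. (S n u x)\<^sup>2)"
    and "x \<in> space M \<Longrightarrow> (LINT u|P. (S n u x)\<^sup>2) \<le> (sqrt n * B)\<^sup>2"
  by (fact P finite_measure_axioms measurable_normalised_sum
      integrable_square_normalised_sum square_normalised_sum_le)+

lemma integral_inner_normalised_sum:
  assumes "g \<in> L2_fun M" "h \<in> L2_fun M" and n: "n \<ge> 1"
  shows "(LINT u|P. L2_inner M (S n u) g * L2_inner M (S n u) h)
    = (LINT x|M. LINT y|M. (LINT u|P. Y (W 0 u) x * Y (W 0 u) y) * g x * h y)"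
  using integral_inner_mult_process[OF normalised_sum_process(1,2) normalised_sum_process(3-5)[where n=n], of g h] L2_fun_integrable assms
  by (simp add: covariance_normalised_sum cong: Bochner_Integration.integral_cong)

lemma L2_inner_normalised_sum:
  assumes "u \<in> space P" "h \<in> L2_fun M"
  shows "L2_inner M (S n u) h = (\<Sum>i<n. L2_inner M (Y (W i u)) h) / sqrt n"
proof -
  have eq: "S n u = (\<lambda>x. (1 / sqrt n) * (\<Sum>i<n. Y (W i u) x))"
    by (simp add: normalised_sum_def fun_eq_iff)
  show ?thesis
    unfolding eq L2_inner_cmult_left
    using assms summand_L2_fun by (subst L2_inner_sum_left) simp_all
qed

lemma measurable_inner_summand:
  assumes h: "h \<in> L2_fun M"
  shows "(\<lambda>v. L2_inner M (Y v) h) \<in> borel_measurable K"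
  unfolding L2_inner_def
proof (rule borel_measurable_lebesgue_integral)
  show "(\<lambda>(v, x). Y v x * h x) \<in> borel_measurable (K \<Otimes>\<^sub>M M)"
    using Y L2_funD(1)[OF h] unfolding case_prod_unfold by measurable
qed

lemma normalised_sum_1: "S (Suc 0) u = Y (W 0 u)"
  by (simp add: normalised_sum_def fun_eq_iff)

lemma expectation_inner_summand:
  assumes h: "h \<in> L2_fun M"
  shows "(LINT u|P. L2_inner M (Y (W 0 u)) h) = 0"
proof -
  note [measurable] = L2_funD(1)[OF h] 
  interpret PM: pair_sigma_finite P M ..
  interpret MP: pair_sigma_finite M P ..
  have sw: "(\<lambda>(x, u). Y (W 0 u) x) \<in> borel_measurable (M \<Otimes>\<^sub>M P)"
    using measurable_compose[OF measurable_pair_swap' measurable_summand[of 0]]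
    by (simp add: case_prod_unfold comp_def)
  have "integrable (M \<Otimes>\<^sub>M P) (\<lambda>(x, u). Y (W 0 u) x * h x)"
  proof (rule MP.Fubini_integrable)
    show meas: "(\<lambda>(x, u). Y (W 0 u) x * h x) \<in> borel_measurable (M \<Otimes>\<^sub>M P)"
      using sw unfolding case_prod_unfold by measurable
    have int: "integrable P (\<lambda>u. Y (W 0 u) x)" if "x \<in> space M" for x
      using measurable_compose[OF measurable_sample[of 0] measurable_summand_at[OF that]] B
      by (intro P.integrable_const_bound[where B=B]) auto
    then show "AE x in M. integrable P (\<lambda>u. (\<lambda>(x, u). Y (W 0 u) x * h x) (x, u))"
      by (auto intro!: AE_I2)
    show "integrable M (\<lambda>x. LINT u|P. norm ((\<lambda>(x, u). Y (W 0 u) x * h x) (x, u)))"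
    proof (rule Bochner_Integration.integrable_bound)
      show "integrable M (\<lambda>x. B * h x)" using L2_fun_integrable[OF h] by simp
      show "(\<lambda>x. LINT u|P. norm ((\<lambda>(x, u). Y (W 0 u) x * h x) (x, u))) \<in> borel_measurable M"
        by (rule P.borel_measurable_lebesgue_integral) (use meas in \<open>simp add: case_prod_unfold\<close>)
      show "AE x in M. norm (LINT u|P. norm ((\<lambda>(x, u). Y (W 0 u) x * h x) (x, u))) \<le> norm (B * h x)"
      proof (rule AE_I2)
        fix x assume x: "x \<in> space M"
        have "(LINT u|P. \<bar>Y (W 0 u) x\<bar>) \<le> (LINT u|P. B)"
          using int[OF x] B by (intro integral_mono) auto
        then have "(LINT u|P. \<bar>Y (W 0 u) x\<bar>) \<le> B"
          by (simp add: P.prob_space)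
        then show "norm (LINT u|P. norm ((\<lambda>(x, u). Y (W 0 u) x * h x) (x, u))) \<le> norm (B * h x)"
          using B_nonneg by (simp add: abs_mult mult_right_mono)
      qed
    qed
  qed
  then have "(LINT u|P. LINT x|M. Y (W 0 u) x * h x) = (LINT x|M. LINT u|P. Y (W 0 u) x * h x)"
    by (rule MP.Fubini_integral)
  also have "\<dots> = (LINT x|M. 0)"
    by (intro Bochner_Integration.integral_cong refl) (simp add: centred)
  finally show ?thesis by (simp add: L2_inner_def)
qed

text \<open>The inner product is linear, so it is a normalised sum of the scalar variables
  \<open>\<xi> i\<close>, independent and identically distributed, whose variance q is the
  covariance form at (h, h).\<close>

lemma conv_iexp_inner:
  assumes h: "h \<in> L2_fun M"
    and q: "q = (LINT x|M. LINT y|M. (LINT u|P. Y (W 0 u) x * Y (W 0 u) y) * h x * h y)"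
  shows "(\<lambda>n. CLINT u|P. iexp (L2_inner M (S n u) h)) \<longlonglongrightarrow> of_real (exp (- q / 2))"
proof -
  define \<xi> where "\<xi> i u = L2_inner M (Y (W i u)) h" for i u
  note meas = measurable_inner_summand[OF h]
  have \<xi>m [measurable]: "\<xi> i \<in> borel_measurable P" for i
    unfolding \<xi>_def using measurable_compose[OF measurable_sample meas] .
  have ind: "P.indep_vars (\<lambda>_. borel) \<xi> UNIV"
    unfolding \<xi>_def[abs_def] using indep meas by (rule P.indep_vars_compose2)
  have mean: "(LINT u|P. \<xi> i u) = 0" for i
    unfolding \<xi>_def using integral_summand_eq[OF meas, of i] expectation_inner_summand[OF h] by simp
  \<comment> \<open>The moments of \<open>\<xi> 0\<close> are read off from n = 1, where the
    normalised sum is the single summand.\<close>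
  have sqi0: "integrable P (\<lambda>u. \<xi> 0 u * \<xi> 0 u)"
    unfolding \<xi>_def using integrable_inner_mult_process[OF normalised_sum_process(1,2) normalised_sum_process(3-5)[where n=1], of h h]
      L2_fun_integrable[OF h] by (simp add: normalised_sum_1)
  have sq0: "(LINT u|P. \<xi> 0 u * \<xi> 0 u) = q"
    unfolding \<xi>_def q using integral_inner_normalised_sum[OF h h, of 1] by (simp add: normalised_sum_1)
  have distr: "distr P borel (\<xi> i) = distr P borel (\<xi> 0)" for i
  proof -
    have "distr P borel (\<xi> i) = distr (distr P K (W i)) borel (\<lambda>v. L2_inner M (Y v) h)" for i
      unfolding \<xi>_def using meas by (subst distr_distr) (auto simp: comp_def)
    then show ?thesis by (simp only: ident[of i])
  qed
  have sqi: "integrable P (\<lambda>u. (\<xi> i u)\<^sup>2)" for i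
  proof -
    have "integrable (distr P borel (\<xi> 0)) (\<lambda>x. x\<^sup>2)"
      using sqi0 by (subst integrable_distr_eq) (auto simp: power2_eq_square)
    then have "integrable (distr P borel (\<xi> i)) (\<lambda>x. x\<^sup>2)" by (simp only: distr[of i])
    then show ?thesis by (subst (asm) integrable_distr_eq) auto
  qed
  have sq: "(LINT u|P. (\<xi> i u)\<^sup>2) = q" for i
    using integral_summand_eq[of "\<lambda>v. (L2_inner M (Y v) h)\<^sup>2" i] meas sq0
    unfolding \<xi>_def by (simp add: power2_eq_square)
  have S: "L2_inner M (S n u) h = (\<Sum>i<n. \<xi> i u) / sqrt n" if "u \<in> space P" for n u
    unfolding \<xi>_def using L2_inner_normalised_sum[OF that h] .
  have q0: "q \<ge> 0" unfolding sq[of 0, symmetric] by simp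
  show ?thesis
  proof (cases "q = 0")
    \<comment> \<open>Zero variance is outside the scalar central limit theorem; here all summands
      vanish almost surely.\<close>
    case True
    have "AE u in P. \<xi> i u = 0" for i
      using sq[of i] sqi[of i] integral_nonneg_eq_0_iff_AE[of P "\<lambda>u. (\<xi> i u)\<^sup>2"] True by simp
    then have "AE u in P. \<forall>i. \<xi> i u = 0" by (simp add: AE_all_countable)
    then have ae: "AE u in P. iexp ((\<Sum>i<n. \<xi> i u) / sqrt n) = 1" for n
      by eventually_elim simp
    have "(CLINT u|P. iexp (L2_inner M (S n u) h)) = 1" for n
    proof -
      have "(CLINT u|P. iexp (L2_inner M (S n u) h)) = (CLINT u|P. iexp ((\<Sum>i<n. \<xi> i u) / sqrt n))"
        by (intro Bochner_Integration.integral_cong refl) (simp only: S)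
      also have "\<dots> = (CLINT u|P. 1)"
        by (rule integral_cong_AE[OF _ _ ae]) simp_all
      finally show ?thesis by (simp add: P.prob_space)
    qed
    then show ?thesis using True by simp
  next
    case False
    with q0 have qp: "q > 0" by simp
    let ?T = "\<lambda>n u. (\<Sum>i<n. \<xi> i u) / sqrt (n * (sqrt q)\<^sup>2)"
    have "weak_conv_m (\<lambda>n. distr P borel (?T n)) std_normal_distribution"
      using qp mean sq
      by (intro P.central_limit_theorem_zero_mean[OF ind mean _ sqi _ distr]) simp_all
    \<comment> \<open>Evaluating at the standard deviation undoes the standardisation.\<close>
    then have "(\<lambda>n. char (distr P borel (?T n)) (sqrt q)) \<longlonglongrightarrow> char std_normal_distribution (sqrt q)"
      by (intro levy_continuity1 P.real_distribution_distr real_dist_normal_dist) simp_all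
    moreover have "char (distr P borel (?T n)) (sqrt q) = (CLINT u|P. iexp (L2_inner M (S n u) h))" for n
    proof -
      have "char (distr P borel (?T n)) (sqrt q) = (CLINT u|P. iexp (sqrt q * ?T n u))"
        unfolding char_def by (subst integral_distr) auto
      also have "\<dots> = (CLINT u|P. iexp (L2_inner M (S n u) h))"
      proof (intro Bochner_Integration.integral_cong refl)
        fix u assume w: "u \<in> space P"
        have "sqrt q * ?T n u = (\<Sum>i<n. \<xi> i u) / sqrt n"
          using qp by (simp add: real_sqrt_mult)
        then show "iexp (sqrt q * ?T n u) = iexp (L2_inner M (S n u) h)"
          by (simp only: S[OF w])
      qed
      finally show ?thesis .
    qed
    moreover have "char std_normal_distribution (sqrt q) = of_real (exp (- q / 2))"
      using qp by (simp add: char_std_normal_distribution)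
    ultimately show ?thesis by simp
  qed
qed

text \<open>V enters the right-hand side through k alone, and for the kernel of the summands the
  value is the limit in \<open>conv_iexp_inner\<close>. Hence any V with this covariance yields the
  same limit.\<close>

lemma char_Gaussian_inner:
  assumes G: "gaussian_element N M V" and c: "centred_element N M V"
    and cov: "covariance_kernel N M V k" and h: "h \<in> L2_fun M"
  shows "(CLINT u|N. iexp (L2_inner M (V u) h))
    = of_real (exp (- (LINT x|M. LINT y|M. k x y * h x * h y) / 2))"
proof -
  have N: "prob_space N" and V: "V \<in> N \<rightarrow>\<^sub>M L2_borel M"
    and law: "normal_law (distr N borel (\<lambda>u. L2_inner M (V u) h))"
    using G h by (auto simp: gaussian_element_def)
  have m [measurable]: "(\<lambda>u. L2_inner M (V u) h) \<in> borel_measurable N"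
    using measurable_compose[OF V measurable_L2_inner[OF h]] .
  have mean: "(LINT x|distr N borel (\<lambda>u. L2_inner M (V u) h). x) = 0"
    using c h by (subst integral_distr) (auto simp: centred_element_def)
  have var: "(LINT x|distr N borel (\<lambda>u. L2_inner M (V u) h). x * x)
      = (LINT x|M. LINT y|M. k x y * h x * h y)"
    using cov h by (subst integral_distr) (auto simp: covariance_kernel_def)
  have "(CLINT u|N. iexp (L2_inner M (V u) h)) = char (distr N borel (\<lambda>u. L2_inner M (V u) h)) 1"
    unfolding char_def by (subst integral_distr) auto
  also have "\<dots> = of_real (exp (- (LINT x|M. LINT y|M. k x y * h x * h y) / 2))"
    using normal_law_char[OF law mean var, of 1] by simp
  finally show ?thesis .
qed

text \<open>Rescaled indicators bring l times the energy into the shape that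
  \<open>conv_Laplace_sum_squares\<close> handles, a sum of squares over 2. Null cells give 0 on
  both sides.\<close>

lemma energy_scaled:
  assumes "l \<ge> 0" and f: "f \<in> L2_fun M"
  shows "(\<Sum>y\<in>p m ` space M. (L2_inner M f
      (\<lambda>x. sqrt (2 * l / measure M (cell m y)) * indicator (cell m y) x))\<^sup>2) / 2 = l * energy m f"
proof -
  have "(L2_inner M f (\<lambda>x. sqrt (2 * l / measure M (cell m y)) * indicator (cell m y) x))\<^sup>2
      = 2 * l * ((L2_inner M f (indicator (cell m y)))\<^sup>2 / measure M (cell m y))" for y
    using assms(1) unfolding L2_inner_commute[of M f] L2_inner_cmult_left
    by (simp add: power_mult_distrib)
  then show ?thesis
    by (simp only: energy_def sum_distrib_left[symmetric])
qed

lemma measurable_energy: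
  assumes "\<And>h. h \<in> L2_fun M \<Longrightarrow> (\<lambda>u. L2_inner M (U u) h) \<in> borel_measurable Q"
  shows "(\<lambda>u. energy m (U u)) \<in> borel_measurable Q"
  unfolding energy_def using assms[OF indicator_L2_fun[OF cell_sets]]
  by (intro borel_measurable_sum borel_measurable_divide borel_measurable_power) auto

lemma energy_nonneg: "0 \<le> energy m f"
  unfolding energy_def by (intro sum_nonneg) simp

lemma integrable_energy_summand: "integrable P (\<lambda>u. energy m (S n u))"
  unfolding energy_def power2_eq_square
  using integrable_inner_mult_process[OF normalised_sum_process(1,2) normalised_sum_process(3-5)[where n=n]]
    L2_fun_integrable[OF indicator_L2_fun[OF cell_sets]]
  by (intro Bochner_Integration.integrable_sum integrable_divide_zero) auto

lemma integrable_square_norm_normalised_sum: "integrable P (\<lambda>u. LINT x|M. (S n u x)\<^sup>2)"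
  using integrable_norm_process[OF normalised_sum_process(1,2) normalised_sum_process(3-5)[where n=n]] .

text \<open>Squared norm and energy are both quadratic, so their expectations depend on the
  covariance alone, which is the same for all n \<ge> 1.\<close>

lemma energy_defect_eq:
  assumes n: "n \<ge> 1"
  shows "(LINT u|P. (LINT x|M. (S n u x)\<^sup>2) - energy m (S n u))
    = (LINT u|P. (LINT x|M. (S 1 u x)\<^sup>2) - energy m (S 1 u))"
proof -
  let ?k = "\<lambda>x y. LINT u|P. Y (W 0 u) x * Y (W 0 u) y"
  have "(LINT u|P. (LINT x|M. (S n u x)\<^sup>2) - energy m (S n u))
      = (LINT x|M. ?k x x) - (\<Sum>y\<in>p m ` space M. (LINT x|M. LINT x'|M.
          ?k x x' * indicator (cell m y) x * indicator (cell m y) x') / measure M (cell m y))"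
    if n: "n \<ge> 1" for n
  proof -
    have "(LINT u|P. LINT x|M. (S n u x)\<^sup>2) = (LINT x|M. LINT u|P. (S n u x)\<^sup>2)"
      using integral_norm_process[OF normalised_sum_process(1,2) normalised_sum_process(3-5)[where n=n]] .
    also have "\<dots> = (LINT x|M. ?k x x)"
      unfolding power2_eq_square
      by (rule Bochner_Integration.integral_cong[OF refl]) (rule covariance_normalised_sum[OF _ _ n])
    finally have 1: "(LINT u|P. LINT x|M. (S n u x)\<^sup>2) = (LINT x|M. ?k x x)" .
    have "(LINT u|P. energy m (S n u)) = (\<Sum>y\<in>p m ` space M. (LINT u|P.
        L2_inner M (S n u) (indicator (cell m y)) * L2_inner M (S n u) (indicator (cell m y)))
        / measure M (cell m y))"
      unfolding energy_def power2_eq_square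
      using integrable_inner_mult_process[OF normalised_sum_process(1,2) normalised_sum_process(3-5)[where n=n]]
        L2_fun_integrable[OF indicator_L2_fun[OF cell_sets]]
      by (subst Bochner_Integration.integral_sum) auto
    also have "\<dots> = (\<Sum>y\<in>p m ` space M. (LINT x|M. LINT x'|M.
          ?k x x' * indicator (cell m y) x * indicator (cell m y) x') / measure M (cell m y))"
      by (intro sum.cong refl arg_cong2[where f="(/)"] integral_inner_normalised_sum[OF _ _ n]
          indicator_L2_fun cell_sets)
    finally show ?thesis
      using 1 integrable_energy_summand integrable_square_norm_normalised_sum by simp
  qed
  from this[OF n] this[of 1] show ?thesis by simp
qed

text \<open>For n = 1 the defect tends to 0 along each path and stays between 0 and the integrable
  squared norm.\<close>

lemma energy_defect_tendsto:
  "(\<lambda>m. LINT u|P. (LINT x|M. (S 1 u x)\<^sup>2) - energy m (S 1 u)) \<longlonglongrightarrow> 0"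
proof -
  have "(\<lambda>m. LINT u|P. (LINT x|M. (S 1 u x)\<^sup>2) - energy m (S 1 u)) \<longlonglongrightarrow> (LINT u|P. 0)"
  proof (rule integral_dominated_convergence[where w="\<lambda>u. LINT x|M. (S 1 u x)\<^sup>2"])
    show "integrable P (\<lambda>u. LINT x|M. (S 1 u x)\<^sup>2)"
      by (rule integrable_square_norm_normalised_sum)
    show "(\<lambda>u. (LINT x|M. (S 1 u x)\<^sup>2) - energy m (S 1 u)) \<in> borel_measurable P" for m
      by (intro borel_measurable_diff borel_measurable_integrable
          integrable_square_norm_normalised_sum integrable_energy_summand)
    show "AE u in P. (\<lambda>m. (LINT x|M. (S 1 u x)\<^sup>2) - energy m (S 1 u)) \<longlonglongrightarrow> 0"
    proof (rule AE_I2)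
      fix u assume "u \<in> space P"
      then have "S 1 u \<in> L2_fun M" by (rule normalised_sum_L2_fun)
      from tendsto_diff[OF tendsto_const energy_tendsto[OF this], of "LINT x|M. (S 1 u x)\<^sup>2"]
      show "(\<lambda>m. (LINT x|M. (S 1 u x)\<^sup>2) - energy m (S 1 u)) \<longlonglongrightarrow> 0" by simp
    qed
    show "AE u in P. norm ((LINT x|M. (S 1 u x)\<^sup>2) - energy m (S 1 u)) \<le> (LINT x|M. (S 1 u x)\<^sup>2)" for m
    proof (rule AE_I2)
      fix u assume "u \<in> space P"
      then show "norm ((LINT x|M. (S 1 u x)\<^sup>2) - energy m (S 1 u)) \<le> (LINT x|M. (S 1 u x)\<^sup>2)"
        using energy_le[OF normalised_sum_L2_fun[of u 1], of m] energy_nonneg[of m "S 1 u"]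
        unfolding real_norm_def by linarith
    qed
  qed simp
  then show ?thesis by simp
qed

theorem weak_conv_square_norm_normalised_sum:
  assumes G: "gaussian_element N M V" and c: "centred_element N M V"
    and cov: "covariance_kernel N M V (\<lambda>x y. LINT u|P. Y (W 0 u) x * Y (W 0 u) y)"
  shows "weak_conv_m (\<lambda>n. distr P borel (\<lambda>u. (L2_norm M (S n u))\<^sup>2))
    (distr N borel (\<lambda>u. (L2_norm M (V u))\<^sup>2))"
proof -
  have N: "prob_space N" and V: "V \<in> N \<rightarrow>\<^sub>M L2_borel M"
    using G by (auto simp: gaussian_element_def)
  interpret N: prob_space N by (rule N)
  have VL: "V u \<in> L2_fun M" if "u \<in> space N" for u
    using measurable_space[OF V that] by simp
  have mVi: "(\<lambda>u. L2_inner M (V u) h) \<in> borel_measurable N" if "h \<in> L2_fun M" for h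
    using measurable_compose[OF V measurable_L2_inner[OF that]] .
  have mSi: "(\<lambda>u. L2_inner M (S n u) h) \<in> borel_measurable P" if "h \<in> L2_fun M" for h n
    using measurable_L2_inner_process[OF normalised_sum_process(1,2) normalised_sum_process(3-5)[where n=n] L2_funD(1)[OF that]] .
  have mVn: "(\<lambda>u. (L2_norm M (V u))\<^sup>2) \<in> borel_measurable N"
    using measurable_compose[OF V measurable_L2_norm] by (intro borel_measurable_power)
  have mSn: "(\<lambda>u. (L2_norm M (S n u))\<^sup>2) \<in> borel_measurable P" for n
    unfolding L2_norm_power2
    by (intro borel_measurable_integrable integrable_square_norm_normalised_sum)
  have mVe: "(\<lambda>u. energy m (V u)) \<in> borel_measurable N" for m
    using mVi by (rule measurable_energy)
  \<comment> \<open>x -> exp (- l x) is Lipschitz with constant l on the half line. As the energy is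
    at most the squared norm, the error is at most l times the energy defect.\<close>
  have lip: "\<bar>exp (- (l * a)) - exp (- (l * b))\<bar> \<le> l * (a - b)" if "l \<ge> 0" "b \<ge> 0" "a \<ge> b" for l a b :: real
  proof -
    define d where "d = l * (a - b)"
    have 1: "exp (- (l * a)) \<le> exp (- (l * b))"
      using that by (simp add: mult_left_mono)
    have "exp (- (l * b)) - exp (- (l * a)) = exp (- (l * b)) * (1 - exp (- d))"
      by (simp add: d_def right_diff_distrib flip: exp_add)
    also have "\<dots> \<le> 1 * (1 - exp (- d))"
      using that by (intro mult_right_mono) (auto simp: d_def)
    also have "\<dots> \<le> d"
      using exp_ge_add_one_self[of "- d"] by simp
    finally show ?thesis using 1 unfolding d_def[symmetric] by simp
  qed
  have conv: "(\<lambda>n. LINT u|P. exp (- (l * (L2_norm M (S n u))\<^sup>2)))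
      \<longlonglongrightarrow> (LINT u|N. exp (- (l * (L2_norm M (V u))\<^sup>2)))" if l: "l \<ge> 0" for l
  \<comment> \<open>For fixed m only finitely many inner products occur while n grows; then m grows,
    with an error free of n.\<close>
  proof (rule tendsto_uniform_approx[where
        a'="\<lambda>m n. LINT u|P. exp (- (l * energy m (S n u)))" and
        b'="\<lambda>m. LINT u|N. exp (- (l * energy m (V u)))" and
        \<delta>="\<lambda>m. l * (LINT u|P. (LINT x|M. (S 1 u x)\<^sup>2) - energy m (S 1 u))"])
    fix m n :: nat assume n: "n \<ge> 1"
    have i1: "integrable P (\<lambda>u. exp (- (l * (L2_norm M (S n u))\<^sup>2)))"
      using mSn l by (intro P.integrable_const_bound[where B=1]) auto
    have i2: "integrable P (\<lambda>u. exp (- (l * energy m (S n u))))"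
      using borel_measurable_integrable[OF integrable_energy_summand] l energy_nonneg
      by (intro P.integrable_const_bound[where B=1]) auto
    have i3: "integrable P (\<lambda>u. l * ((LINT x|M. (S n u x)\<^sup>2) - energy m (S n u)))"
      using integrable_energy_summand integrable_square_norm_normalised_sum by simp
    have "\<bar>(LINT u|P. exp (- (l * (L2_norm M (S n u))\<^sup>2))) - (LINT u|P. exp (- (l * energy m (S n u))))\<bar>
        = \<bar>LINT u|P. exp (- (l * (L2_norm M (S n u))\<^sup>2)) - exp (- (l * energy m (S n u)))\<bar>"
      using i1 i2 by simp
    also have "\<dots> \<le> (LINT u|P. l * ((LINT x|M. (S n u x)\<^sup>2) - energy m (S n u)))"
    proof (rule order_trans[OF integral_abs_bound integral_mono])
      fix u assume "u \<in> space P"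
      then show "\<bar>exp (- (l * (L2_norm M (S n u))\<^sup>2)) - exp (- (l * energy m (S n u)))\<bar>
          \<le> l * ((LINT x|M. (S n u x)\<^sup>2) - energy m (S n u))"
        unfolding L2_norm_power2
        by (intro lip l energy_nonneg energy_le normalised_sum_L2_fun)
    qed (use i1 i2 i3 in auto)
    also have "\<dots> = l * (LINT u|P. (LINT x|M. (S 1 u x)\<^sup>2) - energy m (S 1 u))"
      unfolding integral_mult_right_zero energy_defect_eq[OF n] ..
    finally show "\<bar>(LINT u|P. exp (- (l * (L2_norm M (S n u))\<^sup>2))) - (LINT u|P. exp (- (l * energy m (S n u))))\<bar>
      \<le> l * (LINT u|P. (LINT x|M. (S 1 u x)\<^sup>2) - energy m (S 1 u))" .
  next
    show "(\<lambda>m. l * (LINT u|P. (LINT x|M. (S 1 u x)\<^sup>2) - energy m (S 1 u))) \<longlonglongrightarrow> 0"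
      using tendsto_mult_left[OF energy_defect_tendsto, of l] by simp
  next
    fix m
    let ?h = "\<lambda>y x. sqrt (2 * l / measure M (cell m y)) * indicator (cell m y) x"
    have h: "?h y \<in> L2_fun M" for y
      by (intro L2_fun_cmult indicator_L2_fun cell_sets)
    have "(\<lambda>n. LINT u|P. exp (- (\<Sum>y\<in>p m ` space M. (L2_inner M (S n u) (?h y))\<^sup>2) / 2))
      \<longlonglongrightarrow> (LINT u|N. exp (- (\<Sum>y\<in>p m ` space M. (L2_inner M (V u) (?h y))\<^sup>2) / 2))"
    proof (rule conv_Laplace_sum_squares[OF P N, where H="L2_fun M" and k="?h"
          and A="\<lambda>n u. L2_inner M (S n u)" and B="\<lambda>u. L2_inner M (V u)"])
      show "(\<lambda>n. CLINT u|P. iexp (L2_inner M (S n u) g)) \<longlonglongrightarrow> (CLINT u|N. iexp (L2_inner M (V u) g))"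
        if "g \<in> L2_fun M" for g
        unfolding char_Gaussian_inner[OF G c cov that] by (rule conv_iexp_inner[OF that refl])
      fix g h :: "'x \<Rightarrow> real" and t assume gh: "g \<in> L2_fun M" "h \<in> L2_fun M"
      then show "(\<lambda>x. g x + t * h x) \<in> L2_fun M" by (intro L2_fun_add L2_fun_cmult)
      have lin: "L2_inner M f (\<lambda>x. g x + t * h x) = L2_inner M f g + t * L2_inner M f h"
        if "f \<in> L2_fun M" for f
        using gh that unfolding L2_inner_commute[of M f]
        by (simp add: L2_inner_add_left L2_fun_cmult L2_inner_cmult_left)
      show "L2_inner M (S n u) (\<lambda>x. g x + t * h x) = L2_inner M (S n u) g + t * L2_inner M (S n u) h"
        if "u \<in> space P" for n u using that by (intro lin normalised_sum_L2_fun)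
      show "L2_inner M (V u) (\<lambda>x. g x + t * h x) = L2_inner M (V u) g + t * L2_inner M (V u) h"
        if "u \<in> space N" for u using that by (intro lin VL)
    qed (use mSi mVi h finite_range_p in \<open>auto simp: L2_fun_def\<close>)
    also have "(\<lambda>n. LINT u|P. exp (- (\<Sum>y\<in>p m ` space M. (L2_inner M (S n u) (?h y))\<^sup>2) / 2))
        = (\<lambda>n. LINT u|P. exp (- (l * energy m (S n u))))"
      by (intro ext Bochner_Integration.integral_cong refl)
        (simp only: energy_scaled[OF l normalised_sum_L2_fun] minus_divide_left[symmetric])
    also have "(LINT u|N. exp (- (\<Sum>y\<in>p m ` space M. (L2_inner M (V u) (?h y))\<^sup>2) / 2))
        = (LINT u|N. exp (- (l * energy m (V u))))"
      by (intro Bochner_Integration.integral_cong refl)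
        (simp only: energy_scaled[OF l VL] minus_divide_left[symmetric])
    finally show "(\<lambda>n. LINT u|P. exp (- (l * energy m (S n u))))
      \<longlonglongrightarrow> (LINT u|N. exp (- (l * energy m (V u))))" .
  next
    show "(\<lambda>m. LINT u|N. exp (- (l * energy m (V u))))
      \<longlonglongrightarrow> (LINT u|N. exp (- (l * (L2_norm M (V u))\<^sup>2)))"
    proof (rule integral_dominated_convergence[where w="\<lambda>_. 1"])
      show "AE u in N. (\<lambda>m. exp (- (l * energy m (V u)))) \<longlonglongrightarrow> exp (- (l * (L2_norm M (V u))\<^sup>2))"
        unfolding L2_norm_power2 by (intro AE_I2 tendsto_intros energy_tendsto VL)
      show "AE u in N. norm (exp (- (l * energy m (V u)))) \<le> 1" for m
        using l energy_nonneg by (intro AE_I2) simp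
      show "(\<lambda>u. exp (- (l * (L2_norm M (V u))\<^sup>2))) \<in> borel_measurable N"
        using mVn by measurable
      show "(\<lambda>u. exp (- (l * energy m (V u)))) \<in> borel_measurable N" for m
        using mVe by measurable
    qed simp
  qed
  show ?thesis
  proof (rule weak_conv_if_Laplace_conv)
    show "real_distribution (distr P borel (\<lambda>u. (L2_norm M (S n u))\<^sup>2))" for n
      by (intro P.real_distribution_distr mSn)
    show "real_distribution (distr N borel (\<lambda>u. (L2_norm M (V u))\<^sup>2))"
      by (intro N.real_distribution_distr mVn)
    show "AE x in distr P borel (\<lambda>u. (L2_norm M (S n u))\<^sup>2). 0 \<le> x" for n
      using mSn by (subst AE_distr_iff) auto
    show "AE x in distr N borel (\<lambda>u. (L2_norm M (V u))\<^sup>2). 0 \<le> x"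
      using mVn by (subst AE_distr_iff) auto
    show "(\<lambda>n. LINT x|distr P borel (\<lambda>u. (L2_norm M (S n u))\<^sup>2). exp (- (real k * x)))
      \<longlonglongrightarrow> (LINT x|distr N borel (\<lambda>u. (L2_norm M (V u))\<^sup>2). exp (- (real k * x)))" for k
      using conv[of "real k"] mSn mVn by (simp add: integral_distr)
  qed
qed

end

end

section \<open>Factorisation of positive semidefinite kernels\<close>

text \<open>The points form a sequence and may repeat, so a further point can be appended without
  checking that it is new.\<close>

definition psd_kernel :: "('x \<Rightarrow> 'x \<Rightarrow> real) \<Rightarrow> bool" where
  "psd_kernel K \<longleftrightarrow> (\<forall>x y. K x y = K y x) \<and>
     (\<forall>n (c :: nat \<Rightarrow> real) x. 0 \<le> (\<Sum>i<n. \<Sum>j<n. c i * c j * K (x i) (x j)))"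

lemma psd_kernel_commute: "psd_kernel K \<Longrightarrow> K x y = K y x"
  by (simp add: psd_kernel_def)

lemma psd_kernel_two_points:
  assumes "psd_kernel K"
  shows "0 \<le> a\<^sup>2 * K x x + 2 * a * b * K x y + b\<^sup>2 * K y y"
proof -
  have "0 \<le> (\<Sum>i<2::nat. \<Sum>j<2::nat. (if i = 0 then a else b) * (if j = 0 then a else b)
      * K (if i = 0 then x else y) (if j = 0 then x else y))"
    using assms[unfolded psd_kernel_def, THEN conjunct2, rule_format, where n=2
        and c="\<lambda>i. if i = 0 then a else b" and x="\<lambda>i. if i = 0 then x else y"] .
  then show ?thesis
    using psd_kernel_commute[OF assms, of y x]
    by (simp add: numeral_2_eq_2 power2_eq_square algebra_simps)
qed

lemma psd_kernel_diag: "psd_kernel K \<Longrightarrow> 0 \<le> K x x"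
  using psd_kernel_two_points[of K 1 x 0 x] by simp

lemma psd_kernel_abs_le:
  assumes "psd_kernel K"
  shows "\<bar>K x y\<bar> \<le> (K x x + K y y) / 2"
  using psd_kernel_two_points[OF assms, of 1 x 1 y] psd_kernel_two_points[OF assms, of 1 x "-1" y]
  by (simp add: abs_le_iff)

text \<open>With \<open>K p p = 0\<close> the two-point form is affine in the coefficient b of p, so
  nonnegativity forces its slope to vanish.\<close>

lemma psd_kernel_null:
  assumes K: "psd_kernel K" and p: "K p p = 0"
  shows "K x p = 0"
proof (rule ccontr)
  assume nz: "K x p \<noteq> 0"
  \<comment> \<open>With a = 1 this coefficient makes the form equal to -1.\<close>
  define b where "b = - (K x x + 1) / (2 * K x p)"
  have "2 * b * K x p = - (K x x + 1)" using nz by (simp add: b_def)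
  then show False
    using psd_kernel_two_points[OF K, of 1 x b p] p by simp
qed

text \<open>Conditional covariance of a centred Gaussian process given its value at p. If
  \<open>K p p = 0\<close> it is K itself, since x / 0 = 0.\<close>

definition schur_complement :: "('x \<Rightarrow> 'x \<Rightarrow> real) \<Rightarrow> 'x \<Rightarrow> 'x \<Rightarrow> 'x \<Rightarrow> real" where
  "schur_complement K p x y = K x y - K x p * K p y / K p p"

text \<open>For a nonzero pivot, the form of the complement at c is the form of K at c with one
  extra coefficient at p, minimised over that coefficient.\<close>

lemma psd_kernel_schur_complement:
  assumes K: "psd_kernel K"
  shows "psd_kernel (schur_complement K p)"
  unfolding psd_kernel_def
proof (intro conjI allI)
  show "schur_complement K p x y = schur_complement K p y x" for x y
    unfolding schur_complement_def by (simp add: psd_kernel_commute[OF K, of x] psd_kernel_commute[OF K, of p y])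
  fix n and c :: "nat \<Rightarrow> real" and x :: "nat \<Rightarrow> 'a"
  define q where "q = (\<Sum>i<n. \<Sum>j<n. c i * c j * K (x i) (x j))"
  define l where "l = (\<Sum>i<n. c i * K (x i) p)"
  have l': "(\<Sum>i<n. c i * K p (x i)) = l"
    unfolding l_def by (simp add: psd_kernel_commute[OF K, of p])
  have "l * l = (\<Sum>i<n. \<Sum>j<n. (c i * K (x i) p) * (c j * K p (x j)))"
    by (subst l'[symmetric], subst (1) l_def) (simp add: sum_product)
  then have "l * l / K p p = (\<Sum>i<n. \<Sum>j<n. c i * c j * (K (x i) p * K p (x j) / K p p))"
    by (simp add: sum_divide_distrib ac_simps)
  then have eq: "(\<Sum>i<n. \<Sum>j<n. c i * c j * schur_complement K p (x i) (x j)) = q - l\<^sup>2 / K p p"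
    unfolding schur_complement_def q_def
    by (simp add: right_diff_distrib sum_subtractf power2_eq_square)
  show "0 \<le> (\<Sum>i<n. \<Sum>j<n. c i * c j * schur_complement K p (x i) (x j))"
  proof (cases "K p p = 0")
    case True
    have "0 \<le> q" using K unfolding psd_kernel_def q_def by blast
    then show ?thesis unfolding eq using True by simp
  next
    case False
    \<comment> \<open>The minimiser of q + 2 d l + d^2 \<open>K p p\<close>.\<close>
    define d where "d = - l / K p p"
    define c' where "c' = (\<lambda>i. if i = n then d else c i)"
    define x' where "x' = (\<lambda>i. if i = n then p else x i)"
    have "0 \<le> (\<Sum>i<Suc n. \<Sum>j<Suc n. c' i * c' j * K (x' i) (x' j))"
      using K unfolding psd_kernel_def by blast
    also have "\<dots> = (\<Sum>i<n. (\<Sum>j<n. c i * c j * K (x i) (x j)) + c i * d * K (x i) p)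
        + ((\<Sum>j<n. d * c j * K p (x j)) + d * d * K p p)"
      by (simp add: c'_def x'_def)
    also have "\<dots> = q + d * l + (d * l + d * d * K p p)"
    proof -
      have "(\<Sum>i<n. c i * d * K (x i) p) = d * l" by (simp add: l_def sum_distrib_left ac_simps)
      moreover have "(\<Sum>j<n. d * c j * K p (x j)) = d * l"
        by (simp add: l'[symmetric] sum_distrib_left ac_simps)
      ultimately show ?thesis by (simp add: sum.distrib q_def)
    qed
    also have "\<dots> = q - l\<^sup>2 / K p p"
      using False by (simp add: d_def field_simps power2_eq_square)
    finally show ?thesis unfolding eq .
  qed
qed

text \<open>Pivoted Cholesky factorisation. Vanishing pivots do no harm: then the numerators vanish too, and
  \<open>x / 0 = 0\<close>.\<close>

primrec residual :: "('x \<Rightarrow> 'x \<Rightarrow> real) \<Rightarrow> (nat \<Rightarrow> 'x) \<Rightarrow> nat \<Rightarrow> 'x \<Rightarrow> 'x \<Rightarrow> real" where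
  "residual K p 0 = K"
| "residual K p (Suc n) = schur_complement (residual K p n) (p n)"

definition feature :: "('x \<Rightarrow> 'x \<Rightarrow> real) \<Rightarrow> (nat \<Rightarrow> 'x) \<Rightarrow> nat \<Rightarrow> 'x \<Rightarrow> real" where
  "feature K p n x = residual K p n x (p n) / sqrt (residual K p n (p n) (p n))"

context
  fixes K :: "'x \<Rightarrow> 'x \<Rightarrow> real" and p :: "nat \<Rightarrow> 'x"
  assumes K: "psd_kernel K"
begin

lemma psd_residual: "psd_kernel (residual K p n)"
  by (induction n) (simp_all add: K psd_kernel_schur_complement)

lemma residual_Suc: "residual K p (Suc n) x y = residual K p n x y - feature K p n x * feature K p n y"
proof -
  have "0 \<le> residual K p n (p n) (p n)" by (rule psd_kernel_diag[OF psd_residual])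
  then show ?thesis
    using psd_kernel_commute[OF psd_residual, of n "p n" y]
    by (simp add: schur_complement_def feature_def)
qed

lemma residual_eq: "residual K p n x y = K x y - (\<Sum>k<n. feature K p k x * feature K p k y)"
  by (induction n) (simp_all add: residual_Suc del: residual.simps(2))

lemma residual_diag_Suc_le: "residual K p (Suc n) x x \<le> residual K p n x x"
  unfolding residual_Suc by simp

lemma residual_diag_antimono: "m \<le> n \<Longrightarrow> residual K p n x x \<le> residual K p m x x"
  using decseq_SucI[of "\<lambda>n. residual K p n x x", OF residual_diag_Suc_le]
  by (simp only: monotone_def)

lemma residual_diag_nonneg: "0 \<le> residual K p n x x"
  by (rule psd_kernel_diag[OF psd_residual])

lemma residual_diag_le: "residual K p n x x \<le> K x x"
  using residual_diag_antimono[of 0 n x] by simp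

text \<open>Elimination at \<open>p k\<close> clears the entries at \<open>p k\<close>. A later step
  changes them only by multiples of another entry at \<open>p k\<close>, which is already 0; hence
  the induction is over all x together.\<close>

lemma residual_pivot: "k < n \<Longrightarrow> residual K p n x (p k) = 0"
proof (induction n arbitrary: x)
  case (Suc n)
  show ?case
  proof (cases "k = n")
    case True
    \<comment> \<open>A null pivot leaves the residual unchanged, but then its column is already
      0.\<close>
    then show ?thesis
      using psd_kernel_null[OF psd_residual, of n "p n" x]
      by (cases "residual K p n (p n) (p n) = 0") (simp_all add: schur_complement_def)
  next
    case False
    then have "k < n" using Suc.prems by simp
    then show ?thesis by (simp add: schur_complement_def Suc.IH)
  qed
qed simp

text \<open>The right-hand side is E (V x - V (p k))^2, the squared canonical distance of a process
  with covariance K. The residual vanishes at \<open>p k\<close>, and its own squared distance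
  arises from that of K by subtracting squares of feature differences.\<close>

lemma residual_le_dist:
  assumes "k < n"
  shows "residual K p n x x \<le> K x x - 2 * K x (p k) + K (p k) (p k)"
proof -
  have "residual K p n x x = residual K p n x x - 2 * residual K p n x (p k) + residual K p n (p k) (p k)"
    using residual_pivot[OF assms] by simp
  also have "\<dots> = K x x - 2 * K x (p k) + K (p k) (p k)
      - (\<Sum>j<n. (feature K p j x - feature K p j (p k))\<^sup>2)"
    by (simp add: residual_eq power2_eq_square algebra_simps sum.distrib sum_subtractf sum_distrib_left)
  also have "\<dots> \<le> K x x - 2 * K x (p k) + K (p k) (p k)"
    by (simp add: sum_nonneg)
  finally show ?thesis .
qed

text \<open>Density is asked for in the canonical distance, the only notion of closeness that the
  bound \<open>residual_le_dist\<close> sees.\<close>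

lemma residual_diag_tendsto:
  assumes dense: "\<And>e. e > 0 \<Longrightarrow> \<exists>k. K x x - 2 * K x (p k) + K (p k) (p k) < e"
  shows "(\<lambda>n. residual K p n x x) \<longlonglongrightarrow> 0"
proof (rule LIMSEQ_I)
  fix e :: real assume "e > 0"
  then obtain k where k: "K x x - 2 * K x (p k) + K (p k) (p k) < e" using dense by blast
  show "\<exists>n0. \<forall>n\<ge>n0. norm (residual K p n x x - 0) < e"
  proof (intro exI allI impI)
    fix n assume "n \<ge> Suc k"
    then show "norm (residual K p n x x - 0) < e"
      using residual_le_dist[of k n x] residual_diag_nonneg[of n x] k by simp
  qed
qed

lemma residual_tendsto:
  assumes "(\<lambda>n. residual K p n x x) \<longlonglongrightarrow> 0" "(\<lambda>n. residual K p n y y) \<longlonglongrightarrow> 0"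
  shows "(\<lambda>n. residual K p n x y) \<longlonglongrightarrow> 0"
proof (rule Lim_null_comparison)
  show "(\<lambda>n. (residual K p n x x + residual K p n y y) / 2) \<longlonglongrightarrow> 0"
    using tendsto_divide[OF tendsto_add[OF assms] tendsto_const[of 2]] by simp
  show "\<forall>\<^sub>F n in sequentially. norm (residual K p n x y) \<le> (residual K p n x x + residual K p n y y) / 2"
    unfolding real_norm_def by (intro always_eventually allI psd_kernel_abs_le psd_residual)
qed

lemma feature_measurable:
  assumes "\<And>y. (\<lambda>x. K x y) \<in> borel_measurable M"
  shows "(\<lambda>x. residual K p n x y) \<in> borel_measurable M" "feature K p n \<in> borel_measurable M"
proof -
  show *: "(\<lambda>x. residual K p n x y) \<in> borel_measurable M" for y
    by (induction n arbitrary: y) (simp_all add: assms schur_complement_def)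
  show "feature K p n \<in> borel_measurable M"
    unfolding feature_def[abs_def] using * by simp
qed

end

text \<open>Mean square increments of order 4^-i have absolute means of order 2^-i. These are
  summable, which gives almost sure convergence; Fatou then carries the mean square bound over to
  the limit.\<close>

lemma (in prob_space) fast_L2_limit:
  fixes A :: "nat \<Rightarrow> 'a \<Rightarrow> real"
  assumes [measurable]: "\<And>i. A i \<in> borel_measurable M"
    and int: "\<And>i j. i \<le> j \<Longrightarrow> integrable M (\<lambda>u. (A j u - A i u)\<^sup>2)"
    and le: "\<And>i j. i \<le> j \<Longrightarrow> (LINT u|M. (A j u - A i u)\<^sup>2) \<le> (1 / 4) ^ i"
  shows "integrable M (\<lambda>u. (lim (\<lambda>j. A j u) - A i u)\<^sup>2)" (is ?int)
    and "(LINT u|M. (lim (\<lambda>j. A j u) - A i u)\<^sup>2) \<le> (1 / 4) ^ i" (is ?le)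
proof -
  have step: "(\<integral>\<^sup>+ u. ennreal \<bar>A (Suc i) u - A i u\<bar> \<partial>M) \<le> ennreal ((1 / 2) ^ i)" for i
  proof -
    \<comment> \<open>Arithmetic-geometric mean with weight 2^i, chosen so that 2^i 4^-i and 2^-i
      balance.\<close>
    have b: "\<bar>a\<bar> \<le> (2 ^ i * a\<^sup>2 + (1 / 2) ^ i) / 2" for a :: real
    proof -
      have "0 \<le> (1 / 2) ^ i * (2 ^ i * \<bar>a\<bar> - 1)\<^sup>2" by simp
      also have "\<dots> = (1 / 2) ^ i * (2 ^ i * 2 ^ i) * a\<^sup>2 - 2 * ((1 / 2) ^ i * 2 ^ i) * \<bar>a\<bar> + (1 / 2) ^ i"
        by (simp add: power2_diff power_mult_distrib algebra_simps flip: power2_eq_square)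
      also have "(1 / 2 :: real) ^ i * (2 ^ i * 2 ^ i) = 2 ^ i"
        by (simp add: power_one_over)
      also have "(1 / 2 :: real) ^ i * 2 ^ i = 1" by (simp add: power_one_over)
      finally show ?thesis by simp
    qed
    have i: "integrable M (\<lambda>u. (2 ^ i * (A (Suc i) u - A i u)\<^sup>2 + (1 / 2) ^ i) / 2)"
      using int[of i "Suc i"] by simp
    have "(\<integral>\<^sup>+ u. ennreal \<bar>A (Suc i) u - A i u\<bar> \<partial>M)
        \<le> (\<integral>\<^sup>+ u. ennreal ((2 ^ i * (A (Suc i) u - A i u)\<^sup>2 + (1 / 2) ^ i) / 2) \<partial>M)"
      by (intro nn_integral_mono ennreal_leI b)
    also have "\<dots> = ennreal (LINT u|M. (2 ^ i * (A (Suc i) u - A i u)\<^sup>2 + (1 / 2) ^ i) / 2)"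
      by (rule nn_integral_eq_integral[OF i]) simp
    also have "(LINT u|M. (2 ^ i * (A (Suc i) u - A i u)\<^sup>2 + (1 / 2) ^ i) / 2)
        = (2 ^ i * (LINT u|M. (A (Suc i) u - A i u)\<^sup>2) + (1 / 2) ^ i) / 2"
      using int[of i "Suc i"] by (simp add: prob_space)
    also have "\<dots> \<le> (2 ^ i * (1 / 4) ^ i + (1 / 2) ^ i) / 2"
      using le[of i "Suc i"] by (simp add: divide_right_mono)
    also have "2 ^ i * (1 / 4 :: real) ^ i = (1 / 2) ^ i"
      by (simp flip: power_mult_distrib)
    finally show ?thesis by (simp add: ennreal_leI)
  qed
  have "(\<integral>\<^sup>+ u. (\<Sum>i. ennreal \<bar>A (Suc i) u - A i u\<bar>) \<partial>M) = (\<Sum>i. \<integral>\<^sup>+ u. ennreal \<bar>A (Suc i) u - A i u\<bar> \<partial>M)"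
    by (rule nn_integral_suminf) simp
  also have "\<dots> \<le> (\<Sum>i. ennreal ((1 / 2) ^ i))"
    by (intro suminf_le step summableI)
  also have "\<dots> < \<infinity>"
    by (subst suminf_ennreal_eq[OF _ power_half_series[THEN sums_Suc_iff[THEN iffD1]]]) simp_all
  finally have "(\<integral>\<^sup>+ u. (\<Sum>i. ennreal \<bar>A (Suc i) u - A i u\<bar>) \<partial>M) \<noteq> \<infinity>" by simp
  then have "AE u in M. (\<Sum>i. ennreal \<bar>A (Suc i) u - A i u\<bar>) \<noteq> \<infinity>"
    by (intro nn_integral_PInf_AE) simp_all
  then have conv: "AE u in M. (\<lambda>j. A j u) \<longlonglongrightarrow> lim (\<lambda>j. A j u)"
  proof eventually_elim
    case (elim u)
    then have "summable (\<lambda>i. \<bar>A (Suc i) u - A i u\<bar>)"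
      by (intro summable_suminf_not_top) (simp_all add: infinity_ennreal_def)
    then have "summable (\<lambda>i. A (Suc i) u - A i u)" by (rule summable_rabs_cancel)
    then have "convergent (\<lambda>n. \<Sum>i<n. A (Suc i) u - A i u)" by (simp add: summable_iff_convergent)
    then have "convergent (\<lambda>n. A n u - A 0 u)" by (simp only: sum_lessThan_telescope[of "\<lambda>i. A i u"])
    then have "convergent (\<lambda>n. A n u)" by (simp only: convergent_diff_const_right_iff)
    then show ?case by (simp add: convergent_LIMSEQ_iff)
  qed
  let ?L = "\<lambda>u. lim (\<lambda>j. A j u)"
  have "(\<integral>\<^sup>+ u. ennreal ((?L u - A i u)\<^sup>2) \<partial>M) = (\<integral>\<^sup>+ u. liminf (\<lambda>j. ennreal ((A j u - A i u)\<^sup>2)) \<partial>M)"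
  proof (rule nn_integral_cong_AE)
    show "AE u in M. ennreal ((?L u - A i u)\<^sup>2) = liminf (\<lambda>j. ennreal ((A j u - A i u)\<^sup>2))"
      using conv
    proof eventually_elim
      case (elim u)
      then have "(\<lambda>j. ennreal ((A j u - A i u)\<^sup>2)) \<longlonglongrightarrow> ennreal ((?L u - A i u)\<^sup>2)"
        by (intro tendsto_intros tendsto_ennrealI)
      then show ?case by (intro lim_imp_Liminf[symmetric]) simp_all
    qed
  qed
  also have "\<dots> \<le> liminf (\<lambda>j. \<integral>\<^sup>+ u. ennreal ((A j u - A i u)\<^sup>2) \<partial>M)"
    by (rule nn_integral_liminf) simp
  also have "\<dots> \<le> ennreal ((1 / 4) ^ i)"
  proof (rule Liminf_le)
    show "\<forall>\<^sub>F j in sequentially. (\<integral>\<^sup>+ u. ennreal ((A j u - A i u)\<^sup>2) \<partial>M) \<le> ennreal ((1 / 4) ^ i)"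
      using eventually_ge_at_top[of i]
    proof eventually_elim
      case (elim j)
      then show ?case
        using nn_integral_eq_integral[OF int[OF elim]] le[OF elim] by (simp add: ennreal_leI)
    qed
  qed simp
  finally have *: "(\<integral>\<^sup>+ u. ennreal ((?L u - A i u)\<^sup>2) \<partial>M) \<le> ennreal ((1 / 4) ^ i)" .
  show ?int
    using * by (intro integrableI_bounded) (auto simp: le_less_trans[OF _ ennreal_less_top])
  have "ennreal (LINT u|M. (?L u - A i u)\<^sup>2) \<le> ennreal ((1 / 4) ^ i)"
    using * nn_integral_eq_integral[OF \<open>?int\<close>] by simp
  then show ?le by simp
qed

section \<open>Independent standard normal variables\<close>

lemma L2_inner_diff_right:
  assumes "f \<in> L2_fun M" "g \<in> L2_fun M" "h \<in> L2_fun M"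
  shows "L2_inner M h (\<lambda>x. f x - g x) = L2_inner M h f - L2_inner M h g"
  using L2_inner_diff_left[OF assms] by (simp add: L2_inner_commute[of M h])

lemma L2_inner_tendsto:
  assumes f: "f \<in> L2_fun M" "\<And>n. F n \<in> L2_fun M" "(\<lambda>n. L2_norm M (\<lambda>x. F n x - f x)) \<longlonglongrightarrow> 0"
    and g: "g \<in> L2_fun M" "\<And>n. G n \<in> L2_fun M" "(\<lambda>n. L2_norm M (\<lambda>x. G n x - g x)) \<longlonglongrightarrow> 0"
  shows "(\<lambda>n. L2_inner M (F n) (G n)) \<longlonglongrightarrow> L2_inner M f g"
proof (rule LIM_zero_cancel, rule Lim_null_comparison)
  let ?a = "\<lambda>n. L2_norm M (\<lambda>x. F n x - f x)" and ?b = "\<lambda>n. L2_norm M (\<lambda>x. G n x - g x)"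
  have "(\<lambda>n. ?a n * ?b n + ?a n * L2_norm M g + L2_norm M f * ?b n)
    \<longlonglongrightarrow> 0 * 0 + 0 * L2_norm M g + L2_norm M f * 0"
    by (intro tendsto_intros f g)
  then show "(\<lambda>n. ?a n * ?b n + ?a n * L2_norm M g + L2_norm M f * ?b n) \<longlonglongrightarrow> 0" by simp
  have "\<bar>L2_inner M (F n) (G n) - L2_inner M f g\<bar>
      \<le> ?a n * ?b n + ?a n * L2_norm M g + L2_norm M f * ?b n" for n
  proof -
    note d = L2_fun_diff[OF f(2)[of n] f(1)] L2_fun_diff[OF g(2)[of n] g(1)]
    have "L2_inner M (F n) (G n) - L2_inner M f g
      = L2_inner M (\<lambda>x. F n x - f x) (\<lambda>x. G n x - g x) + L2_inner M (\<lambda>x. F n x - f x) g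
        + L2_inner M f (\<lambda>x. G n x - g x)"
      using f g d by (simp add: L2_inner_diff_left L2_inner_diff_right)
    then show ?thesis
      using L2_Cauchy_Schwarz[OF d] L2_Cauchy_Schwarz[OF d(1) g(1)] L2_Cauchy_Schwarz[OF f(1) d(2)]
      by linarith
  qed
  then show "\<forall>\<^sub>F n in sequentially. norm (L2_inner M (F n) (G n) - L2_inner M f g)
      \<le> ?a n * ?b n + ?a n * L2_norm M g + L2_norm M f * ?b n" by simp
qed

lemma (in prob_space) abs_expectation_le_L2_norm:
  assumes f: "f \<in> L2_fun M"
  shows "(LINT u|M. \<bar>f u\<bar>) \<le> L2_norm M f"
proof -
  have "(\<lambda>u. \<bar>f u\<bar>) \<in> L2_fun M"
    using L2_funD[OF f] by (intro L2_funI borel_measurable_abs) simp_all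
  moreover have "(\<lambda>_. 1) \<in> L2_fun M" by (simp add: L2_fun_def)
  ultimately have "\<bar>L2_inner M (\<lambda>u. \<bar>f u\<bar>) (\<lambda>_. 1)\<bar> \<le> L2_norm M (\<lambda>u. \<bar>f u\<bar>) * L2_norm M (\<lambda>_. 1)"
    by (rule L2_Cauchy_Schwarz)
  then show ?thesis by (simp add: L2_inner_def L2_norm_def prob_space)
qed

lemma norm_iexp_diff_le: "cmod (iexp x - iexp y) \<le> \<bar>x - y\<bar>"
proof -
  have "iexp x - iexp y = iexp y * (iexp (x - y) - 1)"
    by (simp add: right_diff_distrib flip: exp_add)
  then have "cmod (iexp x - iexp y) = cmod (iexp (x - y) - 1)" by (simp add: norm_mult)
  then show ?thesis using iexp_approx1[of "x - y" 0] by simp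
qed

text \<open>x -> exp (i x) is Lipschitz with constant 1, and under a probability measure the L^1
  norm is at most the L^2 norm.\<close>

lemma (in prob_space) char_tendsto_if_L2_tendsto:
  assumes f: "f \<in> L2_fun M" "\<And>n. F n \<in> L2_fun M" "(\<lambda>n. L2_norm M (\<lambda>x. F n x - f x)) \<longlonglongrightarrow> 0"
  shows "(\<lambda>n. CLINT u|M. iexp (t * F n u)) \<longlonglongrightarrow> (CLINT u|M. iexp (t * f u))"
proof (rule LIM_zero_cancel, rule Lim_null_comparison)
  show "(\<lambda>n. \<bar>t\<bar> * L2_norm M (\<lambda>x. F n x - f x)) \<longlonglongrightarrow> 0"
    using tendsto_mult_left[OF f(3), of "\<bar>t\<bar>"] by simp
  have "cmod ((CLINT u|M. iexp (t * F n u)) - (CLINT u|M. iexp (t * f u)))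
      \<le> \<bar>t\<bar> * L2_norm M (\<lambda>x. F n x - f x)" for n
  proof -
    note [measurable] = L2_funD(1)[OF f(1)] L2_funD(1)[OF f(2)]
    have d: "(\<lambda>u. F n u - f u) \<in> L2_fun M" using f by (intro L2_fun_diff)
    have i: "integrable M (\<lambda>u. iexp (t * F n u))" "integrable M (\<lambda>u. iexp (t * f u))"
      by (intro integrable_const_bound[where B=1]; simp)+
    have "(CLINT u|M. iexp (t * F n u)) - (CLINT u|M. iexp (t * f u))
        = (CLINT u|M. iexp (t * F n u) - iexp (t * f u))"
      using i by simp
    also have "cmod \<dots> \<le> (LINT u|M. cmod (iexp (t * F n u) - iexp (t * f u)))"
      by (rule integral_norm_bound)
    also have "\<dots> \<le> (LINT u|M. \<bar>t\<bar> * \<bar>F n u - f u\<bar>)"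
    proof (rule integral_mono)
      show "integrable M (\<lambda>u. cmod (iexp (t * F n u) - iexp (t * f u)))"
        using i by (intro integrable_norm Bochner_Integration.integrable_diff)
      show "integrable M (\<lambda>u. \<bar>t\<bar> * \<bar>F n u - f u\<bar>)"
        using L2_fun_integrable[OF d] by simp
      show "cmod (iexp (t * F n u) - iexp (t * f u)) \<le> \<bar>t\<bar> * \<bar>F n u - f u\<bar>" for u
        using norm_iexp_diff_le[of "t * F n u" "t * f u"]
        by (simp only: right_diff_distrib[symmetric] abs_mult)
    qed
    also have "\<dots> \<le> \<bar>t\<bar> * L2_norm M (\<lambda>x. F n x - f x)"
      using abs_expectation_le_L2_norm[OF d] by (simp add: mult_left_mono)
    finally show ?thesis .
  qed
  then show "\<forall>\<^sub>F n in sequentially. cmod ((CLINT u|M. iexp (t * F n u)) - (CLINT u|M. iexp (t * f u)))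
      \<le> \<bar>t\<bar> * L2_norm M (\<lambda>x. F n x - f x)" by simp
qed

text \<open>Levy uniqueness against sqrt q times a standard normal variable, which covers q = 0 as a
  point mass.\<close>

lemma (in prob_space) normal_law_if_char:
  assumes f [measurable]: "f \<in> borel_measurable M" and q: "q \<ge> 0"
    and char: "\<And>t. (CLINT u|M. iexp (t * f u)) = of_real (exp (- q * t\<^sup>2 / 2))"
  shows "normal_law (distr M borel f)" and "(LINT u|M. f u) = 0"
proof -
  let ?G = std_normal_distribution
  interpret G: prob_space ?G by (rule prob_space_normal_density) simp
  have eq: "distr M borel f = distr ?G borel (\<lambda>x. 0 + sqrt q * x)"
  proof (rule Levy_uniqueness)
    show "char (distr M borel f) = char (distr ?G borel (\<lambda>x. 0 + sqrt q * x))"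
    proof
      fix t
      have "char (distr M borel f) t = (CLINT u|M. iexp (t * f u))"
        unfolding char_def by (subst integral_distr) auto
      then show "char (distr M borel f) t = char (distr ?G borel (\<lambda>x. 0 + sqrt q * x)) t"
        unfolding char char_affine_std_normal using q by (simp add: power_mult_distrib)
    qed
  qed (intro real_distribution_distr G.real_distribution_distr; simp)+
  show "normal_law (distr M borel f)"
    unfolding normal_law_iff eq using q by (intro exI[of _ 0] exI[of _ "sqrt q"]) simp
  have "(LINT u|M. f u) = (LINT x|distr M borel f. x)"
    by (subst integral_distr) auto
  also have "\<dots> = (LINT x|?G. sqrt q * x)"
    unfolding eq by (subst integral_distr) auto
  also have "\<dots> = 0"
    using integral_std_normal_distribution_moment_odd[of 1] by simp
  finally show "(LINT u|M. f u) = 0" .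
qed

text \<open>The coefficient sequences of the Gaussian series; this is the probability space of the
  existence claim.\<close>

definition normals :: "(nat \<Rightarrow> real) measure" where
  "normals = Pi\<^sub>M UNIV (\<lambda>_. std_normal_distribution)"

lemma prob_space_std_normal: "prob_space std_normal_distribution"
  by (rule prob_space_normal_density) simp

interpretation normals: prob_space normals
  unfolding normals_def by (intro prob_space_PiM prob_space_std_normal)

lemma sets_normals [measurable_cong]: "sets normals = sets (Pi\<^sub>M UNIV (\<lambda>_. borel))"
  unfolding normals_def by (rule sets_PiM_cong) auto

lemma space_normals [simp]: "space normals = UNIV"
  by (simp add: normals_def space_PiM)

lemma measurable_normals [measurable]: "(\<lambda>u. u k) \<in> borel_measurable normals"
  by measurable

lemma distr_normals: "distr normals borel (\<lambda>u. u k) = std_normal_distribution"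
proof -
  have "distr normals std_normal_distribution (\<lambda>u. u k) = std_normal_distribution"
    unfolding normals_def by (intro distr_PiM_component prob_space_std_normal) simp
  moreover have "distr normals std_normal_distribution (\<lambda>u. u k) = distr normals borel (\<lambda>u. u k)"
    by (rule distr_cong) simp_all
  ultimately show ?thesis by simp
qed

lemma indep_vars_normals: "normals.indep_vars (\<lambda>_. borel) (\<lambda>k u. u k) UNIV"
proof (subst normals.indep_vars_iff_distr_eq_PiM)
  have "distr normals (Pi\<^sub>M UNIV (\<lambda>_. borel)) (\<lambda>x. x) = normals"
    by (rule distr_id2) (simp add: sets_normals)
  then show "distr normals (Pi\<^sub>M UNIV (\<lambda>_. borel)) (\<lambda>x. \<lambda>i\<in>UNIV. x i)
      = Pi\<^sub>M UNIV (\<lambda>i. distr normals borel (\<lambda>u. u i))"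
    unfolding distr_normals by (simp add: normals_def restrict_UNIV)
qed simp_all

lemma
  shows integrable_normals_mult: "integrable normals (\<lambda>u. u i * u j)" (is ?t3)
    and expectation_normals_mult: "(LINT u|normals. u i * u j) = (if i = j then 1 else 0)" (is ?t4)
proof -
  have i1: "integrable normals (\<lambda>u. u k ^ n)" for k n
    using integrable_std_normal_distribution_moment[of n]
    by (subst (asm) distr_normals[of k, symmetric], subst (asm) integrable_distr_eq) auto
  have e: "(LINT u|normals. u k ^ n) = (LINT x|std_normal_distribution. x ^ n)" for k n
    by (subst distr_normals[of k, symmetric], subst integral_distr) auto
  have int: "integrable normals (\<lambda>u. u k)" for k using i1[of k 1] by simp
  have mean: "(LINT u|normals. u k) = 0" for k
    using e[of k 1] integral_std_normal_distribution_moment_odd[of 1] by simp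
  have ind: "normals.indep_vars (\<lambda>_. borel) (\<lambda>k u. u k) {i, j}"
    using indep_vars_normals by (rule normals.indep_vars_subset) simp
  show ?t3
  proof (cases "i = j")
    case True
    then show ?thesis using i1[of i 2] by (simp add: power2_eq_square)
  next
    case False
    then show ?thesis
      using normals.indep_vars_integrable[OF _ ind] int by simp
  qed
  show ?t4
  proof (cases "i = j")
    case True
    then show ?thesis
      using e[of i 2] std_normal_distribution_even_moments(1)[of 1]
      by (simp add: power2_eq_square fact_numeral)
  next
    case False
    then show ?thesis
      using normals.indep_vars_lebesgue_integral[OF _ ind] int mean by simp
  qed
qed

lemma
  assumes "finite I"
  shows integrable_square_normals: "integrable normals (\<lambda>u. (\<Sum>k\<in>I. c k * u k)\<^sup>2)"
    and expectation_square_normals: "(LINT u|normals. (\<Sum>k\<in>I. c k * u k)\<^sup>2) = (\<Sum>k\<in>I. (c k)\<^sup>2)"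
proof -
  have eq: "(\<Sum>k\<in>I. c k * u k)\<^sup>2 = (\<Sum>i\<in>I. \<Sum>j\<in>I. (c i * c j) * (u i * u j))" for u :: "nat \<Rightarrow> real"
    by (simp add: power2_eq_square sum_product ac_simps)
  show "integrable normals (\<lambda>u. (\<Sum>k\<in>I. c k * u k)\<^sup>2)"
    unfolding eq by (intro Bochner_Integration.integrable_sum integrable_mult_right integrable_normals_mult)
  have "(LINT u|normals. (\<Sum>k\<in>I. c k * u k)\<^sup>2)
      = (\<Sum>i\<in>I. \<Sum>j\<in>I. (c i * c j) * (LINT u|normals. u i * u j))"
    unfolding eq
    by (simp only: Bochner_Integration.integral_sum Bochner_Integration.integrable_sum
        integrable_mult_right integrable_normals_mult integral_mult_right_zero)
  also have "\<dots> = (\<Sum>k\<in>I. (c k)\<^sup>2)"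
  proof (intro sum.cong refl)
    fix i assume "i \<in> I"
    have "(\<Sum>j\<in>I. (c i * c j) * (LINT u|normals. u i * u j)) = (\<Sum>j\<in>I. if i = j then c i * c j else 0)"
      by (intro sum.cong refl) (simp add: expectation_normals_mult)
    also have "\<dots> = (c i)\<^sup>2"
      using assms \<open>i \<in> I\<close> by (simp add: power2_eq_square)
    finally show "(\<Sum>j\<in>I. (c i * c j) * (LINT u|normals. u i * u j)) = (c i)\<^sup>2" .
  qed
  finally show "(LINT u|normals. (\<Sum>k\<in>I. c k * u k)\<^sup>2) = (\<Sum>k\<in>I. (c k)\<^sup>2)" .
qed

lemma char_normals:
  assumes "finite I"
  shows "(CLINT u|normals. iexp (t * (\<Sum>k\<in>I. c k * u k)))
    = of_real (exp (- (\<Sum>k\<in>I. (c k)\<^sup>2) * t\<^sup>2 / 2))"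
proof -
  have "normals.indep_vars (\<lambda>_. borel) (\<lambda>k u. c k * u k) UNIV"
    using indep_vars_normals by (rule normals.indep_vars_compose2) simp
  then have ind: "normals.indep_vars (\<lambda>_. borel) (\<lambda>k u. c k * u k) I"
    by (rule normals.indep_vars_subset) simp
  have "(CLINT u|normals. iexp (t * (\<Sum>k\<in>I. c k * u k)))
      = char (distr normals borel (\<lambda>u. \<Sum>k\<in>I. c k * u k)) t"
    unfolding char_def by (subst integral_distr) auto
  also have "\<dots> = (\<Prod>k\<in>I. char (distr normals borel (\<lambda>u. c k * u k)) t)"
    by (rule normals.char_distr_sum[OF ind])
  also have "\<dots> = (\<Prod>k\<in>I. of_real (exp (- (c k)\<^sup>2 * t\<^sup>2 / 2)))"
  proof (intro prod.cong refl)
    fix k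
    have "char (distr normals borel (\<lambda>u. c k * u k)) t = (CLINT u|normals. iexp (t * c k * u k))"
      unfolding char_def by (subst integral_distr) (auto simp: ac_simps)
    also have "\<dots> = char (distr normals borel (\<lambda>u. u k)) (t * c k)"
      unfolding char_def by (subst integral_distr) auto
    also have "\<dots> = of_real (exp (- (c k)\<^sup>2 * t\<^sup>2 / 2))"
      unfolding distr_normals by (simp add: char_std_normal_distribution power_mult_distrib ac_simps)
    finally show "char (distr normals borel (\<lambda>u. c k * u k)) t = of_real (exp (- (c k)\<^sup>2 * t\<^sup>2 / 2))" .
  qed
  also have "\<dots> = of_real (\<Prod>k\<in>I. exp (- (c k)\<^sup>2 * t\<^sup>2 / 2))" by simp
  also have "(\<Prod>k\<in>I. exp (- (c k)\<^sup>2 * t\<^sup>2 / 2)) = exp (- (\<Sum>k\<in>I. (c k)\<^sup>2) * t\<^sup>2 / 2)"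
    using assms by (simp add: exp_sum[symmetric] sum_negf sum_distrib_right sum_divide_distrib)
  finally show ?thesis .
qed

section \<open>Gaussian random functions with a given covariance\<close>

context discretised_measure
begin

context
  fixes K :: "'x \<Rightarrow> 'x \<Rightarrow> real" and d :: "nat \<Rightarrow> 'x" and C :: real
  assumes K: "psd_kernel K"
    and K_measurable: "\<And>y. (\<lambda>x. K x y) \<in> borel_measurable M"
    and K_diag_measurable: "(\<lambda>x. K x x) \<in> borel_measurable M"
    and K_bound: "\<And>x. K x x \<le> C"
    and d_dense: "\<And>x e. e > 0 \<Longrightarrow> \<exists>k. K x x - 2 * K x (d k) + K (d k) (d k) < e"
begin

interpretation NM: pair_sigma_finite normals M ..

abbreviation (input) "R n x \<equiv> residual K d n x x"

definition partial_sum :: "nat \<Rightarrow> (nat \<Rightarrow> real) \<Rightarrow> 'x \<Rightarrow> real" where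
  "partial_sum m u x = (\<Sum>k<m. feature K d k x * u k)"

text \<open>The first number of terms after which the remaining variance at x is at most 4^-j, the
  speed that \<open>fast_L2_limit\<close> asks for.\<close>

definition level :: "nat \<Rightarrow> 'x \<Rightarrow> nat" where
  "level j x = (LEAST m. R m x \<le> (1 / 4) ^ j)"

text \<open>Letting the number of terms of the \<open>j\<close>-th approximation depend on the point \<open>x\<close> yields
  almost sure convergence at every \<open>x\<close>, although the kernel series need not converge uniformly.\<close>

definition limit_sum :: "(nat \<Rightarrow> real) \<Rightarrow> 'x \<Rightarrow> real" where
  "limit_sum u x = lim (\<lambda>j. partial_sum (level j x) u x)"

lemma R_tendsto: "(\<lambda>n. R n x) \<longlonglongrightarrow> 0"
  using residual_diag_tendsto[OF K] d_dense by blast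

lemma R_level: "R (level j x) x \<le> (1 / 4) ^ j"
  unfolding level_def
proof (rule LeastI_ex)
  have "\<forall>\<^sub>F n in sequentially. R n x < (1 / 4) ^ j"
    by (intro order_tendstoD(2)[OF R_tendsto]) simp
  then show "\<exists>n. R n x \<le> (1 / 4) ^ j"
    unfolding eventually_sequentially by (meson less_imp_le order_refl)
qed

lemma level_mono: "i \<le> j \<Longrightarrow> level i x \<le> level j x"
  unfolding level_def[of i]
proof (rule Least_le)
  assume "i \<le> j"
  then have "(1 / 4 :: real) ^ j \<le> (1 / 4) ^ i" by (intro power_decreasing) auto
  then show "R (level j x) x \<le> (1 / 4) ^ i" using R_level[of j x] by linarith
qed

lemma feature_meas [measurable]: "feature K d k \<in> borel_measurable M"
  using K_measurable by (rule feature_measurable[OF K])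

lemma R_meas [measurable]: "(\<lambda>x. R n x) \<in> borel_measurable M"
  unfolding residual_eq[OF K] using K_diag_measurable by measurable

lemma level_measurable: "level j \<in> M \<rightarrow>\<^sub>M count_space UNIV"
  unfolding level_def[abs_def] by measurable

lemma partial_sum_measurable:
  "(\<lambda>z. partial_sum m (fst z) (snd z)) \<in> borel_measurable (normals \<Otimes>\<^sub>M M)"
  unfolding partial_sum_def by measurable

lemma partial_sum_measurable1: "(\<lambda>u. partial_sum m u x) \<in> borel_measurable normals"
  unfolding partial_sum_def by measurable

text \<open>The number of terms varies with x, but \<open>level j\<close> is measurable with
  countably many values, so joint measurability survives.\<close>

lemma limit_sum_measurable:
  "(\<lambda>z. limit_sum (fst z) (snd z)) \<in> borel_measurable (normals \<Otimes>\<^sub>M M)"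
  unfolding limit_sum_def
proof (rule borel_measurable_lim_metric)
  show "(\<lambda>z. partial_sum (level j (snd z)) (fst z) (snd z)) \<in> borel_measurable (normals \<Otimes>\<^sub>M M)" for j
    by (rule measurable_compose_countable[where f="\<lambda>m z. partial_sum m (fst z) (snd z)",
          OF partial_sum_measurable measurable_compose[OF measurable_snd level_measurable]])
qed

lemma limit_sum_measurable1: "(\<lambda>u. limit_sum u x) \<in> borel_measurable normals"
  unfolding limit_sum_def by (intro borel_measurable_lim_metric partial_sum_measurable1)

text \<open>The normals are orthonormal, so the mean square of an increment is a sum of squared
  features, and this sum is the drop of the residual variance.\<close>

lemma
  shows integrable_partial_sum_diff:
    "integrable normals (\<lambda>u. (partial_sum n u x - partial_sum m u x)\<^sup>2)"
    and partial_sum_diff_eq: "m \<le> n \<Longrightarrow>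
    (LINT u|normals. (partial_sum n u x - partial_sum m u x)\<^sup>2) = R m x - R n x"
proof -
  have diff: "partial_sum n u x - partial_sum m u x = (\<Sum>k=m..<n. feature K d k x * u k)"
    if "m \<le> n" for m n u
    using that unfolding partial_sum_def lessThan_atLeast0
    by (simp add: sum_diff_nat_ivl[of 0 m n, symmetric])
  have int: "integrable normals (\<lambda>u. (partial_sum n u x - partial_sum m u x)\<^sup>2)"
    if "m \<le> n" for m n
    unfolding diff[OF that] by (rule integrable_square_normals) simp
  show "integrable normals (\<lambda>u. (partial_sum n u x - partial_sum m u x)\<^sup>2)"
    using int[of m n] int[of n m] by (cases "m \<le> n") (simp_all add: power2_commute)
  assume mn: "m \<le> n"
  have "(LINT u|normals. (partial_sum n u x - partial_sum m u x)\<^sup>2)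
      = (\<Sum>k=m..<n. (feature K d k x)\<^sup>2)"
    unfolding diff[OF mn] by (rule expectation_square_normals) simp
  also have "\<dots> = (\<Sum>k<n. (feature K d k x)\<^sup>2) - (\<Sum>k<m. (feature K d k x)\<^sup>2)"
    using mn unfolding lessThan_atLeast0 by (simp add: sum_diff_nat_ivl)
  also have "\<dots> = R m x - R n x"
    by (simp add: residual_eq[OF K] power2_eq_square)
  finally show "(LINT u|normals. (partial_sum n u x - partial_sum m u x)\<^sup>2) = R m x - R n x" .
qed

text \<open>The order of m and n is left open because the levels of a point may lie on either side
  of a given m.\<close>

lemma partial_sum_diff_le:
  "(LINT u|normals. (partial_sum n u x - partial_sum m u x)\<^sup>2) \<le> R m x + R n x"
proof (cases "m \<le> n")
  case True
  then show ?thesis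
    using partial_sum_diff_eq[OF True, of x] residual_diag_nonneg[OF K, of d n x] by linarith
next
  case False
  then have "n \<le> m" by simp
  then show ?thesis
    using partial_sum_diff_eq[of n m x] residual_diag_nonneg[OF K, of d m x]
    by (simp add: power2_commute)
qed

lemma
  shows limit_sum_L2: "(\<lambda>u. limit_sum u x - partial_sum m u x) \<in> L2_fun normals"
    and limit_sum_error: "(LINT u|normals. (limit_sum u x - partial_sum m u x)\<^sup>2) \<le> 2 * R m x"
proof -
  define A where "A j u = partial_sum (level j x) u x" for j u
  have lim: "limit_sum u x = lim (\<lambda>j. A j u)" for u
    by (simp add: limit_sum_def A_def)
  have Am: "A i \<in> borel_measurable normals" for i
    unfolding A_def[abs_def] by (rule partial_sum_measurable1)
  have intA: "integrable normals (\<lambda>u. (A j u - A i u)\<^sup>2)" for i j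
    unfolding A_def by (rule integrable_partial_sum_diff)
  have leA: "(LINT u|normals. (A j u - A i u)\<^sup>2) \<le> (1 / 4) ^ i" if "i \<le> j" for i j
    unfolding A_def partial_sum_diff_eq[OF level_mono[OF that]]
    using R_level[of i x] residual_diag_nonneg[OF K, of d "level j x" x] by linarith
  note L = normals.fast_L2_limit[OF Am intA leA, folded lim]
  have 1: "(\<lambda>u. limit_sum u x - A i u) \<in> L2_fun normals" for i
    using L(1) by (intro L2_funI borel_measurable_diff limit_sum_measurable1 Am)
  have 2: "(\<lambda>u. A i u - partial_sum m u x) \<in> L2_fun normals" for i
    unfolding A_def
    by (intro L2_funI borel_measurable_diff partial_sum_measurable1 integrable_partial_sum_diff)
  from L2_fun_add[OF 1[of 0] 2[of 0]] show *: "(\<lambda>u. limit_sum u x - partial_sum m u x) \<in> L2_fun normals"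
    by simp
  let ?e = "L2_norm normals (\<lambda>u. limit_sum u x - partial_sum m u x)"
  \<comment> \<open>From (a + b)^2 \<le> 2 a^2 + 2 b^2 with a^2 \<le> 4^-i and b^2 \<le> 4^-i + R m
    x. Letting i grow leaves the factor 2 of the claim.\<close>
  have bound: "?e\<^sup>2 \<le> 4 * (1 / 4) ^ i + 2 * R m x" for i
  proof -
    let ?a = "L2_norm normals (\<lambda>u. limit_sum u x - A i u)"
    let ?b = "L2_norm normals (\<lambda>u. A i u - partial_sum m u x)"
    have "?e \<le> ?a + ?b" using L2_norm_triangle[OF 1[of i] 2[of i]] by simp
    then have "?e\<^sup>2 \<le> (?a + ?b)\<^sup>2" by (intro power_mono L2_norm_nonneg)
    also have "\<dots> \<le> 2 * ?a\<^sup>2 + 2 * ?b\<^sup>2"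
      using sum_squares_bound[of ?a ?b] by (simp add: power2_sum)
    also have "?a\<^sup>2 \<le> (1 / 4) ^ i" using L(2)[of i] by (simp add: L2_norm_power2)
    also have "?b\<^sup>2 \<le> (1 / 4) ^ i + R m x"
      using partial_sum_diff_le[of "level i x" x m] R_level[of i x]
      by (simp add: L2_norm_power2 A_def)
    finally show ?thesis by simp
  qed
  have "(\<lambda>i. 4 * (1 / 4) ^ i + 2 * R m x) \<longlonglongrightarrow> 4 * 0 + 2 * R m x"
    by (intro tendsto_intros LIMSEQ_power_zero) simp
  then have "?e\<^sup>2 \<le> 2 * R m x"
    using bound by (intro LIMSEQ_le_const[of "\<lambda>i. 4 * (1 / 4) ^ i + 2 * R m x"]) auto
  then show "(LINT u|normals. (limit_sum u x - partial_sum m u x)\<^sup>2) \<le> 2 * R m x"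
    by (simp add: L2_norm_power2)
qed

lemma partial_sum_L2: "(\<lambda>u. partial_sum m u x) \<in> L2_fun normals"
  using integrable_partial_sum_diff[of m x 0] by (intro L2_funI) (auto simp: partial_sum_def)

lemma limit_sum_in_L2: "(\<lambda>u. limit_sum u x) \<in> L2_fun normals"
  using L2_fun_add[OF limit_sum_L2[of x 0] partial_sum_L2[of 0 x]] by simp

lemma limit_sum_norm_tendsto:
  "(\<lambda>m. L2_norm normals (\<lambda>u. partial_sum m u x - limit_sum u x)) \<longlonglongrightarrow> 0"
proof (rule Lim_null_comparison)
  show "(\<lambda>m. sqrt (2 * R m x)) \<longlonglongrightarrow> 0"
    using tendsto_real_sqrt[OF tendsto_mult_left[OF R_tendsto[of x], of 2]] by simp
  have "L2_norm normals (\<lambda>u. partial_sum m u x - limit_sum u x) \<le> sqrt (2 * R m x)" for m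
    unfolding L2_norm_minus_commute[of _ "\<lambda>u. partial_sum m u x"] L2_norm_def[of normals]
    using limit_sum_error[of x m] by (rule real_sqrt_le_mono)
  then show "\<forall>\<^sub>F m in sequentially. norm (L2_norm normals (\<lambda>u. partial_sum m u x - limit_sum u x)) \<le> sqrt (2 * R m x)"
    by (simp add: L2_norm_nonneg)
qed

text \<open>The partial sums have covariance K minus the residual, and the residual tends to 0 at
  each pair of points; so the identity holds everywhere and not just almost everywhere.\<close>

lemma limit_sum_covariance:
  "(LINT u|normals. limit_sum u x * limit_sum u y) = K x y"
proof (rule LIMSEQ_unique)
  show "(\<lambda>m. LINT u|normals. partial_sum m u x * partial_sum m u y)
    \<longlonglongrightarrow> (LINT u|normals. limit_sum u x * limit_sum u y)"
    unfolding L2_inner_def[symmetric]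
    by (intro L2_inner_tendsto limit_sum_in_L2 partial_sum_L2 limit_sum_norm_tendsto)
  have eq: "(LINT u|normals. partial_sum m u x * partial_sum m u y) = K x y - residual K d m x y" for m
  proof -
    have "(LINT u|normals. partial_sum m u x * partial_sum m u y)
      = (LINT u|normals. (\<Sum>i<m. \<Sum>j<m. (feature K d i x * feature K d j y) * (u i * u j)))"
      by (simp add: partial_sum_def sum_product ac_simps)
    also have "\<dots> = (\<Sum>i<m. \<Sum>j<m. (feature K d i x * feature K d j y) * (LINT u|normals. u i * u j))"
      by (simp only: Bochner_Integration.integral_sum Bochner_Integration.integrable_sum
          integrable_mult_right integrable_normals_mult integral_mult_right_zero)
    also have "\<dots> = (\<Sum>i<m. \<Sum>j<m. if i = j then feature K d i x * feature K d j y else 0)"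
      by (intro sum.cong refl) (simp add: expectation_normals_mult)
    also have "\<dots> = (\<Sum>i<m. feature K d i x * feature K d i y)"
      by simp
    finally show ?thesis by (simp add: residual_eq[OF K])
  qed
  have "(\<lambda>m. K x y - residual K d m x y) \<longlonglongrightarrow> K x y - 0"
    by (rule tendsto_diff[OF tendsto_const residual_tendsto[OF K R_tendsto R_tendsto]])
  then show "(\<lambda>m. LINT u|normals. partial_sum m u x * partial_sum m u y) \<longlonglongrightarrow> K x y"
    unfolding eq diff_0_right .
qed

text \<open>A random element must have all its paths in L^2. The test concerns u alone, so one null
  set serves all x and the pointwise covariance is not disturbed.\<close>

definition gauss_process :: "(nat \<Rightarrow> real) \<Rightarrow> 'x \<Rightarrow> real" where
  "gauss_process u x = (if limit_sum u \<in> L2_fun M then limit_sum u x else 0)"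

lemma limit_sum_path: "limit_sum u \<in> borel_measurable M"
  using measurable_compose[OF measurable_Pair1'[of u normals M] limit_sum_measurable] by simp

lemma limit_sum_L2_sets: "{u. limit_sum u \<in> L2_fun M} \<in> sets normals"
proof -
  note [measurable] = limit_sum_measurable
  have "limit_sum u \<in> L2_fun M \<longleftrightarrow> (\<integral>\<^sup>+ x. ennreal ((limit_sum u x)\<^sup>2) \<partial>M) < \<infinity>" for u
    using limit_sum_path[of u] by (simp add: L2_fun_def integrable_iff_bounded)
  moreover have m: "(\<lambda>u. \<integral>\<^sup>+ x. ennreal ((limit_sum u x)\<^sup>2) \<partial>M) \<in> borel_measurable normals"
    by (rule borel_measurable_nn_integral) (simp add: case_prod_unfold)
  have "{u\<in>space normals. (\<integral>\<^sup>+ x. ennreal ((limit_sum u x)\<^sup>2) \<partial>M) < \<infinity>} \<in> sets normals"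
    by (rule borel_measurable_less[OF m borel_measurable_const])
  ultimately show ?thesis by simp
qed

lemma gauss_process_measurable:
  "(\<lambda>(u, x). gauss_process u x) \<in> borel_measurable (normals \<Otimes>\<^sub>M M)"
proof -
  let ?G = "{u. limit_sum u \<in> L2_fun M}"
  have "(\<lambda>z. if fst z \<in> ?G then limit_sum (fst z) (snd z) else 0)
      \<in> borel_measurable (normals \<Otimes>\<^sub>M M)"
  proof (rule measurable_If[OF limit_sum_measurable borel_measurable_const])
    have "fst -` ?G \<inter> space (normals \<Otimes>\<^sub>M M) \<in> sets (normals \<Otimes>\<^sub>M M)"
      by (rule measurable_sets[OF measurable_fst limit_sum_L2_sets])
    also have "fst -` ?G \<inter> space (normals \<Otimes>\<^sub>M M) = {z \<in> space (normals \<Otimes>\<^sub>M M). fst z \<in> ?G}"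
      unfolding vimage_def Int_def mem_Collect_eq by (rule Collect_cong) (rule conj_commute)
    finally show "{z \<in> space (normals \<Otimes>\<^sub>M M). fst z \<in> ?G} \<in> sets (normals \<Otimes>\<^sub>M M)" .
  qed
  then show ?thesis
    unfolding gauss_process_def case_prod_unfold mem_Collect_eq .
qed

lemma gauss_process_L2_fun: "gauss_process u \<in> L2_fun M"
proof (cases "limit_sum u \<in> L2_fun M")
  case True
  then have "gauss_process u = limit_sum u" by (simp add: gauss_process_def fun_eq_iff)
  then show ?thesis using True by simp
next
  case False
  then have "gauss_process u = (\<lambda>_. 0)" by (simp add: gauss_process_def fun_eq_iff)
  then show ?thesis by (simp add: L2_fun_def)
qed

text \<open>The pointwise variances are bounded by C and M is finite, so the squared norm of the
  path has finite expectation.\<close>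

lemma AE_gauss_process: "AE u in normals. gauss_process u = limit_sum u"
proof -
  have "AE u in normals. limit_sum u \<in> L2_fun M"
  proof (rule AE_L2_fun_process[OF normals.prob_space_axioms finite_measure_axioms])
    show "(\<lambda>(u, x). limit_sum u x) \<in> borel_measurable (normals \<Otimes>\<^sub>M M)"
      using limit_sum_measurable by (simp add: case_prod_unfold)
    show "integrable normals (\<lambda>u. (limit_sum u x)\<^sup>2)" for x
      using limit_sum_in_L2 by (rule L2_funD)
    show "(LINT u|normals. (limit_sum u x)\<^sup>2) \<le> C" for x
      using limit_sum_covariance[of x x] K_bound[of x] by (simp add: power2_eq_square)
  qed
  then show ?thesis by eventually_elim (simp add: gauss_process_def fun_eq_iff)
qed

lemma gauss_process_measurable1:
  "x \<in> space M \<Longrightarrow> (\<lambda>u. gauss_process u x) \<in> borel_measurable normals"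
  using measurable_compose[OF measurable_Pair2' gauss_process_measurable, of x] by simp

lemma gauss_process_covariance:
  assumes "x \<in> space M" "y \<in> space M"
  shows "integrable normals (\<lambda>u. gauss_process u x * gauss_process u y)"
    and "(LINT u|normals. gauss_process u x * gauss_process u y) = K x y"
proof -
  have m: "(\<lambda>u. gauss_process u x * gauss_process u y) \<in> borel_measurable normals"
    "(\<lambda>u. limit_sum u x * limit_sum u y) \<in> borel_measurable normals"
    by (intro borel_measurable_times gauss_process_measurable1 limit_sum_measurable1 assms)+
  have ae: "AE u in normals. gauss_process u x * gauss_process u y = limit_sum u x * limit_sum u y"
    using AE_gauss_process by eventually_elim simp
  show "integrable normals (\<lambda>u. gauss_process u x * gauss_process u y)"
    unfolding integrable_cong_AE[OF m ae]
    by (intro L2_fun_integrable_mult limit_sum_in_L2)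
  show "(LINT u|normals. gauss_process u x * gauss_process u y) = K x y"
    unfolding integral_cong_AE[OF m ae] by (rule limit_sum_covariance)
qed

text \<open>A squared feature is a drop of the residual diagonal, hence at most C; so the features
  are bounded.\<close>

lemma partial_sum_path: "partial_sum m u \<in> L2_fun M"
  unfolding partial_sum_def[abs_def]
proof (intro L2_fun_sum)
  fix k
  have "(feature K d k x)\<^sup>2 \<le> C" for x
  proof -
    have "(feature K d k x)\<^sup>2 = R k x - R (Suc k) x"
      unfolding residual_Suc[OF K] by (simp add: power2_eq_square)
    also have "\<dots> \<le> C"
      using residual_diag_le[OF K, of d k x] K_bound[of x] residual_diag_nonneg[OF K, of d "Suc k" x]
      by linarith
    finally show ?thesis .
  qed
  then have "\<bar>feature K d k x\<bar> \<le> sqrt C" for x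
    using real_sqrt_le_mono[of "(feature K d k x)\<^sup>2" C] by simp
  then have "feature K d k \<in> L2_fun M" by (intro L2_fun_bounded feature_meas)
  from L2_fun_cmult[OF this, of "u k"] show "(\<lambda>x. feature K d k x * u k) \<in> L2_fun M"
    by (simp add: mult.commute)
qed

lemma feature_L2_fun: "feature K d k \<in> L2_fun M"
proof -
  \<comment> \<open>A single feature is the partial sum whose coefficients form a unit
    vector.\<close>
  have "feature K d k = (\<lambda>x. partial_sum (Suc k) (\<lambda>i. if i = k then 1 else 0) x)"
    by (simp add: partial_sum_def fun_eq_iff)
  then show ?thesis using partial_sum_path by simp
qed

lemma inner_partial_sum:
  assumes h: "h \<in> L2_fun M"
  shows "L2_inner M (partial_sum m u) h = (\<Sum>k<m. L2_inner M (feature K d k) h * u k)"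
proof -
  have "L2_inner M (partial_sum m u) h = (\<Sum>k<m. L2_inner M (\<lambda>x. u k * feature K d k x) h)"
    unfolding partial_sum_def[abs_def] mult.commute[of "feature K d _ _"]
    by (rule L2_inner_sum_left) (use h in \<open>auto intro: L2_fun_cmult feature_L2_fun\<close>)
  then show ?thesis by (simp add: L2_inner_cmult_left mult.commute)
qed

lemma
  shows integrable_process_error: "integrable normals (\<lambda>u. LINT x|M. (gauss_process u x - partial_sum m u x)\<^sup>2)"
    and process_error_le: "(LINT u|normals. LINT x|M. (gauss_process u x - partial_sum m u x)\<^sup>2)
      \<le> (LINT x|M. 2 * R m x)"
proof -
  have ae: "AE u in normals. (gauss_process u x - partial_sum m u x)\<^sup>2
      = (limit_sum u x - partial_sum m u x)\<^sup>2" for x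
    using AE_gauss_process by eventually_elim simp
  have m: "(\<lambda>u. (gauss_process u x - partial_sum m u x)\<^sup>2) \<in> borel_measurable normals"
    "(\<lambda>u. (limit_sum u x - partial_sum m u x)\<^sup>2) \<in> borel_measurable normals"
    if "x \<in> space M" for x
    by (intro borel_measurable_power borel_measurable_diff gauss_process_measurable1
        limit_sum_measurable1 partial_sum_measurable1 that)+
  have sq: "integrable normals (\<lambda>u. (gauss_process u x - partial_sum m u x)\<^sup>2)"
    and le: "(LINT u|normals. (gauss_process u x - partial_sum m u x)\<^sup>2) \<le> 2 * R m x"
    if "x \<in> space M" for x
    unfolding integrable_cong_AE[OF m[OF that] ae] integral_cong_AE[OF m[OF that] ae]
    using limit_sum_L2 limit_sum_error by (auto dest: L2_funD)
  have R2: "2 * R m x \<le> 2 * C" for x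
    using residual_diag_le[OF K, of d m x] K_bound[of x] by linarith
  have joint: "(\<lambda>(u, x). gauss_process u x - partial_sum m u x) \<in> borel_measurable (normals \<Otimes>\<^sub>M M)"
    using gauss_process_measurable partial_sum_measurable[of m]
    unfolding case_prod_unfold by (rule borel_measurable_diff)
  note facts = normals.prob_space_axioms finite_measure_axioms joint sq order_trans[OF le R2]
  show "integrable normals (\<lambda>u. LINT x|M. (gauss_process u x - partial_sum m u x)\<^sup>2)"
    by (rule integrable_norm_process[OF facts])
  have sw: "(\<lambda>x. LINT u|normals. (gauss_process u x - partial_sum m u x)\<^sup>2) \<in> borel_measurable M"
  proof (rule normals.borel_measurable_lebesgue_integral)
    show "(\<lambda>(x, u). (gauss_process u x - partial_sum m u x)\<^sup>2) \<in> borel_measurable (M \<Otimes>\<^sub>M normals)"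
      unfolding case_prod_unfold by (rule borel_measurable_power[OF measurable_swapped[OF facts]])
  qed
  have iR: "integrable M (\<lambda>x. 2 * R m x)"
    using R2 residual_diag_nonneg[OF K] by (intro integrable_const_bound[where B="2 * C"]) auto
  have "(LINT u|normals. LINT x|M. (gauss_process u x - partial_sum m u x)\<^sup>2)
      = (LINT x|M. LINT u|normals. (gauss_process u x - partial_sum m u x)\<^sup>2)"
    by (rule integral_norm_process[OF facts])
  also have "\<dots> \<le> (LINT x|M. 2 * R m x)"
  proof (rule integral_mono[OF _ iR le])
    show "integrable M (\<lambda>x. LINT u|normals. (gauss_process u x - partial_sum m u x)\<^sup>2)"
      using le by (intro Bochner_Integration.integrable_bound[OF iR sw] AE_I2)
        (auto simp: residual_diag_nonneg[OF K])
  qed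
  finally show "(LINT u|normals. LINT x|M. (gauss_process u x - partial_sum m u x)\<^sup>2)
      \<le> (LINT x|M. 2 * R m x)" .
qed

lemma process_error_tendsto: "(\<lambda>m. LINT x|M. 2 * R m x) \<longlonglongrightarrow> 0"
proof -
  have "(\<lambda>m. LINT x|M. 2 * R m x) \<longlonglongrightarrow> (LINT x|M. 2 * 0)"
  proof (rule integral_dominated_convergence[where w="\<lambda>_. 2 * C"])
    show "AE x in M. (\<lambda>m. 2 * R m x) \<longlonglongrightarrow> 2 * 0"
      by (intro AE_I2 tendsto_intros R_tendsto)
    show "AE x in M. norm (2 * R m x) \<le> 2 * C" for m
    proof (rule AE_I2)
      fix x
      show "norm (2 * R m x) \<le> 2 * C"
        using residual_diag_le[OF K, of d m x] K_bound[of x] residual_diag_nonneg[OF K, of d m x] by simp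
    qed
  qed simp_all
  then show ?thesis by simp
qed

lemma measurable_inner_gauss_process:
  assumes "h \<in> borel_measurable M"
  shows "(\<lambda>u. L2_inner M (gauss_process u) h) \<in> borel_measurable normals"
  unfolding L2_inner_def
  by (rule borel_measurable_lebesgue_integral)
    (use gauss_process_measurable assms in \<open>unfold case_prod_unfold, measurable\<close>)

text \<open>Cauchy-Schwarz in L^2 of M turns the mean square error of the paths into one of their
  inner products with h.\<close>

lemma
  assumes h: "h \<in> L2_fun M"
  shows inner_gauss_process_L2: "(\<lambda>u. L2_inner M (gauss_process u) h) \<in> L2_fun normals"
    and inner_partial_sum_L2: "(\<lambda>u. L2_inner M (partial_sum m u) h) \<in> L2_fun normals"
    and inner_process_tendsto: "(\<lambda>m. L2_norm normals (\<lambda>u. L2_inner M (partial_sum m u) h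
      - L2_inner M (gauss_process u) h)) \<longlonglongrightarrow> 0"
proof -
  have mG: "(\<lambda>u. L2_inner M (gauss_process u) h) \<in> borel_measurable normals"
    by (intro measurable_inner_gauss_process L2_funD(1)[OF h])
  have mP: "(\<lambda>u. L2_inner M (partial_sum m u) h) \<in> borel_measurable normals" for m
    unfolding inner_partial_sum[OF h] by measurable
  show P: "(\<lambda>u. L2_inner M (partial_sum m u) h) \<in> L2_fun normals" for m
    unfolding inner_partial_sum[OF h]
    by (intro L2_funI integrable_square_normals) (simp_all add: mP[unfolded inner_partial_sum[OF h]])
  have le: "(L2_inner M (partial_sum m u) h - L2_inner M (gauss_process u) h)\<^sup>2
      \<le> (L2_norm M h)\<^sup>2 * (LINT x|M. (gauss_process u x - partial_sum m u x)\<^sup>2)" for m u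
  proof -
    let ?D = "\<lambda>x. gauss_process u x - partial_sum m u x"
    have "L2_inner M (gauss_process u) h - L2_inner M (partial_sum m u) h = L2_inner M ?D h"
      by (rule L2_inner_diff_left[OF gauss_process_L2_fun partial_sum_path h, symmetric])
    also have "(L2_inner M ?D h)\<^sup>2 \<le> (L2_norm M ?D * L2_norm M h)\<^sup>2"
      using L2_Cauchy_Schwarz[OF L2_fun_diff[OF gauss_process_L2_fun partial_sum_path] h, of u m u]
      by (simp add: abs_le_square_iff[symmetric] abs_mult L2_norm_nonneg)
    finally show ?thesis
      by (simp add: power2_commute power_mult_distrib L2_norm_power2 mult.commute)
  qed
  have int: "integrable normals (\<lambda>u. (L2_norm M h)\<^sup>2 * (LINT x|M. (gauss_process u x - partial_sum m u x)\<^sup>2))" for m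
    by (intro integrable_mult_right integrable_process_error)
  have D: "(\<lambda>u. L2_inner M (partial_sum m u) h - L2_inner M (gauss_process u) h) \<in> L2_fun normals" for m
  proof (rule L2_funI)
    show m: "(\<lambda>u. L2_inner M (partial_sum m u) h - L2_inner M (gauss_process u) h) \<in> borel_measurable normals"
      using mG mP by (intro borel_measurable_diff)
    show "integrable normals (\<lambda>u. (L2_inner M (partial_sum m u) h - L2_inner M (gauss_process u) h)\<^sup>2)"
      by (rule Bochner_Integration.integrable_bound[OF int[of m] borel_measurable_power[OF m]])
        (use le[of m] in \<open>auto intro!: AE_I2 order_trans[OF _ abs_ge_self]\<close>)
  qed
  from L2_fun_diff[OF P[of 0] D[of 0]] show "(\<lambda>u. L2_inner M (gauss_process u) h) \<in> L2_fun normals"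
    by simp
  show "(\<lambda>m. L2_norm normals (\<lambda>u. L2_inner M (partial_sum m u) h
      - L2_inner M (gauss_process u) h)) \<longlonglongrightarrow> 0"
  proof (rule Lim_null_comparison)
    show "(\<lambda>m. sqrt ((L2_norm M h)\<^sup>2 * (LINT x|M. 2 * R m x))) \<longlonglongrightarrow> 0"
      using tendsto_real_sqrt[OF tendsto_mult_left[OF process_error_tendsto]] by fastforce
    have "L2_norm normals (\<lambda>u. L2_inner M (partial_sum m u) h - L2_inner M (gauss_process u) h)
      \<le> sqrt ((L2_norm M h)\<^sup>2 * (LINT x|M. 2 * R m x))" for m
      unfolding L2_norm_def[of normals]
    proof (rule real_sqrt_le_mono)
      have "(LINT u|normals. (L2_inner M (partial_sum m u) h - L2_inner M (gauss_process u) h)\<^sup>2)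
        \<le> (LINT u|normals. (L2_norm M h)\<^sup>2 * (LINT x|M. (gauss_process u x - partial_sum m u x)\<^sup>2))"
        using L2_funD(2)[OF D] int le by (intro integral_mono)
      also have "\<dots> = (L2_norm M h)\<^sup>2 * (LINT u|normals. LINT x|M. (gauss_process u x - partial_sum m u x)\<^sup>2)"
        by (rule integral_mult_right_zero)
      also have "\<dots> \<le> (L2_norm M h)\<^sup>2 * (LINT x|M. 2 * R m x)"
        by (intro mult_left_mono process_error_le) simp
      finally show "(LINT u|normals. (L2_inner M (partial_sum m u) h - L2_inner M (gauss_process u) h)\<^sup>2)
        \<le> (L2_norm M h)\<^sup>2 * (LINT x|M. 2 * R m x)" .
    qed
    then show "\<forall>\<^sub>F m in sequentially. norm (L2_norm normals (\<lambda>u. L2_inner M (partial_sum m u) h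
        - L2_inner M (gauss_process u) h)) \<le> sqrt ((L2_norm M h)\<^sup>2 * (LINT x|M. 2 * R m x))"
      by (simp add: L2_norm_nonneg)
  qed
qed

text \<open>For partial sums the inner product is a finite combination of independent normals, with
  an explicit characteristic function. Characteristic function and variance both pass to the mean
  square limit.\<close>

lemma char_inner_gauss_process:
  assumes h: "h \<in> L2_fun M"
  shows "(CLINT u|normals. iexp (t * L2_inner M (gauss_process u) h))
    = of_real (exp (- L2_inner normals (\<lambda>u. L2_inner M (gauss_process u) h)
        (\<lambda>u. L2_inner M (gauss_process u) h) * t\<^sup>2 / 2))"
proof (rule LIMSEQ_unique)
  let ?G = "\<lambda>u. L2_inner M (gauss_process u) h" and ?P = "\<lambda>m u. L2_inner M (partial_sum m u) h"
  note L2 = inner_gauss_process_L2[OF h] inner_partial_sum_L2[OF h] inner_process_tendsto[OF h]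
  show "(\<lambda>m. CLINT u|normals. iexp (t * ?P m u)) \<longlonglongrightarrow> (CLINT u|normals. iexp (t * ?G u))"
    by (rule normals.char_tendsto_if_L2_tendsto[OF L2])
  have "(CLINT u|normals. iexp (t * ?P m u)) = of_real (exp (- L2_inner normals (?P m) (?P m) * t\<^sup>2 / 2))" for m
    unfolding L2_inner_def[of normals] power2_eq_square[symmetric, of "L2_inner M _ _"]
    unfolding inner_partial_sum[OF h] char_normals[OF finite_lessThan]
      expectation_square_normals[OF finite_lessThan] ..
  moreover have "(\<lambda>m. complex_of_real (exp (- L2_inner normals (?P m) (?P m) * t\<^sup>2 / 2)))
      \<longlonglongrightarrow> of_real (exp (- L2_inner normals ?G ?G * t\<^sup>2 / 2))"
    by (intro tendsto_intros L2_inner_tendsto L2) simp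
  ultimately show "(\<lambda>m. CLINT u|normals. iexp (t * ?P m u))
      \<longlonglongrightarrow> of_real (exp (- L2_inner normals ?G ?G * t\<^sup>2 / 2))"
    by simp
qed

lemma gauss_process_properties:
  shows "gaussian_element normals M gauss_process"
    and "centred_element normals M gauss_process"
    and "covariance_kernel normals M gauss_process K"
    and "pointwise_covariance normals M gauss_process K"
proof -
  have nonneg: "0 \<le> L2_inner normals f f" for f by (simp add: L2_inner_def)
  have law: "normal_law (distr normals borel (\<lambda>u. L2_inner M (gauss_process u) h))"
    and mean: "(LINT u|normals. L2_inner M (gauss_process u) h) = 0" if h: "h \<in> L2_fun M" for h
    using normals.normal_law_if_char[OF measurable_inner_gauss_process[OF L2_funD(1)[OF h]] nonneg
        char_inner_gauss_process[OF h]] by blast+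
  have meas: "gauss_process \<in> normals \<rightarrow>\<^sub>M L2_borel M"
  \<comment> \<open>Joint measurability makes the distances to fixed functions measurable, and these
    suffice.\<close>
  proof (rule measurable_into_L2_borel[OF gauss_process_L2_fun])
    fix g assume g: "g \<in> L2_fun M"
    note [measurable] = gauss_process_measurable[unfolded case_prod_unfold] L2_funD(1)[OF g]
    have "(\<lambda>(u, x). (gauss_process u x - g x)\<^sup>2) \<in> borel_measurable (normals \<Otimes>\<^sub>M M)"
      unfolding case_prod_unfold by measurable
    then show "(\<lambda>u. L2_norm M (\<lambda>x. gauss_process u x - g x)) \<in> borel_measurable normals"
      unfolding L2_norm_def
      by (rule measurable_compose[OF borel_measurable_lebesgue_integral borel_measurable_sqrt])
  qed
  show "gaussian_element normals M gauss_process"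
    unfolding gaussian_element_def using normals.prob_space_axioms meas law by blast
  show "centred_element normals M gauss_process"
    unfolding centred_element_def using mean by blast
  show pc: "pointwise_covariance normals M gauss_process K"
    unfolding pointwise_covariance_def
    using gauss_process_measurable gauss_process_covariance by blast
  show "covariance_kernel normals M gauss_process K"
    unfolding covariance_kernel_def
  proof (intro ballI)
    fix g h assume gh: "g \<in> L2_fun M" "h \<in> L2_fun M"
    have sq: "integrable normals (\<lambda>u. (gauss_process u x)\<^sup>2)"
      "(LINT u|normals. (gauss_process u x)\<^sup>2) \<le> C" if "x \<in> space M" for x
      unfolding power2_eq_square
      using gauss_process_covariance[OF that that] K_bound[of x] by auto
    have "(LINT u|normals. L2_inner M (gauss_process u) g * L2_inner M (gauss_process u) h)
      = (LINT x|M. LINT y|M. (LINT u|normals. gauss_process u x * gauss_process u y) * g x * h y)"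
      by (rule integral_inner_mult_process[OF normals.prob_space_axioms finite_measure_axioms
            gauss_process_measurable sq]) (use gh L2_fun_integrable in auto)
    also have "\<dots> = (LINT x|M. LINT y|M. K x y * g x * h y)"
      by (intro Bochner_Integration.integral_cong refl) (simp add: gauss_process_covariance)
    finally show "(LINT u|normals. L2_inner M (gauss_process u) g * L2_inner M (gauss_process u) h)
      = (LINT x|M. LINT y|M. K x y * g x * h y)" .
  qed
qed

end

end

section \<open>The test statistic\<close>

lemma lborel_integral_uminus:
  fixes f :: "'a :: euclidean_space \<Rightarrow> real"
  assumes "f \<in> borel_measurable borel"
  shows "(LINT x|lborel. f (- x)) = (LINT x|lborel. f x)"
proof -
  have "lborel = (distr lborel borel uminus :: 'a measure)"
    using lborel_affine[of "-1" "0 :: 'a"] by (simp add: density_1 uminus_add_conv_diff)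
  then have "(LINT x|lborel. f x) = (LINT x|distr lborel borel uminus. f x)" by simp
  also have "\<dots> = (LINT x|lborel. f (- x))"
    using assms by (subst integral_distr) auto
  finally show ?thesis by simp
qed

text \<open>Brings the product sigma-algebra of \<open>H_measure\<close> into the form of a trace of
  Borel sets that \<open>discretised_measure\<close> requires.\<close>

lemma sets_pair_restrict_borel:
  fixes T :: "'b :: second_countable_topology set"
  shows "sets ((borel :: 'a :: second_countable_topology measure) \<Otimes>\<^sub>M restrict_space borel T)
    = sets (restrict_space borel (UNIV \<times> T))" (is "sets ?M = sets ?R")
proof
  have space: "space ?M = UNIV \<times> T" "space ?R = UNIV \<times> T"
    by (simp_all add: space_pair_measure space_restrict_space)
  show "sets ?M \<subseteq> sets ?R"
  proof
    fix A assume A: "A \<in> sets ?M"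
    have "fst \<in> ?R \<rightarrow>\<^sub>M (borel :: 'a measure)"
      by (rule measurable_restrict_space1) (simp add: borel_prod[symmetric])
    moreover have "snd \<in> ?R \<rightarrow>\<^sub>M restrict_space (borel :: 'b measure) T"
      by (rule measurable_restrict_space2, simp add: space Pi_def)
        (rule measurable_restrict_space1, simp add: borel_prod[symmetric])
    ultimately have "(\<lambda>z. (fst z, snd z)) \<in> ?R \<rightarrow>\<^sub>M ?M" by (rule measurable_Pair)
    from measurable_sets[OF this A] have "A \<inter> space ?R \<in> sets ?R" by (simp add: vimage_def Int_def)
    moreover have "A \<subseteq> space ?R" using sets.sets_into_space[OF A] space by simp
    ultimately show "A \<in> sets ?R" by (simp add: Int_absorb2)
  qed
  show "sets ?R \<subseteq> sets ?M"
  proof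
    fix A assume "A \<in> sets ?R"
    then obtain B where B: "B \<in> sets (borel :: ('a \<times> 'b) measure)" "A = B \<inter> (UNIV \<times> T)"
      by (auto simp: sets_restrict_space)
    have "snd \<in> ?M \<rightarrow>\<^sub>M (borel :: 'b measure)"
      using measurable_compose[OF measurable_snd measurable_restrict_space1[OF measurable_ident]]
      by simp
    then have "(\<lambda>z. (fst z, snd z)) \<in> ?M \<rightarrow>\<^sub>M (borel \<Otimes>\<^sub>M borel)"
      by (intro measurable_Pair measurable_fst)
    moreover have "B \<in> sets (borel \<Otimes>\<^sub>M borel)" using B(1) by (simp only: borel_prod)
    ultimately have "(\<lambda>z. (fst z, snd z)) -` B \<inter> space ?M \<in> sets ?M" by (rule measurable_sets)
    then show "A \<in> sets ?M" by (simp add: B(2) space)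
  qed
qed

lemma sets_H_measure:
  "sets (H_measure w :: ((real ^ 'm) \<times> real) measure) = sets (restrict_space borel (UNIV \<times> Theta))"
proof -
  have "sets (H_measure w :: ((real ^ 'm) \<times> real) measure)
      = sets ((borel :: (real ^ 'm) measure) \<Otimes>\<^sub>M restrict_space borel Theta)"
    unfolding H_measure_def sets_density
    by (intro sets_pair_measure_cong sets_restrict_space_cong sets_lborel)
  then show ?thesis by (simp only: sets_pair_restrict_borel)
qed

lemma finite_measure_H_measure:
  fixes w :: "real \<Rightarrow> real"
  assumes w_meas: "w \<in> borel_measurable (restrict_space borel {0..})"
    and w_pos: "\<And>r. r \<ge> 0 \<Longrightarrow> w r > 0"
    and w_int: "integrable lborel (\<lambda>s :: real ^ 'm. w (norm s))"
  shows "finite_measure (H_measure w :: ((real ^ 'm) \<times> real) measure)"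
proof
  let ?L = "lborel :: (real ^ 'm) measure" and ?R = "restrict_space lborel Theta"
  have Th: "Theta \<in> sets lborel" by (simp add: Theta_def)
  interpret R: sigma_finite_measure ?R
    using Th by (intro sigma_finite_measure_restrict_space sigma_finite_lborel) auto
  have wn [measurable]: "(\<lambda>s :: real ^ 'm. w (norm s)) \<in> borel_measurable borel"
    using borel_measurable_integrable[OF w_int] by simp
  have "emeasure (H_measure w) (space (H_measure w :: ((real ^ 'm) \<times> real) measure))
      = (\<integral>\<^sup>+ z. ennreal (w (norm (fst z))) \<partial>(?L \<Otimes>\<^sub>M ?R))"
    unfolding H_measure_def space_density
    by (subst emeasure_density[OF _ sets.top]) (auto simp: case_prod_unfold intro!: nn_integral_cong)
  also have "\<dots> = (\<integral>\<^sup>+ s. \<integral>\<^sup>+ \<theta>. ennreal (w (norm s)) \<partial>?R \<partial>?L)"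
    by (subst R.nn_integral_fst[symmetric]) simp_all
  also have "\<dots> = (\<integral>\<^sup>+ s. ennreal (w (norm s)) \<partial>?L) * emeasure ?R (space ?R)"
    by (simp add: nn_integral_multc)
  also have "emeasure ?R (space ?R) = emeasure lborel Theta"
    using Th by (simp add: space_restrict_space emeasure_restrict_space)
  also have "(\<integral>\<^sup>+ s. ennreal (w (norm s)) \<partial>?L) * emeasure lborel Theta < \<infinity>"
  proof (rule ennreal_mult_less_top[THEN iffD2, unfolded infinity_ennreal_def[symmetric]], intro disjI2 conjI)
    have "(\<integral>\<^sup>+ s. ennreal (w (norm s)) \<partial>?L) = ennreal (LINT s|?L. w (norm s))"
      using w_pos by (intro nn_integral_eq_integral w_int AE_I2) (simp add: less_imp_le)
    then show "(\<integral>\<^sup>+ s. ennreal (w (norm s)) \<partial>?L) < \<infinity>" by simp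
    show "emeasure lborel Theta < \<infinity>" by (simp add: Theta_def)
  qed
  finally show "emeasure (H_measure w) (space (H_measure w :: ((real ^ 'm) \<times> real) measure)) \<noteq> \<infinity>"
    by simp
qed

text \<open>The partitions come from simple functions that approximate the identity map, which is
  Borel measurable into a separable metric space.\<close>

lemma discretised_H_measure:
  fixes w :: "real \<Rightarrow> real"
  assumes "w \<in> borel_measurable (restrict_space borel {0..})" "\<And>r. r \<ge> 0 \<Longrightarrow> w r > 0"
    and "integrable lborel (\<lambda>s :: real ^ 'm. w (norm s))"
  obtains p where "discretised_measure (H_measure w :: ((real ^ 'm) \<times> real) measure) p"
proof -
  let ?M = "H_measure w :: ((real ^ 'm) \<times> real) measure"
  have "(\<lambda>x. x) \<in> borel_measurable ?M"
    by (subst measurable_cong_sets[OF sets_H_measure refl]) (rule measurable_restrict_space1, simp)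
  then obtain F where F: "\<And>i. simple_function ?M (F i)" "\<And>x. x \<in> space ?M \<Longrightarrow> (\<lambda>i. F i x) \<longlonglongrightarrow> x"
    using borel_measurable_implies_sequence_metric[of "\<lambda>x. x" ?M] by blast
  have "discretised_measure ?M F"
  proof (intro discretised_measure.intro finite_measure_H_measure assms discretised_measure_axioms.intro F)
    show "sets ?M = sets (restrict_space borel (space ?M))"
      unfolding space_H_measure by (rule sets_H_measure)
  qed
  then show ?thesis by (rule that)
qed

section \<open>Rotations, continuity and bounds for \<open>ell\<close>\<close>

lemma sum_UNIV_sum:
  fixes f :: "'a :: finite + 'a \<Rightarrow> real"
  shows "(\<Sum>j\<in>UNIV. f j) = (\<Sum>k\<in>UNIV. f (Inl k)) + (\<Sum>k\<in>UNIV. f (Inr k))"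
  using sum.Plus [of "UNIV :: 'a set" "UNIV :: 'a set" f] by (simp add: comp_def)

lemma rot_mult_component:
  fixes x :: "real ^ ('d :: finite + 'd)"
  shows "(rot \<theta> *v x) $ i = (case i of
      Inl k \<Rightarrow> cos \<theta> * x $ Inl k - sin \<theta> * x $ Inr k
    | Inr k \<Rightarrow> sin \<theta> * x $ Inl k + cos \<theta> * x $ Inr k)"
  by (simp add: rot_def matrix_vector_mult_def sum_UNIV_sum if_distrib [of "\<lambda>x. x * _"] sum.delta'
      split: sum.split cong: if_cong)

text \<open>Continuity in all three arguments jointly serves twice: for the measurability of
  \<open>ell_process\<close>, and for turning a topologically dense sequence into one dense in the
  canonical distance.\<close>

lemma continuous_on_ell:
  fixes f g :: "'t :: t2_space \<Rightarrow> real ^ ('d :: finite + 'd)" and h :: "'t \<Rightarrow> real"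
  assumes "continuous_on S f" "continuous_on S g" "continuous_on S h"
  shows "continuous_on S (\<lambda>z. ell (f z) (g z) (h z))"
proof -
  have "continuous_on S (\<lambda>z. (rot (h z) *v f z) $ i)" for i
    unfolding rot_mult_component
    by (cases i) (auto intro!: continuous_intros assms)
  then have "continuous_on S (\<lambda>z. \<chi> i. (rot (h z) *v f z) $ i)"
    by (rule continuous_on_vec_lambda)
  then have "continuous_on S (\<lambda>z. rot (h z) *v f z)"
    by (simp only: vec_lambda_eta)
  then have "continuous_on S (\<lambda>z. g z \<bullet> (rot (h z) *v f z))"
    by (auto intro!: continuous_intros assms)
  then show ?thesis
    unfolding ell_def CS_plus_def by (auto intro!: continuous_intros assms)
qed

lemma continuous_on_RI: "continuous_on UNIV (RI :: complex ^ 'd \<Rightarrow> real ^ ('d + 'd))"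
  unfolding RI_def
proof (intro continuous_on_vec_lambda)
  fix i :: "'d + 'd"
  show "continuous_on UNIV (\<lambda>z :: complex ^ 'd. case i of Inl k \<Rightarrow> Re (z $ k) | Inr k \<Rightarrow> Im (z $ k))"
    by (cases i) (auto intro!: continuous_intros)
qed

lemma CS_plus_abs_le: "\<bar>CS_plus x\<bar> \<le> 2"
  unfolding CS_plus_def using abs_cos_le_one[of x] abs_sin_le_one[of x] by linarith

lemma ell_abs_le: "\<bar>ell x s \<theta>\<bar> \<le> 4"
  unfolding ell_def using CS_plus_abs_le[of "s \<bullet> x"] CS_plus_abs_le[of "s \<bullet> (rot \<theta> *v x)"] by linarith

definition ell_process :: "complex ^ 'd \<Rightarrow> (real ^ ('d :: finite + 'd)) \<times> real \<Rightarrow> real" where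
  "ell_process z x = ell (RI z) (fst x) (snd x)"

lemma continuous_ell_process:
  "continuous_on UNIV (\<lambda>z. ell_process (fst z) (snd z) :: real)"
  unfolding ell_process_def
  by (intro continuous_on_ell continuous_intros continuous_on_compose2[OF continuous_on_RI]) auto

lemma measurable_ell_process:
  assumes f: "f \<in> borel_measurable M" and g: "g \<in> borel_measurable M"
  shows "(\<lambda>z. ell_process (f z) (g z)) \<in> borel_measurable M"
proof -
  have "(\<lambda>z. ell_process (fst z) (snd z)) \<in> borel_measurable (borel \<Otimes>\<^sub>M borel)"
    unfolding borel_prod by (rule borel_measurable_continuous_onI[OF continuous_ell_process])
  from measurable_compose[OF measurable_Pair[OF f g] this] show ?thesis by simp
qed

lemma limit_kernel_eq: "limit_kernel P Z = (\<lambda>x y. LINT u|P. ell_process (Z u) x * ell_process (Z u) y)"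
  by (simp add: limit_kernel_def ell_process_def fun_eq_iff case_prod_unfold)

text \<open>Let a and b be the sums of cosine and of sine differences. The empirical characteristic
  functions produce a^2 + b^2, \<open>CS_plus\<close> produces (a + b)^2. Under s -> - s the sum a
  is even, b is odd and the weight is radial, so 2 a b integrates to 0. This lets one real function
  stand in for the complex difference.\<close>

lemma set_integral_square_ecf_diff:
  fixes w :: "real \<Rightarrow> real" and x y :: "nat \<Rightarrow> real ^ 'm"
  assumes w_int: "integrable lborel (\<lambda>s :: real ^ 'm. w (norm s))" and n: "n \<ge> 1"
  shows "real n * (LINT s|lborel. (cmod (ecf x n s - ecf y n s))\<^sup>2 * w (norm s))
    = (LINT s|lborel. ((\<Sum>j=1..n. CS_plus (s \<bullet> x j) - CS_plus (s \<bullet> y j)) / sqrt n)\<^sup>2 * w (norm s))"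
proof -
  define a where "a s = (\<Sum>j=1..n. cos (s \<bullet> x j) - cos (s \<bullet> y j))" for s
  define b where "b s = (\<Sum>j=1..n. sin (s \<bullet> x j) - sin (s \<bullet> y j))" for s
  have [measurable]: "(\<lambda>s :: real ^ 'm. w (norm s)) \<in> borel_measurable borel"
    using borel_measurable_integrable[OF w_int] by simp
  have [measurable]: "a \<in> borel_measurable borel" "b \<in> borel_measurable borel"
    unfolding a_def[abs_def] b_def[abs_def] by measurable
  have a_le: "\<bar>a s\<bar> \<le> 2 * n" and b_le: "\<bar>b s\<bar> \<le> 2 * n" for s
  proof -
    have "\<bar>cos u - cos v\<bar> \<le> 2" "\<bar>sin u - sin v\<bar> \<le> 2" for u v :: real
      using abs_cos_le_one[of u] abs_cos_le_one[of v] abs_sin_le_one[of u] abs_sin_le_one[of v] by linarith+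
    then have "\<bar>a s\<bar> \<le> (\<Sum>j=1..n. 2)" "\<bar>b s\<bar> \<le> (\<Sum>j=1..n. 2)"
      unfolding a_def b_def by (intro order_trans[OF sum_abs sum_mono]; simp)+
    then show "\<bar>a s\<bar> \<le> 2 * n" "\<bar>b s\<bar> \<le> 2 * n" by simp_all
  qed
  have int: "integrable lborel (\<lambda>s. f s * w (norm s))"
    if [measurable]: "f \<in> borel_measurable borel" and f: "\<And>s. \<bar>f s\<bar> \<le> c" for f :: "real ^ 'm \<Rightarrow> real" and c
  proof (rule Bochner_Integration.integrable_bound[where f="\<lambda>s. c * w (norm s)"])
    have "\<bar>f s\<bar> \<le> \<bar>c\<bar>" for s using f[of s] by linarith
    then show "AE s in lborel. norm (f s * w (norm s)) \<le> norm (c * w (norm s))"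
      by (intro AE_I2) (simp add: abs_mult mult_right_mono)
  qed (use w_int in simp_all)
  have i1: "integrable lborel (\<lambda>s. (((a s)\<^sup>2 + (b s)\<^sup>2) / n) * w (norm s))"
  proof (rule int)
    have "(a s)\<^sup>2 \<le> (2 * real n)\<^sup>2" "(b s)\<^sup>2 \<le> (2 * real n)\<^sup>2" for s
      using a_le[of s] b_le[of s] by (intro abs_le_square_iff[THEN iffD1]; simp)+
    then show "\<bar>((a s)\<^sup>2 + (b s)\<^sup>2) / n\<bar> \<le> ((2 * real n)\<^sup>2 + (2 * real n)\<^sup>2) / n" for s
      unfolding abs_divide abs_of_nat
      by (intro divide_right_mono order_trans[OF eq_refl[OF abs_of_nonneg] add_mono]) simp_all
  qed measurable
  have i2: "integrable lborel (\<lambda>s. (2 * a s * b s / n) * w (norm s))"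
  proof (rule int)
    show "\<bar>2 * a s * b s / n\<bar> \<le> 2 * (2 * real n) * (2 * real n) / n" for s
      unfolding abs_divide abs_mult abs_of_nat
      using a_le[of s] b_le[of s] by (intro divide_right_mono mult_mono) simp_all
  qed measurable
  have "(LINT s|lborel. (2 * a s * b s / n) * w (norm s)) = (LINT s|lborel. (2 * a (- s) * b (- s) / n) * w (norm (- s)))"
    by (rule lborel_integral_uminus[symmetric]) measurable
  also have "\<dots> = (LINT s|lborel. - ((2 * a s * b s / n) * w (norm s)))"
  proof (intro Bochner_Integration.integral_cong refl)
    fix s
    have "a (- s) = a s" "b (- s) = - b s"
      by (simp_all add: a_def b_def sum_negf[symmetric])
    then show "(2 * a (- s) * b (- s) / n) * w (norm (- s)) = - ((2 * a s * b s / n) * w (norm s))"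
      by simp
  qed
  finally have odd: "(LINT s|lborel. (2 * a s * b s / n) * w (norm s)) = 0" by simp
  have ecf: "real n * (cmod (ecf x n s - ecf y n s))\<^sup>2 = ((a s)\<^sup>2 + (b s)\<^sup>2) / n" for s
  proof -
    have "ecf x n s - ecf y n s = (1 / of_nat n) * (\<Sum>j=1..n. exp (\<i> * of_real (s \<bullet> x j)) - exp (\<i> * of_real (s \<bullet> y j)))"
      by (simp add: ecf_def sum_subtractf right_diff_distrib)
    also have "(\<Sum>j=1..n. exp (\<i> * of_real (s \<bullet> x j)) - exp (\<i> * of_real (s \<bullet> y j))) = Complex (a s) (b s)"
      by (simp add: complex_eq_iff a_def b_def Re_exp Im_exp)
    finally have "cmod (ecf x n s - ecf y n s) = cmod (Complex (a s) (b s)) / n"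
      by (simp add: norm_mult norm_divide)
    then have "(cmod (ecf x n s - ecf y n s))\<^sup>2 = ((a s)\<^sup>2 + (b s)\<^sup>2) / (real n)\<^sup>2"
      by (simp add: power_divide complex_norm)
    then show ?thesis
      using n by (simp add: power2_eq_square)
  qed
  have CS: "((\<Sum>j=1..n. CS_plus (s \<bullet> x j) - CS_plus (s \<bullet> y j)) / sqrt n)\<^sup>2
      = ((a s)\<^sup>2 + (b s)\<^sup>2) / n + 2 * a s * b s / n" for s
  proof -
    have "(\<Sum>j=1..n. CS_plus (s \<bullet> x j) - CS_plus (s \<bullet> y j)) = a s + b s"
      by (simp add: a_def b_def CS_plus_def sum.distrib[symmetric] algebra_simps)
    then show ?thesis by (simp add: power_divide power2_sum add_divide_distrib)
  qed
  have "real n * (LINT s|lborel. (cmod (ecf x n s - ecf y n s))\<^sup>2 * w (norm s))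
      = (LINT s|lborel. (real n * (cmod (ecf x n s - ecf y n s))\<^sup>2) * w (norm s))"
    by (subst integral_mult_right_zero[symmetric]) (simp only: mult.assoc)
  also have "\<dots> = (LINT s|lborel. (((a s)\<^sup>2 + (b s)\<^sup>2) / n) * w (norm s))"
    unfolding ecf ..
  also have "\<dots> = (LINT s|lborel. (((a s)\<^sup>2 + (b s)\<^sup>2) / n) * w (norm s) + (2 * a s * b s / n) * w (norm s))"
    using odd i1 i2 by simp
  also have "\<dots> = (LINT s|lborel. ((\<Sum>j=1..n. CS_plus (s \<bullet> x j) - CS_plus (s \<bullet> y j)) / sqrt n)\<^sup>2 * w (norm s))"
    unfolding CS distrib_right ..
  finally show ?thesis .
qed

lemma test_stat_eq_norm:
  fixes w :: "real \<Rightarrow> real" and z :: "nat \<Rightarrow> complex ^ 'd :: finite"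
  assumes w_pos: "\<And>r. r \<ge> 0 \<Longrightarrow> w r > 0" and w_meas: "w \<in> borel_measurable (restrict_space borel {0..})"
    and w_int: "integrable lborel (\<lambda>s :: real ^ ('d + 'd). w (norm s))"
    and S: "normalised_sum (\<lambda>i. ell_process (z (Suc i))) n \<in> L2_fun (H_measure w)"
  shows "test_stat w n z = (L2_norm (H_measure w) (normalised_sum (\<lambda>i. ell_process (z (Suc i))) n))\<^sup>2"
proof (cases "n = 0")
  case True
  then show ?thesis by (simp add: test_stat_def normalised_sum_def L2_norm_def)
next
  case False
  then have n: "n \<ge> 1" by simp
  let ?S = "normalised_sum (\<lambda>i. ell_process (z (Suc i))) n"
  let ?y = "\<lambda>\<theta> j. rot \<theta> *v RI (z j)"
  have S_eq: "?S (s, \<theta>) = (\<Sum>j=1..n. CS_plus (s \<bullet> RI (z j)) - CS_plus (s \<bullet> ?y \<theta> j)) / sqrt n" for s \<theta>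
  proof -
    \<comment> \<open>The sample is numbered from 1, the summands of \<open>normalised_sum\<close>
      from 0.\<close>
    have "(\<Sum>i<n. ell_process (z (Suc i)) (s, \<theta>)) = (\<Sum>j=1..n. ell_process (z j) (s, \<theta>))"
      by (rule sum.reindex_bij_witness[of _ "\<lambda>j. j - 1" Suc]) auto
    then show ?thesis by (simp add: normalised_sum_def ell_process_def ell_def)
  qed
  have "test_stat w n z = (LINT \<theta>:Theta|lborel. real n * (LINT s|lborel.
        (cmod (ecf (\<lambda>j. RI (z j)) n s - ecf (?y \<theta>) n s))\<^sup>2 * w (norm s)))"
    unfolding test_stat_def RI_rotate by simp
  also have "\<dots> = (LINT \<theta>:Theta|lborel. LINT s|lborel. (?S (s, \<theta>))\<^sup>2 * w (norm s))"
    unfolding set_integral_square_ecf_diff[OF w_int n] S_eq ..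
  also have "\<dots> = (L2_norm (H_measure w) ?S)\<^sup>2"
    by (rule H_norm_iterated[OF w_pos w_meas S, symmetric])
  finally show ?thesis .
qed

theorem corollary4p3:
  fixes P :: "'a measure"
    and Z :: "'a \<Rightarrow> complex ^ 'd"
    and Zs :: "nat \<Rightarrow> 'a \<Rightarrow> complex ^ 'd"
    and w :: "real \<Rightarrow> real"
  assumes P: "prob_space P"
    and indep: "prob_space.indep_vars P (\<lambda>_. borel) (\<lambda>j. if j = 0 then Z else Zs j) UNIV"
    and ident: "\<And>j. j \<ge> 1 \<Longrightarrow> distr P borel (Zs j) = distr P borel Z"
    and w_pos: "\<And>r. r \<ge> 0 \<Longrightarrow> w r > 0"
    and w_meas: "w \<in> borel_measurable (restrict_space borel {0..})"
    and w_int: "integrable lborel (\<lambda>s :: real ^ ('d + 'd). w (norm s))"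
    and H0: "\<And>\<theta>. \<theta> \<in> Theta \<Longrightarrow>
      distr P borel (\<lambda>\<omega>. exp (\<i> * of_real \<theta>) *s Z \<omega>) = distr P borel Z"
  shows
    "(\<exists>(N :: (nat \<Rightarrow> real) measure) V.
        gaussian_element N (H_measure w) V \<and> centred_element N (H_measure w) V \<and>
        covariance_kernel N (H_measure w) V (limit_kernel P Z) \<and>
        pointwise_covariance N (H_measure w) V (limit_kernel P Z)) \<and>
     (\<forall>(N :: 'b measure) V.
        gaussian_element N (H_measure w) V \<and> centred_element N (H_measure w) V \<and>
        covariance_kernel N (H_measure w) V (limit_kernel P Z) \<longrightarrow>
        weak_conv_m
          (\<lambda>n. distr P borel (\<lambda>\<omega>. test_stat w n (\<lambda>j. Zs j \<omega>)))
          (distr N borel (\<lambda>\<omega>. (L2_norm (H_measure w) (V \<omega>))\<^sup>2)))"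
proof -
  interpret P: prob_space P by (rule P)
  let ?M = "H_measure w :: ((real ^ ('d + 'd)) \<times> real) measure"
  obtain p where "discretised_measure ?M p"
    using discretised_H_measure[OF w_meas w_pos w_int] .
  then interpret M: discretised_measure ?M p .
  have rv: "(if j = 0 then Z else Zs j) \<in> borel_measurable P" for j
    using indep unfolding P.indep_vars_def2 by simp
  have Zm: "Z \<in> borel_measurable P" using rv[of 0] by simp
  have Zsm: "Zs (Suc i) \<in> borel_measurable P" for i using rv[of "Suc i"] by simp
  let ?Y = "ell_process :: complex ^ 'd \<Rightarrow> _"
  let ?K = "limit_kernel P Z"
  have Y1: "(\<lambda>u. ?Y (Z u) x) \<in> borel_measurable P" for x
    by (intro measurable_ell_process Zm) simp
  have Y_abs: "\<bar>?Y v x\<bar> \<le> 4" for v x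
    unfolding ell_process_def by (rule ell_abs_le)
  have Y_L2: "(\<lambda>u. ?Y (Z u) x) \<in> L2_fun P" for x
    using Y1 Y_abs by (rule P.L2_fun_bounded)
  have prod: "integrable P (\<lambda>u. ?Y (Z u) x * ?Y (Z u) y)" for x y
    by (intro L2_fun_integrable_mult Y_L2)
  have id_meas: "(\<lambda>x. x) \<in> borel_measurable ?M"
    by (rule M.borel_measurable_M) simp

  have "psd_kernel ?K"
    unfolding psd_kernel_def
  proof (intro conjI allI)
    show "?K x y = ?K y x" for x y by (simp add: limit_kernel_eq mult.commute)
    fix n and c :: "nat \<Rightarrow> real" and x :: "nat \<Rightarrow> (real ^ ('d + 'd)) \<times> real"
    have "(\<Sum>i<n. \<Sum>j<n. c i * c j * ?K (x i) (x j))
        = (LINT u|P. (\<Sum>i<n. \<Sum>j<n. (c i * c j) * (?Y (Z u) (x i) * ?Y (Z u) (x j))))"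
      unfolding limit_kernel_eq
      by (simp only: Bochner_Integration.integral_sum Bochner_Integration.integrable_sum
          integrable_mult_right prod integral_mult_right_zero)
    also have "\<dots> = (LINT u|P. (\<Sum>i<n. c i * ?Y (Z u) (x i))\<^sup>2)"
      by (simp add: power2_eq_square sum_product ac_simps)
    finally show "0 \<le> (\<Sum>i<n. \<Sum>j<n. c i * c j * ?K (x i) (x j))" by simp
  qed
  moreover have "(\<lambda>x. ?K x y) \<in> borel_measurable ?M" "(\<lambda>x. ?K x x) \<in> borel_measurable ?M" for y
  proof -
    note rules = borel_measurable_times[OF measurable_ell_process measurable_ell_process]
      measurable_compose[OF measurable_fst id_meas] measurable_compose[OF measurable_snd Zm]
    show "(\<lambda>x. ?K x y) \<in> borel_measurable ?M" "(\<lambda>x. ?K x x) \<in> borel_measurable ?M" for y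
      unfolding limit_kernel_eq
      by (rule P.borel_measurable_lebesgue_integral, unfold case_prod_unfold,
          intro rules borel_measurable_const)+
  qed
  \<comment> \<open>16 = 4 * 4, from the bound 4 on \<open>ell\<close>.\<close>
  moreover have "?K x x \<le> 16" for x
  proof -
    have "\<bar>?Y v x * ?Y v x\<bar> \<le> 4 * 4" for v
      unfolding abs_mult by (intro mult_mono Y_abs) auto
    then have "(LINT u|P. ?Y (Z u) x * ?Y (Z u) x) \<le> (LINT u|P. 16)"
      by (intro integral_mono prod) (auto simp: abs_le_iff)
    then show ?thesis by (simp add: limit_kernel_eq P.prob_space)
  qed
  moreover obtain D :: "((real ^ ('d + 'd)) \<times> real) set" where
    D: "countable D" "\<And>X. open X \<Longrightarrow> X \<noteq> {} \<Longrightarrow> \<exists>d\<in>D. d \<in> X"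
    using countable_dense_exists by blast
  \<comment> \<open>A topologically dense sequence is dense in the canonical distance:
    \<open>ell_process\<close> is continuous with differences bounded by 4 + 4 = 8, so its mean
    square increments vanish along a sequence tending to x.\<close>
  moreover have "\<exists>k. ?K x x - 2 * ?K x (from_nat_into D k) + ?K (from_nat_into D k) (from_nat_into D k) < e"
    if e: "e > 0" for x e
  proof -
    have "\<exists>d\<in>D. dist d x < 1 / real (Suc i)" for i
      using D(2)[of "ball x (1 / real (Suc i))"] by (auto simp: dist_commute)
    then obtain d where d: "\<And>i. d i \<in> D" "\<And>i. dist (d i) x < 1 / real (Suc i)" by metis
    have "(\<lambda>i. dist (d i) x) \<longlonglongrightarrow> 0"
      by (rule Lim_null_comparison[OF _ LIMSEQ_inverse_real_of_nat])
        (use d(2) in \<open>simp add: less_imp_le inverse_eq_divide\<close>)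
    then have lim: "d \<longlonglongrightarrow> x" by (rule tendsto_dist_iff[THEN iffD2])
    have "(\<lambda>i. LINT u|P. (?Y (Z u) x - ?Y (Z u) (d i))\<^sup>2) \<longlonglongrightarrow> (LINT u|P. 0)"
    proof (rule integral_dominated_convergence[where w="\<lambda>_. 8\<^sup>2"])
      show "(\<lambda>u. (?Y (Z u) x - ?Y (Z u) (d i))\<^sup>2) \<in> borel_measurable P" for i
        by (intro borel_measurable_power borel_measurable_diff Y1)
      show "AE u in P. (\<lambda>i. (?Y (Z u) x - ?Y (Z u) (d i))\<^sup>2) \<longlonglongrightarrow> 0"
      proof (rule AE_I2)
        fix u
        have "(\<lambda>i. ?Y (fst (Z u, d i)) (snd (Z u, d i))) \<longlonglongrightarrow> ?Y (fst (Z u, x)) (snd (Z u, x))"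
          by (rule continuous_on_tendsto_compose[OF continuous_ell_process]) (auto intro!: tendsto_intros lim)
        then have "(\<lambda>i. (?Y (Z u) x - ?Y (Z u) (d i))\<^sup>2) \<longlonglongrightarrow> (?Y (Z u) x - ?Y (Z u) x)\<^sup>2"
          by (intro tendsto_intros) simp
        then show "(\<lambda>i. (?Y (Z u) x - ?Y (Z u) (d i))\<^sup>2) \<longlonglongrightarrow> 0" by simp
      qed
      show "AE u in P. norm ((?Y (Z u) x - ?Y (Z u) (d i))\<^sup>2) \<le> 8\<^sup>2" for i
      proof (rule AE_I2)
        fix u
        have "\<bar>?Y (Z u) x - ?Y (Z u) (d i)\<bar> \<le> \<bar>8\<bar>"
          using Y_abs[of "Z u" x] Y_abs[of "Z u" "d i"] by linarith
        then show "norm ((?Y (Z u) x - ?Y (Z u) (d i))\<^sup>2) \<le> 8\<^sup>2"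
          unfolding abs_le_square_iff by simp
      qed
    qed simp_all
    then have "(\<lambda>i. LINT u|P. (?Y (Z u) x - ?Y (Z u) (d i))\<^sup>2) \<longlonglongrightarrow> 0" by simp
    from order_tendstoD(2)[OF this e] obtain i where
      i: "(LINT u|P. (?Y (Z u) x - ?Y (Z u) (d i))\<^sup>2) < e"
      unfolding eventually_sequentially by blast
    \<comment> \<open>Expanding the square identifies the mean square increment with the squared
      canonical distance.\<close>
    have "(LINT u|P. (?Y (Z u) x - ?Y (Z u) (d i))\<^sup>2) = ?K x x - 2 * ?K x (d i) + ?K (d i) (d i)"
      using L2_norm_diff_power2[OF Y_L2[of x] Y_L2[of "d i"], unfolded L2_norm_power2 L2_inner_def]
      by (simp add: limit_kernel_eq power2_eq_square)
    moreover obtain k where "d i = from_nat_into D k"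
      using from_nat_into_surj[OF D(1) d(1)] by metis
    ultimately show ?thesis using i by metis
  qed
  ultimately have ex: "gaussian_element normals ?M (M.gauss_process ?K (from_nat_into D))"
      "centred_element normals ?M (M.gauss_process ?K (from_nat_into D))"
      "covariance_kernel normals ?M (M.gauss_process ?K (from_nat_into D)) ?K"
      "pointwise_covariance normals ?M (M.gauss_process ?K (from_nat_into D)) ?K"
    by (intro M.gauss_process_properties[where C=16]; blast)+

  define W where "W i = Zs (Suc i)" for i
  have indW: "P.indep_vars (\<lambda>_. borel) W UNIV"
  proof -
    let ?X = "\<lambda>j. if j = 0 then Z else Zs j"
    \<comment> \<open>Index 0 of the independent family is Z itself; the singleton blocks {Suc j}
      drop it and renumber the sample from 0.\<close>
    have "P.indep_vars (\<lambda>j. Pi\<^sub>M {Suc j} (\<lambda>_. borel)) (\<lambda>j u. restrict (\<lambda>i. ?X i u) {Suc j}) UNIV"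
      using indep by (rule P.indep_vars_restrict) (auto simp: disjoint_family_on_def)
    then have "P.indep_vars (\<lambda>_. borel) (\<lambda>j u. restrict (\<lambda>i. ?X i u) {Suc j} (Suc j)) UNIV"
      by (rule P.indep_vars_compose2) (rule measurable_component_singleton, simp)
    then show ?thesis by (simp add: W_def[abs_def])
  qed
  have identW: "distr P borel (W i) = distr P borel Z" for i
    unfolding W_def by (rule ident) simp
  have Wm: "W i \<in> borel_measurable P" for i unfolding W_def by (rule Zsm)
  have transfer: "(LINT u|P. f (W i u)) = (LINT u|P. f (Z u))"
    if f: "f \<in> borel_measurable borel" for f :: "complex ^ 'd \<Rightarrow> real" and i
  proof -
    have "(LINT u|P. f (W i u)) = (LINT v|distr P borel (W i). f v)"
      by (rule integral_distr[OF Wm f, symmetric])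
    also have "\<dots> = (LINT v|distr P borel Z. f v)" by (simp only: identW)
    also have "\<dots> = (LINT u|P. f (Z u))" by (rule integral_distr[OF Zm f])
    finally show ?thesis .
  qed
  have Yv: "(\<lambda>v. ?Y v x) \<in> borel_measurable borel" for x
    by (intro measurable_ell_process) simp_all
  have centred: "(LINT u|P. ?Y (W 0 u) x) = 0" if x: "x \<in> space ?M" for x
  proof -
    obtain s \<theta> where x_eq: "x = (s, \<theta>)" and th: "\<theta> \<in> Theta"
      using x by (auto simp: space_H_measure)
    let ?f = "\<lambda>z :: complex ^ 'd. CS_plus (s \<bullet> RI z)" and ?r = "\<lambda>z :: complex ^ 'd. exp (\<i> * of_real \<theta>) *s z"
    have fm: "?f \<in> borel_measurable borel"
      unfolding CS_plus_def
      by (intro borel_measurable_continuous_onI continuous_intros continuous_on_RI)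
    have rm: "(\<lambda>u. ?r (Z u)) \<in> borel_measurable P"
    proof (rule measurable_compose[OF Zm borel_measurable_continuous_onI])
      show "continuous_on UNIV ?r"
        unfolding vector_scalar_mult_def by (intro continuous_on_vec_lambda continuous_intros)
    qed
    have int: "integrable P (\<lambda>u. ?f (g u))" if "g \<in> borel_measurable P" for g
      by (intro P.integrable_const_bound[where B=2] AE_I2 measurable_compose[OF that fm])
        (simp add: CS_plus_abs_le)
    \<comment> \<open>Rotating the real vector amounts to multiplying Z by a unit complex number, so
      circular symmetry gives both terms the same expectation.\<close>
    have "(LINT u|P. ?Y (W 0 u) x) = (LINT u|P. ?f (Z u) - ?f (?r (Z u)))"
      unfolding transfer[OF Yv] by (simp add: x_eq ell_process_def ell_def RI_rotate)
    also have "\<dots> = (LINT u|P. ?f (Z u)) - (LINT u|P. ?f (?r (Z u)))"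
      by (intro Bochner_Integration.integral_diff int Zm rm)
    also have "(LINT u|P. ?f (?r (Z u))) = (LINT v|distr P borel (\<lambda>u. ?r (Z u)). ?f v)"
      by (rule integral_distr[OF rm fm, symmetric])
    also have "\<dots> = (LINT v|distr P borel Z. ?f v)" by (simp only: H0[OF th])
    also have "\<dots> = (LINT u|P. ?f (Z u))" by (rule integral_distr[OF Zm fm])
    finally show ?thesis by simp
  qed
  have Yjoint: "(\<lambda>(v, x). ?Y v x) \<in> borel_measurable (borel \<Otimes>\<^sub>M ?M)"
    unfolding case_prod_unfold
    by (intro measurable_ell_process measurable_compose[OF measurable_snd id_meas]) simp
  \<comment> \<open>The general theorem states the kernel through the first sample variable, which
    has the law of Z.\<close>
  have K: "?K = (\<lambda>x y. LINT u|P. ?Y (W 0 u) x * ?Y (W 0 u) y)"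
    unfolding limit_kernel_eq
    by (intro ext transfer[symmetric] borel_measurable_times Yv)
  have identW0: "distr P borel (W i) = distr P borel (W 0)" for i by (simp only: identW)
  note sample = P indW identW0 Yjoint Y_abs centred
  have stat: "distr P borel (\<lambda>u. test_stat w n (\<lambda>j. Zs j u))
      = distr P borel (\<lambda>u. (L2_norm ?M (normalised_sum (\<lambda>i. ?Y (W i u)) n))\<^sup>2)" for n
  proof (intro distr_cong refl)
    fix u assume "u \<in> space P"
    from M.normalised_sum_L2_fun[OF sample this, of n]
    show "test_stat w n (\<lambda>j. Zs j u) = (L2_norm ?M (normalised_sum (\<lambda>i. ?Y (W i u)) n))\<^sup>2"
      unfolding W_def by (intro test_stat_eq_norm w_pos w_meas w_int)
  qed
  show ?thesis
  proof (intro conjI allI impI)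
    show "\<exists>(N :: (nat \<Rightarrow> real) measure) V. gaussian_element N ?M V \<and> centred_element N ?M V \<and>
        covariance_kernel N ?M V ?K \<and> pointwise_covariance N ?M V ?K"
      using ex by blast
    fix N :: "'b measure" and V
    assume "gaussian_element N ?M V \<and> centred_element N ?M V \<and> covariance_kernel N ?M V ?K"
    then show "weak_conv_m (\<lambda>n. distr P borel (\<lambda>u. test_stat w n (\<lambda>j. Zs j u)))
        (distr N borel (\<lambda>u. (L2_norm ?M (V u))\<^sup>2))"
      unfolding stat K by (intro M.weak_conv_square_norm_normalised_sum[OF sample]) auto
  qed
qed

end
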